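(* Let $q\ge2$ and let $f,g:\mathbb{D}\to\mathbb{C}$ be continuous functions which are the isotropic parts of two positive definite kernels on $\Omega_{2q}$, with series representations $$f(z)=\sum_{m,n=0}^\infty a_{m,n}(f)R_{m,n}^{q-2}(z),\qquad g(z)=\sum_{m,n=0}^\infty a_{m,n}(g)R_{m,n}^{q-2}(z),\qquad z\in\mathbb{D},$$ where all coefficients are nonnegative and both series converge at $z=1$. Then $fg$ is the isotropic part of a strictly positive definite kernel on $\Omega_{2q}$ if, and only if, the set $$\{(m-n)+(m'-n'):\ m,n,m',n'\in\mathbb{Z}_+,\ a_{m,n}(f)a_{m',n'}(g)>0\}$$ intersects every full arithmetic progression in $\mathbb{Z}$.
   Context: $\Omega_{2q}$ is the unit sphere in $\mathbb{C}^q$, $\cdot$ is the usual Hermitian inner product of $\mathbb{C}^q$, and $\mathbb{D}=\{z\in\mathbb{C}:|z|\le1\}$. For $q\ge2$, a continuous function $f:\mathbb{D}\to\mathbb{C}$ is called the isotropic part of the kernel $K(x,y)=f(x\cdot y)$, $x,y\in\Omega_{2q}$. The kernel $K$ is positive definite if $\sum_{i,j=1}^n c_i\overline{c_j}K(x_i,x_j)\ge0$ for all $n\ge1$, all distinct $x_1,\dots,x_n\in\Omega_{2q}$ and all complex $c_1,\dots,c_n$; it is strictly positive definite if in addition the inequality is strict whenever $c_1,\dots,c_n$ are not all zero. $R_{m,n}^{q-2}$ is the disk (Zernike) polynomial of bi-degree $(m,n)$ associated with the integer $q-2$: for $z=re^{i\theta}\in\mathbb{D}$, $$R_{m,n}^{q-2}(z)=r^{|m-n|}e^{i(m-n)\theta}\,\frac{P_{\min(m,n)}^{(q-2,|m-n|)}(2r^2-1)}{P_{\min(m,n)}^{(q-2,|m-n|)}(1)},$$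 with $P_k^{(\alpha,\beta)}$ the usual Jacobi polynomials. It is known that, for $q\ge 2$, a continuous $f$ is the isotropic part of a positive definite kernel on $\Omega_{2q}$ if and only if it has a (unique) representation $f(z)=\sum_{m,n\ge0}a_{m,n}(f)R_{m,n}^{q-2}(z)$, $z\in\mathbb{D}$, with all $a_{m,n}(f)\ge0$ and the series convergent at $z=1$. A full arithmetic progression in $\mathbb{Z}$ is a set $n\mathbb{Z}+j=\{nl+j:l\in\mathbb{Z}\}$ with $n,j\in\mathbb{N}$ and $n\ge2$. $\mathbb{Z}_+$ is the set of nonnegative integers. *)

theory Defs
  imports "HOL-Analysis.Analysis" "HOL-Library.Complex_Order"
begin

text \<open>
  The space \<open>\<complex>\<^sup>q\<close> is \<^typ>\<open>complex ^ 'q\<close> with \<open>q = CARD('q)\<close>. Its norm is the Hermitian norm, so that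
  \<open>\<Omega>\<^sub>2\<^sub>q\<close> is \<open>sphere 0 1\<close>; its library inner product \<open>(\<bullet>)\<close>, however, is only the real part of the
  Hermitian one.
\<close>

definition hermitian_inner :: "complex ^ 'q \<Rightarrow> complex ^ 'q \<Rightarrow> complex" where
  "hermitian_inner x y = (\<Sum>i\<in>UNIV. x $ i * cnj (y $ i))"

definition isotropic_kernel :: "(complex \<Rightarrow> complex) \<Rightarrow> complex ^ 'q \<Rightarrow> complex ^ 'q \<Rightarrow> complex" where
  "isotropic_kernel f x y = f (hermitian_inner x y)"

text \<open>
  In the order on \<^typ>\<open>complex\<close>, \<open>0 \<le> z\<close> and \<open>0 < z\<close> include that \<open>z\<close> is real.
\<close>

definition positive_definite :: "(complex ^ 'q \<Rightarrow> complex ^ 'q \<Rightarrow> complex) \<Rightarrow> bool" where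
  "positive_definite K \<longleftrightarrow>
     (\<forall>n\<ge>(1::nat). \<forall>x c. x ` {..<n} \<subseteq> sphere 0 1 \<longrightarrow> inj_on x {..<n} \<longrightarrow>
        0 \<le> (\<Sum>i<n. \<Sum>j<n. c i * cnj (c j) * K (x i) (x j)))"

definition strictly_positive_definite :: "(complex ^ 'q \<Rightarrow> complex ^ 'q \<Rightarrow> complex) \<Rightarrow> bool" where
  "strictly_positive_definite K \<longleftrightarrow>
     positive_definite K \<and>
     (\<forall>n\<ge>(1::nat). \<forall>x c. x ` {..<n} \<subseteq> sphere 0 1 \<longrightarrow> inj_on x {..<n} \<longrightarrow> (\<exists>i<n. c i \<noteq> 0) \<longrightarrow>
        0 < (\<Sum>i<n. \<Sum>j<n. c i * cnj (c j) * K (x i) (x j)))"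

text \<open>
  The Jacobi polynomial \<open>P\<^sub>k\<close> with parameters \<open>\<alpha>, \<beta>\<close> (in the classical range \<open>\<alpha>, \<beta> > -1\<close>), by the
  explicit formula that results from expanding the Rodrigues formula with the Leibniz rule.
\<close>

definition jacobi_poly :: "real \<Rightarrow> real \<Rightarrow> nat \<Rightarrow> real \<Rightarrow> real" where
  "jacobi_poly \<alpha> \<beta> k x =
     (\<Sum>s\<le>k. ((real k + \<alpha>) gchoose (k - s)) * ((real k + \<beta>) gchoose s)
            * ((x - 1) / 2) ^ s * ((x + 1) / 2) ^ (k - s))"

text \<open>
  At \<open>z = 0\<close> the value of \<^const>\<open>Arg\<close> is irrelevant: the radius factor vanishes if \<open>m \<noteq> n\<close>, and the
  angle is multiplied by \<open>0\<close> if \<open>m = n\<close>.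
\<close>

definition disk_poly :: "nat \<Rightarrow> nat \<Rightarrow> nat \<Rightarrow> complex \<Rightarrow> complex" where
  "disk_poly \<alpha> m n z =
     (let d = int m - int n; b = real_of_int \<bar>d\<bar>; k = min m n; r = cmod z in
        rcis (r ^ nat \<bar>d\<bar>) (real_of_int d * Arg z)
        * of_real (jacobi_poly (real \<alpha>) b k (2 * r\<^sup>2 - 1) / jacobi_poly (real \<alpha>) b k 1))"

definition full_arith_progressions :: "int set set" where
  "full_arith_progressions = {range (\<lambda>l. int n * l + int j) | n j. 2 \<le> n}"

end

theory Submission
  imports Defs "HOL-Computational_Algebra.Polynomial"
begin

text \<open>
  Split \<open>f\<close> and \<open>g\<close> into their parts \<open>f\<^sub>d\<close>, \<open>g\<^sub>d\<close> of degree \<open>d = m - n\<close>, which satisfy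
  \<open>f\<^sub>d (\<zeta> z) = \<zeta>\<^sup>d f\<^sub>d z\<close> for unimodular \<open>\<zeta>\<close>. Averaging over roots of unity and the Schur product
  theorem show that a quadratic form of \<open>f g\<close> can vanish only if those of all products \<open>f\<^sub>d g\<^sub>d\<^sub>'\<close>
  vanish. Since \<open>f\<^sub>d z / f\<^sub>d 1\<close> tends to \<open>0\<close> as \<open>d\<close> tends to infinity for \<open>\<bar>z\<bar> < 1\<close>, for large
  \<open>d + d'\<close> such a form is nearly diagonal once points on a common circle \<open>{\<zeta> y. \<bar>\<zeta>\<bar> = 1}\<close> are
  merged. Hence for every circle the exponential sum \<open>\<Sum> c\<^sub>i \<zeta>\<^sub>i\<^sup>e\<close> vanishes at all large \<open>e = d + d'\<close>
  that occur. A nonzero exponential sum, however, has no zero on some full arithmetic progression.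
  Conversely, if a progression \<open>n\<int> + j\<close> is missed, the points \<open>\<omega>\<^sup>k x\<close> with \<open>\<omega>\<close> a primitive \<open>n\<close>-th root
  of unity and the coefficients \<open>\<omega>\<^sup>-\<^sup>j\<^sup>k\<close> annihilate the form.
\<close>

section \<open>Exponential sums and residual finiteness\<close>

text \<open>Positive definiteness speaks of finite sums only, so averaging over \<open>N\<close>-th
  roots of unity isolates a residue class of degrees modulo \<open>N\<close>; a single degree
  appears only as \<open>N\<close> tends to infinity. Residue classes also keep every complement a
  finite sum of positive semidefinite forms.

  The analytic obstacle is that the part of degree \<open>d\<close> is an infinite series over
  \<open>min m n\<close>, so the decay in \<open>d\<close> must be uniform in the degree of the
  Jacobi factor. For parameter 0 this comes from an integral representation; a contiguous relation
  then raises the parameter.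

  On the arithmetic side, one zero-free progression is all that is required of an exponential sum,
  and reduction modulo an ideal of finite index provides it. The coefficients and points are
  arbitrary complex numbers, so the ring that contains them has to be built through transcendental
  as well as algebraic elements.

  The vanishing of the exponential sums is known only away from a bounded interval of exponents. As
  progressions are two-sided, the zero-free one is first thinned until it avoids that
  interval.\<close>

definition subring_of :: "'a::comm_ring_1 set \<Rightarrow> bool" where
  "subring_of A \<longleftrightarrow> 1 \<in> A \<and> (\<forall>x\<in>A. \<forall>y\<in>A. x - y \<in> A \<and> x * y \<in> A)"

definition ideal_of :: "'a::comm_ring_1 set \<Rightarrow> 'a set \<Rightarrow> bool" where
  "ideal_of A M \<longleftrightarrow> M \<subseteq> A \<and> 0 \<in> M \<and> (\<forall>x\<in>M. \<forall>y\<in>M. x - y \<in> M) \<and> (\<forall>x\<in>A. \<forall>y\<in>M. x * y \<in> M)"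

definition polys_over :: "'a::comm_ring_1 set \<Rightarrow> 'a poly set" where
  "polys_over A = {p. \<forall>i. coeff p i \<in> A}"

definition adjoin :: "'a::comm_ring_1 set \<Rightarrow> 'a \<Rightarrow> 'a set" where
  "adjoin A x = (\<lambda>p. poly p x) ` polys_over A"

text \<open>Invertibility of \<open>v\<close> modulo \<open>M\<close>, and not merely
  \<open>v \<notin> M\<close>, is what lets the property pass to algebraic adjunctions: leading
  coefficients have to be cancelled modulo \<open>M\<close> there.\<close>

definition finite_index_unit :: "'a::comm_ring_1 set \<Rightarrow> 'a \<Rightarrow> 'a set \<Rightarrow> bool" where
  "finite_index_unit A v M \<longleftrightarrow>
     ideal_of A M \<and> 1 \<notin> M \<and> (\<exists>F. finite F \<and> F \<subseteq> A \<and> (\<forall>y\<in>A. \<exists>f\<in>F. y - f \<in> M)) \<and> (\<exists>w\<in>A. v * w - 1 \<in> M)"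

definition residually_finite :: "'a::comm_ring_1 set \<Rightarrow> bool" where
  "residually_finite A \<longleftrightarrow> (\<forall>v\<in>A. v \<noteq> 0 \<longrightarrow> (\<exists>M. finite_index_unit A v M))"

lemma subring_ofD:
  assumes "subring_of A"
  shows "1 \<in> A" "0 \<in> A" "x \<in> A \<Longrightarrow> y \<in> A \<Longrightarrow> x - y \<in> A" "x \<in> A \<Longrightarrow> y \<in> A \<Longrightarrow> x * y \<in> A"
    "x \<in> A \<Longrightarrow> - x \<in> A" "x \<in> A \<Longrightarrow> y \<in> A \<Longrightarrow> x + y \<in> A" "x \<in> A \<Longrightarrow> x ^ n \<in> A"
proof -
  show 1: "1 \<in> A" and 2: "\<And>x y. x \<in> A \<Longrightarrow> y \<in> A \<Longrightarrow> x - y \<in> A" and 3: "\<And>x y. x \<in> A \<Longrightarrow> y \<in> A \<Longrightarrow> x * y \<in> A"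
    using assms by (auto simp: subring_of_def)
  show 0: "0 \<in> A" using 2[OF 1 1] by simp
  show 4: "\<And>x. x \<in> A \<Longrightarrow> - x \<in> A" using 2[OF 0] by simp
  show "x \<in> A \<Longrightarrow> y \<in> A \<Longrightarrow> x + y \<in> A" using 2[OF _ 4] by force
  show "x \<in> A \<Longrightarrow> x ^ n \<in> A" by (induction n) (auto intro: 1 3)
qed

lemma ideal_ofD:
  assumes "ideal_of A M"
  shows "x \<in> M \<Longrightarrow> x \<in> A" "0 \<in> M" "x \<in> M \<Longrightarrow> y \<in> M \<Longrightarrow> x - y \<in> M" "x \<in> A \<Longrightarrow> y \<in> M \<Longrightarrow> x * y \<in> M"
    "x \<in> M \<Longrightarrow> y \<in> A \<Longrightarrow> x * y \<in> M" "x \<in> M \<Longrightarrow> - x \<in> M" "x \<in> M \<Longrightarrow> y \<in> M \<Longrightarrow> x + y \<in> M"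
proof -
  show 0: "0 \<in> M" and 2: "\<And>x y. x \<in> M \<Longrightarrow> y \<in> M \<Longrightarrow> x - y \<in> M" 
    and 3: "\<And>x y. x \<in> A \<Longrightarrow> y \<in> M \<Longrightarrow> x * y \<in> M" and "x \<in> M \<Longrightarrow> x \<in> A"
    using assms by (auto simp: ideal_of_def)
  show "x \<in> M \<Longrightarrow> y \<in> A \<Longrightarrow> x * y \<in> M" using 3[of y x] by (simp add: mult.commute)
  show 4: "\<And>x. x \<in> M \<Longrightarrow> - x \<in> M" using 2[OF 0] by simp
  show "x \<in> M \<Longrightarrow> y \<in> M \<Longrightarrow> x + y \<in> M" using 2[OF _ 4] by force
qed

lemma sum_mem_closed:
  fixes f :: "'b \<Rightarrow> 'a::comm_monoid_add"
  assumes "0 \<in> A" "\<And>x y. x \<in> A \<Longrightarrow> y \<in> A \<Longrightarrow> x + y \<in> A" "\<And>i. i \<in> I \<Longrightarrow> f i \<in> A"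
  shows "sum f I \<in> A"
  using assms(3) by (induction I rule: infinite_finite_induct) (auto intro: assms(1,2))

lemma polys_over_ideal_mult:
  assumes "ideal_of A M" "p \<in> polys_over A" "q \<in> polys_over M"
  shows "p * q \<in> polys_over M"
  using assms unfolding polys_over_def
  by (auto simp: coeff_mult intro!: sum_mem_closed ideal_ofD(2,4,7)[OF assms(1)])

lemma subring_of_polys_over:
  assumes "subring_of A" shows "subring_of (polys_over A)"
  unfolding subring_of_def polys_over_def
  by (auto simp: coeff_mult intro!: sum_mem_closed subring_ofD[OF assms])

lemma const_in_polys_over: "0 \<in> A \<Longrightarrow> c \<in> A \<Longrightarrow> [:c:] \<in> polys_over A"
  by (auto simp: polys_over_def coeff_pCons split: nat.splits)

lemma smult_in_polys_over: "subring_of A \<Longrightarrow> c \<in> A \<Longrightarrow> p \<in> polys_over A \<Longrightarrow> smult c p \<in> polys_over A"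
  by (auto simp: polys_over_def intro: subring_ofD)

lemma monom_in_polys_over: "0 \<in> A \<Longrightarrow> c \<in> A \<Longrightarrow> monom c n \<in> polys_over A"
  by (auto simp: polys_over_def)

lemma subring_of_adjoin:
  assumes "subring_of A" shows "subring_of (adjoin A x)" "A \<subseteq> adjoin A x" "x \<in> adjoin A x"
proof -
  note S = subring_of_polys_over[OF assms]
  show "subring_of (adjoin A x)"
    unfolding subring_of_def adjoin_def
    by (auto simp flip: poly_diff poly_mult intro!: imageI subring_ofD[OF S])
      (metis S imageI poly_1 subring_ofD(1))
  show "A \<subseteq> adjoin A x"
  proof
    fix c assume "c \<in> A"
    then show "c \<in> adjoin A x"
      unfolding adjoin_def using const_in_polys_over[OF subring_ofD(2)[OF assms], of c]
      by (intro image_eqI[of _ _ "[:c:]"]) auto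
  qed
  show "x \<in> adjoin A x"
    unfolding adjoin_def using monom_in_polys_over[OF subring_ofD(2,1)[OF assms], of 1]
    by (intro image_eqI[of _ _ "monom 1 1"]) (auto simp: poly_monom)
qed

section \<open>Pseudo-division over a subring and adjunction of one element\<close>

lemma pseudo_division_over:
  fixes g :: "'a::idom poly"
  assumes A: "subring_of A" and g: "g \<in> polys_over A" "g \<noteq> 0" and p: "p \<in> polys_over A"
  shows "\<exists>k. \<exists>q\<in>polys_over A. \<exists>r\<in>polys_over A.
           smult (lead_coeff g ^ k) p = q * g + r \<and> (r = 0 \<or> degree r < degree g)"
  using p
\<comment> \<open>The zero polynomial ranks below the constants: cancelling the leading term of a
  constant leaves \<open>p' = 0\<close> without lowering the degree.\<close>
proof (induction "if p = 0 then 0 else Suc (degree p)" arbitrary: p rule: less_induct)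
  case less
  note S = subring_of_polys_over[OF A]
  show ?case
  proof (cases "p = 0 \<or> degree p < degree g")
    case True
    then show ?thesis using less.prems subring_ofD(2)[OF S]
      by (intro exI[of _ 0] bexI[of _ 0] bexI[of _ p]) auto
  next
    case False
    define b where "b = lead_coeff g"
    define m where "m = monom (lead_coeff p) (degree p - degree g)"
    define p' where "p' = smult b p - m * g"
    have b: "b \<in> A" "lead_coeff p \<in> A" using g less.prems by (auto simp: polys_over_def b_def)
    have m: "m \<in> polys_over A" using b monom_in_polys_over[OF subring_ofD(2)[OF A]] by (simp add: m_def)
    have p': "p' \<in> polys_over A" unfolding p'_def
      using less.prems g m b by (auto intro!: subring_ofD[OF S] smult_in_polys_over[OF A])
    have "p' = 0 \<or> degree p' < degree p"
    proof (cases "p' = 0")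
      case False
      have "degree p' \<le> degree p"
        unfolding p'_def
      proof (rule degree_diff_le)
        show "degree (smult b p) \<le> degree p" by simp
        have "degree (m * g) \<le> degree m + degree g" by (rule degree_mult_le)
        also have "degree m \<le> degree p - degree g" unfolding m_def by (rule degree_monom_le)
        finally show "degree (m * g) \<le> degree p" using \<open>\<not> (p = 0 \<or> degree p < degree g)\<close> by simp
      qed
      moreover have "coeff p' (degree p) = 0"
      proof -
        have "coeff (m * g) (degree p) = lead_coeff p * coeff g (degree g)"
          using \<open>\<not> (p = 0 \<or> degree p < degree g)\<close> by (simp add: m_def coeff_monom_mult)
        then show ?thesis by (simp add: p'_def b_def)
      qed
      ultimately show ?thesis using False
        by (metis le_neq_implies_less leading_coeff_0_iff)
    qed simp
    with False have "(if p' = 0 then 0 else Suc (degree p')) < (if p = 0 then 0 else Suc (degree p))" by auto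
    from less.hyps[OF this p'] obtain k q r where
      *: "q \<in> polys_over A" "r \<in> polys_over A" "smult (b ^ k) p' = q * g + r" "r = 0 \<or> degree r < degree g"
      unfolding b_def by blast
    have "smult (b ^ Suc k) p = (q + smult (b ^ k) m) * g + r"
      using *(3) by (simp add: p'_def algebra_simps smult_diff_right)
    moreover have "q + smult (b ^ k) m \<in> polys_over A"
      using * m b by (auto intro!: subring_ofD[OF S] smult_in_polys_over[OF A] subring_ofD(7)[OF A])
    ultimately show ?thesis using * unfolding b_def by blast
  qed
qed

lemma residually_finite_Ints: "residually_finite (\<int> :: 'a::{comm_ring_1,ring_char_0} set)"
  unfolding residually_finite_def
proof (intro ballI impI)
  fix v :: 'a assume "v \<in> \<int>" "v \<noteq> 0"
  then obtain k where k: "v = of_int k" "k \<noteq> 0" by (auto elim!: Ints_cases)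
  \<comment> \<open>Modulo \<open>\<bar>k\<bar> + 1\<close> the number \<open>k\<close> is congruent
    to 1 or -1, so that \<open>- sgn k\<close> is its inverse.\<close>
  define n where "n = \<bar>k\<bar> + 1"
  have n: "n \<ge> 2" using k by (auto simp: n_def)
  define M :: "'a set" where "M = (\<lambda>l. of_int (n * l)) ` UNIV"
  have "ideal_of \<int> M"
    unfolding ideal_of_def M_def
  proof (intro conjI ballI)
    show "(0::'a) \<in> range (\<lambda>l. of_int (n * l))" by (rule image_eqI[of _ _ 0]) auto
    fix x y :: 'a assume "y \<in> range (\<lambda>l. of_int (n * l))"
    then obtain l where l: "y = of_int (n * l)" by auto
    {
      assume "x \<in> range (\<lambda>l. of_int (n * l))"
      then obtain l' where "x = of_int (n * l')" by auto
      with l show "x - y \<in> range (\<lambda>l. of_int (n * l))"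
        by (intro image_eqI[of _ _ "l' - l"]) (auto simp: algebra_simps)
    next
      assume "x \<in> \<int>"
      then obtain l' where "x = of_int l'" by (auto elim: Ints_cases)
      with l show "x * y \<in> range (\<lambda>l. of_int (n * l))"
        by (intro image_eqI[of _ _ "l' * l"]) (auto simp: algebra_simps)
    }
  qed auto
  moreover have "1 \<notin> M"
  proof
    assume "1 \<in> M"
    then obtain l where "(of_int 1 :: 'a) = of_int (n * l)" by (auto simp: M_def)
    then have "1 = n * l" by (simp only: of_int_eq_iff)
    then have "n dvd 1" by (rule dvdI)
    then show False using n zdvd_imp_le[of n 1] by simp
  qed
  moreover have "\<exists>F. finite F \<and> F \<subseteq> \<int> \<and> (\<forall>y\<in>\<int>. \<exists>f\<in>F. y - f \<in> M)"
  proof (intro exI[of _ "of_int ` {0..<n}"] conjI ballI)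
    fix y :: 'a assume "y \<in> \<int>"
    then obtain l where l: "y = of_int l" by (auto elim: Ints_cases)
    have "y - of_int (l mod n) = of_int (n * (l div n))"
      unfolding l of_int_diff[symmetric] by (simp only: minus_mod_eq_mult_div)
    then show "\<exists>f\<in>of_int ` {0..<n}. y - f \<in> M"
      using n by (intro bexI[of _ "of_int (l mod n)"]) (auto simp: M_def)
  qed auto
  moreover have "\<exists>w\<in>\<int>. v * w - 1 \<in> M"
  proof (intro bexI[of _ "of_int (- sgn k)"])
    have "k * (- sgn k) - 1 = n * (- 1)" by (auto simp: n_def sgn_if abs_if)
    then have "v * of_int (- sgn k) - 1 = of_int (n * (- 1))"
      unfolding k by (metis of_int_1 of_int_diff of_int_mult)
    then show "v * of_int (- sgn k) - 1 \<in> M" unfolding M_def by (rule image_eqI) simp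
  qed simp
  ultimately show "\<exists>M. finite_index_unit \<int> v M" unfolding finite_index_unit_def by blast
qed

text \<open>Specialise \<open>x\<close> to a natural number \<open>t\<close> that is not a root of the given element.\<close>

lemma residually_finite_adjoin_transcendental:
  fixes x :: "'a::{idom,ring_char_0}"
  assumes A: "subring_of A" "residually_finite A"
    and x: "\<And>p. p \<in> polys_over A \<Longrightarrow> poly p x = 0 \<Longrightarrow> p = 0"
  shows "residually_finite (adjoin A x)"
  unfolding residually_finite_def
proof (intro ballI impI)
  note S = subring_of_polys_over[OF A(1)]
  fix v assume "v \<in> adjoin A x" "v \<noteq> 0"
  then obtain p where p: "p \<in> polys_over A" "v = poly p x" by (auto simp: adjoin_def)
  with \<open>v \<noteq> 0\<close> have p0: "p \<noteq> 0" by auto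
  have "\<not> range of_nat \<subseteq> {t. poly p t = 0}"
    using poly_roots_finite[OF p0] range_inj_infinite[OF inj_of_nat] finite_subset by blast
  then obtain n where n: "poly p (of_nat n) \<noteq> 0" by auto
  define t :: 'a where "t = of_nat n"
  have t: "t \<in> A" unfolding t_def by (induction n) (auto intro: subring_ofD[OF A(1)])
  have ev: "poly q t \<in> A" if "q \<in> polys_over A" for q
    using that unfolding poly_altdef polys_over_def
    by (auto intro!: sum_mem_closed subring_ofD[OF A(1)] t)
  from n A(2) ev[OF p(1)] obtain M where M: "finite_index_unit A (poly p t) M"
    by (auto simp: residually_finite_def t_def)
  note I = ideal_ofD[of A M]
  have id: "ideal_of A M" and 1: "1 \<notin> M" using M by (auto simp: finite_index_unit_def)
  obtain F where F: "finite F" "F \<subseteq> A" "\<And>y. y \<in> A \<Longrightarrow> \<exists>f\<in>F. y - f \<in> M"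
    using M unfolding finite_index_unit_def by blast
  obtain w where w: "w \<in> A" "poly p t * w - 1 \<in> M" using M unfolding finite_index_unit_def by blast
  define N where "N = (\<lambda>q. poly q x) ` {q \<in> polys_over A. poly q t \<in> M}"
  \<comment> \<open>A polynomial over \<open>A\<close> is determined by its value at the
    transcendental \<open>x\<close>. Hence sending \<open>x\<close> to \<open>t\<close> is a
    well-defined ring map onto \<open>A\<close>, and \<open>N\<close> is the preimage of
    \<open>M\<close>.\<close>
  have Nmem: "poly q x \<in> N \<longleftrightarrow> poly q t \<in> M" if "q \<in> polys_over A" for q
  proof
    assume "poly q x \<in> N"
    then obtain q' where q': "q' \<in> polys_over A" "poly q' t \<in> M" "poly q x = poly q' x"
      by (auto simp: N_def)
    then have "q - q' = 0" using that by (intro x) (auto intro: subring_ofD[OF S])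
    then show "poly q t \<in> M" using q' by simp
  qed (use that in \<open>auto simp: N_def\<close>)
  have "finite_index_unit (adjoin A x) v N"
    unfolding finite_index_unit_def
  proof (intro conjI)
    show "ideal_of (adjoin A x) N"
      unfolding ideal_of_def
    proof (intro conjI ballI)
      show "N \<subseteq> adjoin A x" by (auto simp: N_def adjoin_def)
      show "0 \<in> N" using Nmem[OF subring_ofD(2)[OF S]] I(2)[OF id] by simp
    next
      fix y z assume "y \<in> N" "z \<in> N"
      then obtain q q' where "q \<in> polys_over A" "poly q t \<in> M" "y = poly q x"
        "q' \<in> polys_over A" "poly q' t \<in> M" "z = poly q' x" by (auto simp: N_def)
      then show "y - z \<in> N" using Nmem[of "q - q'"] by (auto intro: subring_ofD(3,4)[OF S] I(3,4)[OF id])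
    next
      fix y z assume "y \<in> adjoin A x" "z \<in> N"
      then obtain q q' where "q \<in> polys_over A" "y = poly q x"
        "q' \<in> polys_over A" "poly q' t \<in> M" "z = poly q' x" by (auto simp: N_def adjoin_def)
      then show "y * z \<in> N" using Nmem[of "q * q'"] ev by (auto intro: subring_ofD(3,4)[OF S] I(3,4)[OF id])
    qed
    show "1 \<notin> N" using Nmem[OF subring_ofD(1)[OF S]] 1 by simp
    show "\<exists>F. finite F \<and> F \<subseteq> adjoin A x \<and> (\<forall>y\<in>adjoin A x. \<exists>f\<in>F. y - f \<in> N)"
    proof (intro exI[of _ F] conjI ballI)
      show "F \<subseteq> adjoin A x" using F(2) subring_of_adjoin(2)[OF A(1)] by blast
      fix y assume "y \<in> adjoin A x"
      then obtain q where q: "q \<in> polys_over A" "y = poly q x" by (auto simp: adjoin_def)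
      from F(3)[OF ev[OF q(1)]] obtain f where f: "f \<in> F" "poly q t - f \<in> M" by blast
      then have "q - [:f:] \<in> polys_over A" using q F(2)
        by (auto intro!: subring_ofD[OF S] const_in_polys_over smult_in_polys_over[OF A(1)] subring_ofD(2)[OF A(1)])
      from Nmem[OF this] f q show "\<exists>f\<in>F. y - f \<in> N" by auto
    qed (rule F)
    show "\<exists>w\<in>adjoin A x. v * w - 1 \<in> N"
    proof (rule bexI[of _ w])
      have "p * [:w:] - 1 \<in> polys_over A" using p w
        by (auto intro!: subring_ofD[OF S] const_in_polys_over smult_in_polys_over[OF A(1)] subring_ofD(2)[OF A(1)])
      from Nmem[OF this] w p show "v * w - 1 \<in> N" by (simp add: mult.commute)
      show "w \<in> adjoin A x" using w subring_of_adjoin(2)[OF A(1)] by blast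
    qed
  qed
  then show "\<exists>M. finite_index_unit (adjoin A x) v M" by blast
qed

text \<open>
  Let \<open>b\<close> be the leading coefficient of a relation \<open>P\<close> of minimal degree and \<open>a \<in> A\<close> a nonzero multiple
  of \<open>v\<close>. If \<open>a * b\<close> is a unit modulo \<open>M\<close>, then \<open>M[x]\<close> is an ideal as required: \<open>P\<close> is monic up to a
  unit, so that it bounds the index, and it keeps \<open>1\<close> out of \<open>M[x]\<close>.
\<close>

lemma residually_finite_adjoin_algebraic:
  fixes x :: "'a::idom"
  assumes A: "subring_of A" "residually_finite A"
    and x: "p0 \<in> polys_over A" "poly p0 x = 0" "p0 \<noteq> 0"
  shows "residually_finite (adjoin A x)"
  unfolding residually_finite_def
proof (intro ballI impI)
  note S = subring_of_polys_over[OF A(1)]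
  fix v assume v: "v \<in> adjoin A x" "v \<noteq> 0"
  define is_rel where "is_rel = (\<lambda>p. p \<in> polys_over A \<and> poly p x = 0 \<and> p \<noteq> 0)"
  have "is_rel p0" using x by (simp add: is_rel_def)
  from ex_has_least_nat[of is_rel, OF this, of degree] obtain P where
    P: "P \<in> polys_over A" "poly P x = 0" "P \<noteq> 0" and Pmin: "\<And>p. is_rel p \<Longrightarrow> degree P \<le> degree p"
    unfolding is_rel_def by blast
  have Pmin': "r = 0" if "r \<in> polys_over A" "poly r x = 0" "degree r < degree P" for r
    using Pmin[of r] that by (auto simp: is_rel_def)
  define b where "b = lead_coeff P"
  have b: "b \<noteq> 0" "b \<in> A" using P by (auto simp: b_def polys_over_def)
  have dP: "degree P > 0"
  proof (rule ccontr)
    assume "\<not> degree P > 0"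
    then obtain c where "P = [:c:]" by (auto elim: degree_eq_zeroE)
    with P show False by simp
  qed

  define is_mult where "is_mult = (\<lambda>p. p \<in> polys_over A \<and> poly p x \<noteq> 0 \<and> (\<exists>w\<in>adjoin A x. poly p x = v * w))"
  note B = subring_of_adjoin[OF A(1), of x]
  have eval: "poly p x \<in> adjoin A x" if "p \<in> polys_over A" for p using that by (auto simp: adjoin_def)
  obtain pv where pv: "pv \<in> polys_over A" "v = poly pv x" using v by (auto simp: adjoin_def)
  have "is_mult pv" using pv v subring_ofD(1)[OF B(1)] by (auto simp: is_mult_def intro!: bexI[of _ 1])
  \<comment> \<open>A \<open>p\<close> of least degree is constant and gives the multiple
    \<open>a\<close> of \<open>v\<close> in \<open>A\<close>. Otherwise divide \<open>P\<close> by
    \<open>p\<close>: the remainder takes a multiple of \<open>v\<close> as its value at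
    \<open>x\<close>, so by minimality it vanishes at \<open>x\<close> and is 0; the quotient is
    then a relation for \<open>x\<close> of degree below that of \<open>P\<close>.\<close>
  from ex_has_least_nat[of is_mult, OF this, of degree] obtain p where
    p: "is_mult p" and pmin: "\<And>q. is_mult q \<Longrightarrow> degree p \<le> degree q" by blast
  have pA: "p \<in> polys_over A" and px: "poly p x \<noteq> 0" using p by (auto simp: is_mult_def)
  obtain w where w: "w \<in> adjoin A x" "poly p x = v * w" using p by (auto simp: is_mult_def)
  have "degree p = 0"
  proof (rule ccontr)
    assume dp: "degree p \<noteq> 0"
    have "degree p < degree P"
    proof -
      obtain k q r where r: "r \<in> polys_over A" "q \<in> polys_over A" "smult (b ^ k) p = q * P + r" "r = 0 \<or> degree r < degree P"
        using pseudo_division_over[OF A(1) P(1,3) pA] unfolding b_def by blast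
      have "b ^ k * poly p x = poly r x" using arg_cong[OF r(3), of "\<lambda>p. poly p x"] P by simp
      moreover have "b ^ k * (v * w) = v * (b ^ k * w)" by simp
      moreover have "b ^ k * w \<in> adjoin A x" using b B w by (auto intro!: subring_ofD(4,7)[OF B(1)])
      ultimately have "is_mult r" using r px b w unfolding is_mult_def
        by (metis mult_eq_0_iff power_not_zero)
      then have "degree p \<le> degree r" "r \<noteq> 0" using pmin by (auto simp: is_mult_def)
      with r show ?thesis by auto
    qed
    have p0: "p \<noteq> 0" using px by auto
    obtain k q r where r: "r \<in> polys_over A" "q \<in> polys_over A" 
      "smult (lead_coeff p ^ k) P = q * p + r" "r = 0 \<or> degree r < degree p"
      using pseudo_division_over[OF A(1) pA p0 P(1)] by blast
    have eq: "poly r x = v * (- poly q x * w)"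
      using arg_cong[OF r(3), of "\<lambda>p. poly p x"] P w by (simp add: algebra_simps eq_neg_iff_add_eq_0)
    have "poly r x = 0"
    proof (rule ccontr)
      assume "poly r x \<noteq> 0"
      moreover have "- poly q x * w \<in> adjoin A x" using eval[OF r(2)] w 
        by (auto intro!: subring_ofD(4,5)[OF B(1)])
      ultimately have "is_mult r" using eq r unfolding is_mult_def by blast
      then have "degree p \<le> degree r" "r \<noteq> 0" using pmin by (auto simp: is_mult_def)
      with r show False by auto
    qed
    then have r0: "r = 0" using r \<open>degree p < degree P\<close> by (intro Pmin') auto
    have "poly q x = 0" using arg_cong[OF r(3), of "\<lambda>p. poly p x"] P px r0 by simp
    moreover have q0: "q \<noteq> 0" using r r0 p0 P by auto
    moreover have "degree P = degree q + degree p"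
      using arg_cong[OF r(3), of degree] r0 q0 p0 by (simp add: degree_mult_eq)
    ultimately show False using Pmin'[of q] r dp by auto
  qed
  then obtain a where a: "p = [:a:]" by (auto elim: degree_eq_zeroE)
  have aA: "a \<in> A" "a \<noteq> 0" "v * w = a" using pA px w a by (auto simp: polys_over_def dest: spec[of _ 0])
  
  obtain M where M: "finite_index_unit A (a * b) M" using A(2) aA b subring_ofD(4)[OF A(1)]
    unfolding residually_finite_def by (metis mult_eq_0_iff)
  have id: "ideal_of A M" and 1: "1 \<notin> M" using M by (auto simp: finite_index_unit_def)
  note I = ideal_ofD[OF id]
  obtain F where F: "finite F" "F \<subseteq> A" "\<And>y. y \<in> A \<Longrightarrow> \<exists>f\<in>F. y - f \<in> M"
    using M unfolding finite_index_unit_def by blast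
  obtain c where c: "c \<in> A" "a * b * c - 1 \<in> M" using M unfolding finite_index_unit_def by blast
  define b' where "b' = a * c"
  have b': "b' \<in> A" "b * b' - 1 \<in> M" using aA c subring_ofD(4)[OF A(1)] by (auto simp: b'_def mult_ac)
  have cancel: "y \<in> M" if "y \<in> A" "b * y \<in> M" for y
  proof -
    have "y = b' * (b * y) - y * (b * b' - 1)" by (simp add: algebra_simps)
    also have "\<dots> \<in> M" by (rule I(3)[OF I(4)[OF b'(1) that(2)] I(4)[OF that(1) b'(2)]])
    finally show ?thesis .
  qed
  have cancel_power: "y \<in> M" if "y \<in> A" "b ^ k * y \<in> M" for y k
    using that
  proof (induction k)
    case (Suc k)
    then show ?case using cancel[of "b ^ k * y"] b
      by (simp add: mult.assoc subring_ofD(4,7)[OF A(1)])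
  qed simp

  define N where "N = (\<lambda>q. poly q x) ` polys_over M"
  have MA: "polys_over M \<subseteq> polys_over A" using I(1) by (auto simp: polys_over_def)
  have MN: "M \<subseteq> N"
  proof
    fix y assume "y \<in> M"
    then show "y \<in> N" using const_in_polys_over[OF I(2)] unfolding N_def
      by (intro image_eqI[of _ _ "[:y:]"]) auto
  qed
  have idN: "ideal_of (adjoin A x) N"
    unfolding ideal_of_def
  proof (intro conjI ballI)
    show "N \<subseteq> adjoin A x" using MA by (auto simp: N_def adjoin_def)
    show "0 \<in> N" using MN I(2) by auto
    fix y z
    {
      assume "y \<in> N" "z \<in> N"
      then obtain q q' where "q \<in> polys_over M" "q' \<in> polys_over M" "y = poly q x" "z = poly q' x"
        by (auto simp: N_def)
      then show "y - z \<in> N" unfolding N_def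
        by (intro image_eqI[of _ _ "q - q'"]) (auto simp: polys_over_def I(3))
    next
      assume "y \<in> adjoin A x" "z \<in> N"
      then obtain q q' where "q \<in> polys_over A" "q' \<in> polys_over M" "y = poly q x" "z = poly q' x"
        by (auto simp: N_def adjoin_def)
      then show "y * z \<in> N" unfolding N_def
        by (intro image_eqI[of _ _ "q * q'"]) (auto intro: polys_over_ideal_mult[OF id])
    }
  qed
  have "1 \<notin> N"
  proof
    assume "1 \<in> N"
    then obtain m where m: "m \<in> polys_over M" "poly m x = 1" by (auto simp: N_def)
    then have "1 - m \<in> polys_over A" using MA by (auto intro!: subring_ofD[OF S])
    from pseudo_division_over[OF A(1) P(1,3) this] obtain k Q r where
      Q: "Q \<in> polys_over A" "r \<in> polys_over A" "smult (b ^ k) (1 - m) = Q * P + r" "r = 0 \<or> degree r < degree P"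
      unfolding b_def by blast
    have "poly r x = 0" using arg_cong[OF Q(3), of "\<lambda>p. poly p x"] P m by simp
    then have "r = 0" using Q by (auto intro: Pmin')
    then have QP: "Q * P = smult (b ^ k) (1 - m)" using Q by simp
    have bk: "b ^ k \<in> A" using b by (auto intro: subring_ofD(7)[OF A(1)])
    \<comment> \<open>Descent from the top coefficient of \<open>Q\<close>. In degree
      \<open>e + degree P\<close> the product \<open>Q * P\<close> is \<open>b * coeff Q e\<close>
      plus terms with higher coefficients of \<open>Q\<close>, and it lies in \<open>M\<close>
      because \<open>degree P > 0\<close> keeps clear of the constant 1 in \<open>1 - m\<close>. Now
      \<open>b\<close> cancels modulo \<open>M\<close>.\<close>
    have "coeff Q e \<in> M" for e
    proof (induction "degree Q - e" arbitrary: e rule: less_induct)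
      case less
      show ?case
      proof (cases "e > degree Q")
        case True
        then show ?thesis using I(2) by (simp add: coeff_eq_0)
      next
        case False
        let ?n = "e + degree P"
        have IH: "coeff Q i \<in> M" if "i > e" for i
        proof (cases "i > degree Q")
          case True
          then show ?thesis using I(2) by (simp add: coeff_eq_0)
        next
          case False
          then show ?thesis using that by (intro less) auto
        qed
        have "coeff (Q * P) ?n = (\<Sum>i\<in>{..?n}. coeff Q i * coeff P (?n - i))"
          by (simp add: coeff_mult)
        also have "\<dots> = coeff Q e * coeff P (?n - e) + (\<Sum>i\<in>{..?n} - {e}. coeff Q i * coeff P (?n - i))"
          by (rule sum.remove) auto
        finally have "b * coeff Q e = b ^ k * (- coeff m ?n) - (\<Sum>i\<in>{..?n} - {e}. coeff Q i * coeff P (?n - i))"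
          using dP by (simp add: QP b_def)
        also have "\<dots> \<in> M"
        proof (rule I(3))
          show "b ^ k * (- coeff m ?n) \<in> M"
            using m bk by (auto simp: polys_over_def intro!: I(4,6) simp del: mult_minus_right)
          show "(\<Sum>i\<in>{..?n} - {e}. coeff Q i * coeff P (?n - i)) \<in> M"
          proof (rule sum_mem_closed)
            fix i assume i: "i \<in> {..?n} - {e}"
            show "coeff Q i * coeff P (?n - i) \<in> M"
            proof (cases "i < e")
              case True
              then show ?thesis using I(2) by (simp add: coeff_eq_0)
            next
              case False
              then have "i > e" using i by auto
              then show ?thesis using IH P by (auto simp: polys_over_def intro!: I(5))
            qed
          qed (use I in auto)
        qed
        finally show ?thesis using Q(1) by (auto simp: polys_over_def intro: cancel[rotated])
      qed
    qed
    then have "Q \<in> polys_over M" by (simp add: polys_over_def)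
    then have "P * Q \<in> polys_over M" using P by (intro polys_over_ideal_mult[OF id])
    then have "coeff (Q * P) 0 \<in> M" by (simp add: polys_over_def mult.commute)
    then have "b ^ k * (1 - coeff m 0) \<in> M" by (simp add: QP)
    moreover have "1 - coeff m 0 \<in> A"
      using \<open>1 - m \<in> polys_over A\<close> by (auto simp: polys_over_def dest: spec[of _ 0])
    ultimately have "1 - coeff m 0 \<in> M" by (rule cancel_power[rotated])
    then have "(1 - coeff m 0) + coeff m 0 \<in> M" using m by (intro I(7)) (auto simp: polys_over_def)
    then show False using 1 by simp
  qed
  have "finite_index_unit (adjoin A x) v N"
    unfolding finite_index_unit_def
  proof (intro conjI)
    define F' where "F' = (\<lambda>fs. poly (Poly fs) x) ` {fs. set fs \<subseteq> F \<and> length fs = degree P}"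
    note J = ideal_ofD[OF idN]
    show "\<exists>F. finite F \<and> F \<subseteq> adjoin A x \<and> (\<forall>y\<in>adjoin A x. \<exists>f\<in>F. y - f \<in> N)"
    proof (intro exI[of _ F'] conjI ballI)
      show "finite F'" unfolding F'_def using F(1) by (intro finite_imageI finite_lists_length_eq)
      have "Poly fs \<in> polys_over A" if "set fs \<subseteq> F" for fs
        using that F(2) subring_ofD(2)[OF A(1)] by (auto simp: polys_over_def nth_default_def dest: nth_mem)
      then show "F' \<subseteq> adjoin A x" unfolding F'_def adjoin_def by auto
      fix y assume "y \<in> adjoin A x"
      then obtain q where q: "q \<in> polys_over A" "y = poly q x" by (auto simp: adjoin_def)
      obtain k Q r where
        Q: "Q \<in> polys_over A" "r \<in> polys_over A" "smult (b ^ k) q = Q * P + r" "r = 0 \<or> degree r < degree P"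
        using pseudo_division_over[OF A(1) P(1,3) q(1)] unfolding b_def by blast
      have bky: "b ^ k * y = poly r x" using arg_cong[OF Q(3), of "\<lambda>p. poly p x"] P q by simp
      \<comment> \<open>Since \<open>b'\<close> inverts \<open>b\<close> modulo \<open>M\<close>,
        the value of \<open>r'\<close> at \<open>x\<close> is \<open>y\<close> modulo
        \<open>N\<close>. Rounding its \<open>degree P\<close> coefficients to representatives in
        \<open>F\<close> leaves finitely many values.\<close>
      define r' where "r' = smult (b' ^ k) r"
      have r': "r' \<in> polys_over A" "\<And>i. i \<ge> degree P \<Longrightarrow> coeff r' i = 0"
        using Q b' dP by (auto simp: r'_def coeff_eq_0 intro!: smult_in_polys_over[OF A(1)] subring_ofD(7)[OF A(1)])
      have pow: "(b * b') ^ k - 1 \<in> M" for k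
      proof (induction k)
        case (Suc k)
        have "(b * b') ^ Suc k - 1 = (b * b') * ((b * b') ^ k - 1) + (b * b' - 1)" by (simp add: algebra_simps)
        also have "\<dots> \<in> M" using Suc b b' by (intro I(4,7)) (auto intro: subring_ofD(4)[OF A(1)])
        finally show ?case .
      qed (use I in auto)
      have "poly r' x - y = y * ((b * b') ^ k - 1)"
        by (simp add: r'_def flip: bky) (simp add: algebra_simps)
      also have "\<dots> \<in> N" using pow MN \<open>y \<in> adjoin A x\<close> by (intro J(4)) auto
      finally have 1: "poly r' x - y \<in> N" .
      have "\<forall>i. \<exists>f\<in>F. coeff r' i - f \<in> M" using F(3) r'(1) by (auto simp: polys_over_def)
      then obtain g where g: "\<And>i. g i \<in> F" "\<And>i. coeff r' i - g i \<in> M" by metis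
      define fs where "fs = map g [0..<degree P]"
      have "r' - Poly fs \<in> polys_over M"
        using g r'(2) I(2) by (auto simp: polys_over_def nth_default_def fs_def)
      then have "poly r' x - poly (Poly fs) x \<in> N" unfolding N_def by (intro image_eqI[of _ _ "r' - Poly fs"]) auto
      from J(3)[OF this 1] have "y - poly (Poly fs) x \<in> N" by simp
      moreover have "poly (Poly fs) x \<in> F'" unfolding F'_def using g by (intro imageI) (auto simp: fs_def)
      ultimately show "\<exists>f\<in>F'. y - f \<in> N" by blast
    qed
    show "\<exists>w\<in>adjoin A x. v * w - 1 \<in> N"
    proof (rule bexI[of _ "w * (b * c)"])
      have "v * (w * (b * c)) - 1 = a * b * c - 1" using aA(3) by (simp flip: mult.assoc)
      then show "v * (w * (b * c)) - 1 \<in> N" using c(2) MN by (metis subsetD)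
      show "w * (b * c) \<in> adjoin A x" using w b c B(2) by (auto intro!: subring_ofD(4)[OF B(1)])
    qed
  qed (use idN \<open>1 \<notin> N\<close> in auto)
  then show "\<exists>M. finite_index_unit (adjoin A x) v M" by blast
qed

text \<open>Start from the integers and adjoin the elements of \<open>X\<close> one at a time.
  Relative to the ring reached so far, each is either transcendental or a root of a nonzero
  polynomial, so one of the two adjunction lemmas applies.\<close>

theorem ex_residually_finite_superset:
  fixes X :: "'a::{idom,ring_char_0} set"
  assumes "finite X"
  shows "\<exists>A. subring_of A \<and> residually_finite A \<and> X \<subseteq> A"
  using assms
proof (induction X)
  case empty
  have "subring_of (\<int> :: 'a set)" by (auto simp: subring_of_def)
  then show ?case using residually_finite_Ints by blast
next
  case (insert x X)
  then obtain A where A: "subring_of A" "residually_finite A" "X \<subseteq> A" by auto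
  have "residually_finite (adjoin A x)"
    using residually_finite_adjoin_transcendental[OF A(1,2)] residually_finite_adjoin_algebraic[OF A(1,2)]
    by blast
  with A subring_of_adjoin[OF A(1), of x] show ?case by (intro exI[of _ "adjoin A x"]) auto
qed

section \<open>Periodicity of exponential sums modulo an ideal of finite index\<close>

lemma finite_index_unit_power:
  fixes z z' :: "'a::comm_ring_1"
  assumes A: "subring_of A" and M: "finite_index_unit A v M" and z: "z \<in> A" "z' \<in> A" "z * z' = 1"
  shows "\<exists>n>0. z ^ n - 1 \<in> M"
proof -
  have id: "ideal_of A M" using M by (auto simp: finite_index_unit_def)
  note I = ideal_ofD[OF id]
  obtain F where F: "finite F" "F \<subseteq> A" "\<And>y. y \<in> A \<Longrightarrow> \<exists>f\<in>F. y - f \<in> M"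
    using M unfolding finite_index_unit_def by blast
  have "\<forall>n. \<exists>f\<in>F. z ^ n - f \<in> M" using F(3) z subring_ofD(7)[OF A] by blast
  then obtain g where g: "\<And>n::nat. g n \<in> F" "\<And>n. z ^ n - g n \<in> M" by metis
  \<comment> \<open>Pigeonhole: two powers of \<open>z\<close> share a representative, and powers of
    the inverse \<open>z'\<close> cancel the lower one.\<close>
  have "\<not> inj g" using F(1) g(1) by (meson finite_subset image_subsetI infinite_UNIV_nat finite_imageD)
  then obtain s t where st: "s < t" "g s = g t" by (metis injI linorder_neqE_nat)
  have "z ^ t - z ^ s \<in> M" using I(3)[OF g(2)[of t] g(2)[of s]] st by simp
  then have "z' ^ s * (z ^ t - z ^ s) \<in> M" using z subring_ofD(7)[OF A] by (intro I(4)) auto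
  also have "z ^ t = z ^ s * z ^ (t - s)" using st by (simp flip: power_add)
  also have "z' ^ s * (z ^ s * z ^ (t - s) - z ^ s) = (z * z') ^ s * (z ^ (t - s) - 1)"
    by (simp add: algebra_simps)
  finally show ?thesis using z st by (intro exI[of _ "t - s"]) auto
qed

lemma ideal_power_minus_one_dvd:
  fixes z :: "'a::comm_ring_1"
  assumes A: "subring_of A" and M: "ideal_of A M" and z: "z \<in> A" "z ^ n - 1 \<in> M" and "n dvd k"
  shows "z ^ k - 1 \<in> M"
proof -
  note I = ideal_ofD[OF M]
  have "(z ^ n) ^ l - 1 \<in> M" for l
  proof (induction l)
    case (Suc l)
    have "(z ^ n) ^ Suc l - 1 = z ^ n * ((z ^ n) ^ l - 1) + (z ^ n - 1)" by (simp add: algebra_simps)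
    also have "\<dots> \<in> M" using Suc z by (intro I(4,7)) (auto intro: subring_ofD(7)[OF A])
    finally show ?case .
  qed (use I in auto)
  with \<open>n dvd k\<close> show ?thesis by (auto simp: power_mult)
qed

text \<open>
  A weak form of the Skolem--Mahler--Lech theorem. Modulo an ideal of finite index in a ring that
  contains all coefficients and bases, the exponential sum is periodic, and the ideal can be chosen to
  avoid one given nonzero value.
\<close>

theorem exponential_sum_nonzero_on_progression:
  fixes c z :: "'i \<Rightarrow> 'a::field_char_0"
  assumes I: "finite I" "inj_on z I" "\<And>i. i \<in> I \<Longrightarrow> z i \<noteq> 0" and c: "i0 \<in> I" "c i0 \<noteq> 0"
  shows "\<exists>n\<ge>2. \<exists>j. \<forall>l::int. (\<Sum>i\<in>I. c i * z i powi (int n * l + int j)) \<noteq> 0"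
proof -
  have "\<exists>j. (\<Sum>i\<in>I. c i * z i ^ j) \<noteq> 0"
  proof (rule ccontr)
    assume "\<not> ?thesis"
    then have *: "(\<Sum>i\<in>I. c i * z i ^ j) = 0" for j by blast
    \<comment> \<open>Interpolation: \<open>p\<close> vanishes at every base except
      \<open>z i0\<close>, so a linear combination of the power sums isolates the term of
      \<open>i0\<close>.\<close>
    define p where "p = (\<Prod>i\<in>I - {i0}. [:- z i, 1:])"
    have "(\<Sum>i\<in>I. c i * poly p (z i)) = (\<Sum>j\<le>degree p. coeff p j * (\<Sum>i\<in>I. c i * z i ^ j))"
      unfolding poly_altdef sum_distrib_left by (subst sum.swap) (simp add: mult_ac)
    also have "\<dots> = 0" by (simp add: *)
    also have "(\<Sum>i\<in>I. c i * poly p (z i)) = c i0 * poly p (z i0)"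
      using I c by (subst sum.remove[of _ i0]) (auto simp: p_def poly_prod intro!: sum.neutral)
    finally show False using c I by (auto simp: p_def poly_prod inj_on_def)
  qed
  then obtain j where j: "(\<Sum>i\<in>I. c i * z i ^ j) \<noteq> 0" by blast
  define v where "v = (\<Sum>i\<in>I. c i * z i ^ j)"
  \<comment> \<open>The inverses are included because the exponents run through all integers and the
    bases must be units of \<open>A\<close>.\<close>
  obtain A where A: "subring_of A" "residually_finite A" "c ` I \<union> z ` I \<union> (\<lambda>i. inverse (z i)) ` I \<subseteq> A"
    using ex_residually_finite_superset[of "c ` I \<union> z ` I \<union> (\<lambda>i. inverse (z i)) ` I"] I(1) by auto
  have A': "c i \<in> A" "z i \<in> A" "inverse (z i) \<in> A" if "i \<in> I" for i using A(3) that by auto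
  have "v \<in> A" unfolding v_def
    using A' by (intro sum_mem_closed) (auto intro: subring_ofD[OF A(1)])
  with A(2) j obtain M where M: "finite_index_unit A v M" by (auto simp: residually_finite_def v_def)
  have id: "ideal_of A M" and 1: "1 \<notin> M" using M by (auto simp: finite_index_unit_def)
  note J = ideal_ofD[OF id]
  have "v \<notin> M"
  proof
    assume "v \<in> M"
    obtain w where w: "w \<in> A" "v * w - 1 \<in> M" using M unfolding finite_index_unit_def by blast
    from J(3)[OF J(5)[OF \<open>v \<in> M\<close> w(1)] w(2)] 1 show False by simp
  qed
  have "\<forall>i\<in>I. \<exists>n>0. z i ^ n - 1 \<in> M"
    using finite_index_unit_power[OF A(1) M] A' I(3) by (metis right_inverse)
  then obtain N where N: "\<And>i. i \<in> I \<Longrightarrow> N i > (0::nat)" "\<And>i. i \<in> I \<Longrightarrow> z i ^ N i - 1 \<in> M" by metis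
  \<comment> \<open>A common period of all bases modulo \<open>M\<close>; the factor 2 secures
    \<open>n \<ge> 2\<close> even if every single period is 1.\<close>
  define n where "n = 2 * (\<Prod>i\<in>I. N i)"
  have "(\<Prod>i\<in>I. N i) > 0" using N(1) by (intro prod_pos) auto
  then have n: "n \<ge> 2" by (simp add: n_def)
  have dvd: "N i dvd n" if "i \<in> I" for i
    unfolding n_def using dvd_prodI[OF I(1) that] by (rule dvd_mult)
  have per: "z i powi (int n * l) - 1 \<in> M" if i: "i \<in> I" for i l
  proof (cases "l \<ge> 0")
    case True
    then have "z i powi (int n * l) = z i ^ (n * nat l)" by (simp add: power_int_def nat_mult_distrib)
    moreover have "N i dvd n * nat l" using dvd[OF i] by (rule dvd_mult2)
    ultimately show ?thesis
      using ideal_power_minus_one_dvd[OF A(1) id _ N(2)] A' i by metis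
  next
    case False
    define k where "k = n * nat (- l)"
    have "int n * l = - int k" using False by (simp add: k_def)
    then have 1: "z i powi (int n * l) = inverse (z i) ^ k"
      by (simp add: power_int_minus power_inverse)
    have "N i dvd k" unfolding k_def using dvd[OF i] by (rule dvd_mult2)
    then have "z i ^ k - 1 \<in> M"
      using ideal_power_minus_one_dvd[OF A(1) id _ N(2)] A' i by metis
    then have "(- (inverse (z i) ^ k)) * (z i ^ k - 1) \<in> M"
      using A' i by (intro J(4) subring_ofD(5,7)[OF A(1)])
    also have "(- (inverse (z i) ^ k)) * (z i ^ k - 1) = inverse (z i) ^ k - 1"
      using I(3)[OF i] by (simp add: algebra_simps flip: power_mult_distrib)
    finally show ?thesis using 1 by simp
  qed
  have "(\<Sum>i\<in>I. c i * z i powi (int n * l + int j)) \<noteq> 0" for l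
  proof
    assume 0: "(\<Sum>i\<in>I. c i * z i powi (int n * l + int j)) = 0"
    have "- v = (\<Sum>i\<in>I. c i * z i powi (int n * l + int j)) - v" by (simp add: 0)
    also have "\<dots> = (\<Sum>i\<in>I. (c i * z i ^ j) * (z i powi (int n * l) - 1))"
      unfolding v_def sum_subtractf[symmetric]
      by (intro sum.cong refl) (simp add: power_int_add I(3) algebra_simps)
    also have "\<dots> \<in> M"
      using A' per by (intro sum_mem_closed J(2,4,7)) (auto intro: subring_ofD[OF A(1)])
    finally show False using J(6) \<open>v \<notin> M\<close> by fastforce
  qed
  with n show ?thesis by blast
qed

section \<open>Decay of disk polynomials\<close>

lemma has_integral_cis_int:
  "((\<lambda>t. cis (of_int k * t)) has_integral (if k = 0 then complex_of_real (2 * pi) else 0)) {0..2*pi}"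
proof (cases "k = 0")
  case True
  then show ?thesis using has_integral_const_real[of "1::complex" 0 "2*pi"] by (simp add: scaleR_conv_of_real)
next
  case False
  define F where "F = (\<lambda>t. cis (of_int k * t) / (\<i> * of_int k))"
  have "((\<lambda>t. cis (of_int k * t)) has_integral (F (2*pi) - F 0)) {0..2*pi}"
  proof (rule fundamental_theorem_of_calculus)
    fix t :: real
    have "((\<lambda>t. exp (\<i> * of_int k * of_real t) / (\<i> * of_int k)) has_vector_derivative
             exp (\<i> * of_int k * of_real t)) (at t within {0..2*pi})"
      using False by (auto intro!: derivative_eq_intros has_vector_derivative_real_field)
    then show "(F has_vector_derivative cis (of_int k * t)) (at t within {0..2*pi})"
      by (simp add: F_def cis_conv_exp mult_ac)
  qed simp
  moreover have "F (2 * pi) = F 0"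
    using cis_multiple_2pi[of "of_int k"] by (simp add: F_def mult_ac)
  ultimately show ?thesis using False by simp
qed

text \<open>After binomial expansion only terms with equal powers of \<open>cis t\<close> and
  \<open>cis (- t)\<close> survive: the integral extracts the constant Fourier coefficient.\<close>

lemma has_integral_trig_product:
  fixes u v u' v' :: complex
  assumes "n \<le> m"
  shows "((\<lambda>t. (u + v * cis t) ^ m * (u' + v' * cis (- t)) ^ n) has_integral
     of_real (2 * pi) * (\<Sum>i\<le>n. of_nat (m choose i) * of_nat (n choose i) * u ^ (m - i) * u' ^ (n - i) * (v * v') ^ i))
     {0..2*pi}"
proof -
  define C where "C = (\<lambda>i l. of_nat (m choose i) * of_nat (n choose l) * u ^ (m - i) * u' ^ (n - l) * v ^ i * v' ^ l)"
  have cis: "cis t ^ i * cis (- t) ^ l = cis (of_int (int i - int l) * t)" for t i l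
  proof -
    have "real i * t + real l * (- t) = of_int (int i - int l) * t" by (simp add: algebra_simps)
    moreover have "cis t ^ i * cis (- t) ^ l = cis (real i * t + real l * (- t))"
      by (simp only: Complex.DeMoivre cis_mult)
    ultimately show ?thesis by (simp only:)
  qed
  have "((\<lambda>t. \<Sum>l\<le>n. \<Sum>i\<le>m. C i l * cis (of_int (int i - int l) * t)) has_integral
          (\<Sum>l\<le>n. \<Sum>i\<le>m. C i l * (if int i - int l = 0 then of_real (2 * pi) else 0))) {0..2*pi}"
    by (intro has_integral_sum has_integral_mult_right has_integral_cis_int) auto
  also have "(\<lambda>t. \<Sum>l\<le>n. \<Sum>i\<le>m. C i l * cis (of_int (int i - int l) * t)) =
      (\<lambda>t. (u + v * cis t) ^ m * (u' + v' * cis (- t)) ^ n)"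
  proof
    fix t
    have "(u + v * cis t) ^ m = (\<Sum>i\<le>m. of_nat (m choose i) * (v * cis t) ^ i * u ^ (m - i))"
      by (subst add.commute, subst binomial_ring) simp
    moreover have "(u' + v' * cis (- t)) ^ n = (\<Sum>l\<le>n. of_nat (n choose l) * (v' * cis (- t)) ^ l * u' ^ (n - l))"
      by (subst add.commute, subst binomial_ring) simp
    ultimately show "(\<Sum>l\<le>n. \<Sum>i\<le>m. C i l * cis (of_int (int i - int l) * t)) =
        (u + v * cis t) ^ m * (u' + v' * cis (- t)) ^ n"
      unfolding cis[symmetric] by (subst sum.swap) (simp add: sum_product C_def power_mult_distrib mult_ac)
  qed
  also have "(\<Sum>l\<le>n. \<Sum>i\<le>m. C i l * (if int i - int l = 0 then complex_of_real (2 * pi) else 0)) =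
     (\<Sum>l\<le>n. \<Sum>i\<le>m. if i = l then C i l * of_real (2 * pi) else 0)"
    by (intro sum.cong refl) auto
  also have "\<dots> = (\<Sum>l\<le>n. C l l * of_real (2 * pi))"
    using assms by (intro sum.cong refl) simp
  also have "\<dots> = of_real (2 * pi) * (\<Sum>i\<le>n. of_nat (m choose i) * of_nat (n choose i) * u ^ (m - i) * u' ^ (n - i) * (v * v') ^ i)"
    by (simp add: C_def sum_distrib_left power_mult_distrib mult_ac)
  finally show ?thesis .
qed

section \<open>Jacobi polynomials with natural parameters and a contiguous relation\<close>

definition jacobi_coeff :: "nat \<Rightarrow> nat \<Rightarrow> nat \<Rightarrow> nat \<Rightarrow> real" where
  "jacobi_coeff \<alpha> \<beta> k s = real ((k + \<alpha>) choose (k - s)) * real ((k + \<beta>) choose s)"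

lemma jacobi_poly_nat:
  "jacobi_poly (real \<alpha>) (real \<beta>) k x =
     (\<Sum>s\<le>k. jacobi_coeff \<alpha> \<beta> k s * ((x - 1) / 2) ^ s * ((x + 1) / 2) ^ (k - s))"
  unfolding jacobi_poly_def jacobi_coeff_def by (simp flip: of_nat_add binomial_gbinomial)

lemma jacobi_poly_1: "jacobi_poly (real \<alpha>) (real \<beta>) k 1 = real ((k + \<alpha>) choose k)"
proof -
  have "jacobi_poly (real \<alpha>) (real \<beta>) k 1 = (\<Sum>s\<le>k. if s = 0 then jacobi_coeff \<alpha> \<beta> k s else 0)"
    unfolding jacobi_poly_nat by (intro sum.cong refl) (auto simp: power_0_left)
  also have "\<dots> = real ((k + \<alpha>) choose k)" by (simp add: jacobi_coeff_def)
  finally show ?thesis .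
qed

lemma jacobi_poly_1_pos: "jacobi_poly (real \<alpha>) (real \<beta>) k 1 > 0"
  by (simp add: jacobi_poly_1)

text \<open>The coefficient form of the relation that raises \<open>\<alpha>\<close> by one. After
  multiplication by \<open>\<alpha> + s + 1\<close> the absorption identities turn every binomial
  product into a multiple of \<open>X * Y\<close>, and a polynomial identity remains. The two
  conditionals are the boundary terms of an index shift.\<close>

lemma jacobi_coeff_contiguous:
  assumes "s \<le> Suc n"
  shows "real (Suc n + \<alpha> + \<beta> + 1) * jacobi_coeff (Suc \<alpha>) \<beta> (Suc n) s =
         real (2 * Suc n + \<alpha> + \<beta> + 1) * jacobi_coeff \<alpha> \<beta> (Suc n) s
         + real (Suc n + \<beta>) * ((if s \<le> n then jacobi_coeff (Suc \<alpha>) \<beta> n s else 0)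
                               - (if s \<ge> 1 then jacobi_coeff (Suc \<alpha>) \<beta> n (s - 1) else 0))"
proof -
  define N where "N = Suc n"
  define X where "X = real ((N + \<alpha>) choose (N - s))"
  define Y where "Y = real ((N + \<beta>) choose s)"
  have s: "s \<le> N" using assms by (simp add: N_def)
  have 1: "real (\<alpha> + s + 1) * real ((N + Suc \<alpha>) choose (N - s)) = real (N + \<alpha> + 1) * X"
  proof -
    have "(N + Suc \<alpha> - (N - s)) * ((N + Suc \<alpha>) choose (N - s)) = (N + Suc \<alpha>) * ((N + Suc \<alpha> - 1) choose (N - s))"
      by (rule binomial_absorb_comp)
    moreover have "N + Suc \<alpha> - (N - s) = \<alpha> + s + 1" using s by simp
    ultimately have "(\<alpha> + s + 1) * ((N + Suc \<alpha>) choose (N - s)) = (N + \<alpha> + 1) * ((N + \<alpha>) choose (N - s))" by simp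
    from arg_cong[OF this, of real] show ?thesis unfolding X_def by (simp only: of_nat_mult)
  qed
  have 2: "real (\<alpha> + s + 1) * (if s \<le> n then real ((n + Suc \<alpha>) choose (n - s)) else 0) = real (N - s) * X"
  proof (cases "s \<le> n")
    case True
    then have *: "N - s = Suc (n - s)" by (simp add: N_def)
    have "Suc (n - s) * ((N + \<alpha>) choose Suc (n - s)) = (N + \<alpha> - (n - s)) * ((N + \<alpha>) choose (n - s))"
      using binomial_absorption[of "n - s" "N + \<alpha>"] binomial_absorb_comp[of "N + \<alpha>" "n - s"] by simp
    moreover have "N + \<alpha> - (n - s) = \<alpha> + s + 1" "N + \<alpha> = n + Suc \<alpha>" using True by (auto simp: N_def)
    ultimately have "(\<alpha> + s + 1) * ((n + Suc \<alpha>) choose (n - s)) = (N - s) * ((N + \<alpha>) choose (N - s))"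
      using * by simp
    from arg_cong[OF this, of real] show ?thesis unfolding X_def using True by (simp only: of_nat_mult if_True)
  next
    case False
    then show ?thesis using s by (simp add: N_def)
  qed
  have 3: "real (N + \<beta>) * real ((n + \<beta>) choose s) = (real N + real \<beta> - real s) * Y"
  proof -
    have "(N + \<beta> - s) * ((N + \<beta>) choose s) = (N + \<beta>) * ((n + \<beta>) choose s)"
      using binomial_absorb_comp[of "N + \<beta>" s] by (simp add: N_def)
    from arg_cong[OF this, of real] show ?thesis
      using s unfolding Y_def of_nat_mult by simp
  qed
  have 4: "real (N + \<beta>) * (if s \<ge> 1 then real ((n + \<beta>) choose (s - 1)) else 0) = real s * Y"
  proof (cases s)
    case (Suc s')
    have "Suc s' * ((N + \<beta>) choose Suc s') = (N + \<beta>) * ((n + \<beta>) choose s')"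
      using binomial_absorption[of s' "N + \<beta>"] by (simp add: N_def)
    from arg_cong[OF this, of real] show ?thesis unfolding Y_def Suc by (simp only: of_nat_mult) simp
  qed simp
  have 5: "(if s \<ge> 1 then jacobi_coeff (Suc \<alpha>) \<beta> n (s - 1) else 0) =
       X * (if s \<ge> 1 then real ((n + \<beta>) choose (s - 1)) else 0)"
    using assms by (cases s) (auto simp: jacobi_coeff_def X_def N_def)
  have 6: "(if s \<le> n then jacobi_coeff (Suc \<alpha>) \<beta> n s else 0) =
       (if s \<le> n then real ((n + Suc \<alpha>) choose (n - s)) else 0) * real ((n + \<beta>) choose s)"
    by (simp add: jacobi_coeff_def)
  let ?a = "real (\<alpha> + s + 1)"
  let ?L = "real (N + \<alpha> + \<beta> + 1) * jacobi_coeff (Suc \<alpha>) \<beta> N s"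
  let ?U = "(if s \<le> n then real ((n + Suc \<alpha>) choose (n - s)) else 0)"
  let ?V = "(if s \<ge> 1 then real ((n + \<beta>) choose (s - 1)) else 0)"
  let ?R = "real (2 * N + \<alpha> + \<beta> + 1) * jacobi_coeff \<alpha> \<beta> N s
         + real (N + \<beta>) * (?U * real ((n + \<beta>) choose s) - X * ?V)"
  have "?a * ?L = real (N + \<alpha> + \<beta> + 1) * (?a * real ((N + Suc \<alpha>) choose (N - s))) * Y"
    by (simp add: jacobi_coeff_def Y_def)
  also have "\<dots> = real (N + \<alpha> + \<beta> + 1) * real (N + \<alpha> + 1) * X * Y"
    unfolding 1 by simp
  finally have L: "?a * ?L = real (N + \<alpha> + \<beta> + 1) * real (N + \<alpha> + 1) * X * Y" .
  have "?a * ?R = ?a * real (2 * N + \<alpha> + \<beta> + 1) * (X * Y)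
      + (?a * ?U) * (real (N + \<beta>) * real ((n + \<beta>) choose s)) - ?a * X * (real (N + \<beta>) * ?V)"
    unfolding jacobi_coeff_def X_def[symmetric] Y_def[symmetric] by (simp only: algebra_simps)
  also have "\<dots> = ?a * real (2 * N + \<alpha> + \<beta> + 1) * (X * Y)
      + (real (N - s) * X) * ((real N + real \<beta> - real s) * Y) - ?a * X * (real s * Y)"
    unfolding 2 3 4 ..
  also have "\<dots> = ?a * ?L"
    unfolding L using s by (simp add: algebra_simps)
  finally have "?L = ?R" by simp
  then show ?thesis unfolding 5 6 N_def by simp
qed

lemma jacobi_poly_contiguous:
  "real (Suc n + \<alpha> + \<beta> + 1) * jacobi_poly (real (Suc \<alpha>)) (real \<beta>) (Suc n) x =
     real (2 * Suc n + \<alpha> + \<beta> + 1) * jacobi_poly (real \<alpha>) (real \<beta>) (Suc n) x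
     + real (Suc n + \<beta>) * jacobi_poly (real (Suc \<alpha>)) (real \<beta>) n x"
proof -
  define A where "A = (x - 1) / 2"
  define B where "B = (x + 1) / 2"
  define J where "J = jacobi_coeff (Suc \<alpha>) \<beta> n"
  \<comment> \<open>Multiplying by \<open>B - A = 1\<close> lifts the form of degree
    \<open>n\<close> in \<open>A\<close> and \<open>B\<close> to degree \<open>Suc n\<close>, so
    that coefficients can be compared.\<close>
  have "B - A = 1" by (simp add: A_def B_def field_simps)
  then have "(\<Sum>s\<le>n. J s * A ^ s * B ^ (n - s)) = B * (\<Sum>s\<le>n. J s * A ^ s * B ^ (n - s)) - A * (\<Sum>s\<le>n. J s * A ^ s * B ^ (n - s))"
    by (simp flip: left_diff_distrib)
  also have "B * (\<Sum>s\<le>n. J s * A ^ s * B ^ (n - s)) = (\<Sum>s\<le>n. J s * A ^ s * B ^ (Suc n - s))"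
    by (simp add: sum_distrib_left Suc_diff_le mult_ac)
  also have "\<dots> = (\<Sum>s\<le>Suc n. (if s \<le> n then J s else 0) * A ^ s * B ^ (Suc n - s))"
    by (simp add: Suc_diff_le)
  also have "A * (\<Sum>s\<le>n. J s * A ^ s * B ^ (n - s)) = (\<Sum>s\<le>n. J s * A ^ Suc s * B ^ (n - s))"
    by (simp add: sum_distrib_left mult_ac)
  also have "\<dots> = (\<Sum>s\<le>Suc n. (if s \<ge> 1 then J (s - 1) else 0) * A ^ s * B ^ (Suc n - s))"
    by (subst sum.atMost_Suc_shift) simp
  finally have *: "(\<Sum>s\<le>n. J s * A ^ s * B ^ (n - s)) =
     (\<Sum>s\<le>Suc n. ((if s \<le> n then J s else 0) - (if s \<ge> 1 then J (s - 1) else 0)) * A ^ s * B ^ (Suc n - s))"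
    by (simp only: left_diff_distrib sum_subtractf)
  have "real (Suc n + \<alpha> + \<beta> + 1) * jacobi_poly (real (Suc \<alpha>)) (real \<beta>) (Suc n) x =
     (\<Sum>s\<le>Suc n. (real (Suc n + \<alpha> + \<beta> + 1) * jacobi_coeff (Suc \<alpha>) \<beta> (Suc n) s) * A ^ s * B ^ (Suc n - s))"
    unfolding jacobi_poly_nat A_def B_def by (simp only: sum_distrib_left mult.assoc)
  also have "\<dots> = (\<Sum>s\<le>Suc n. (real (2 * Suc n + \<alpha> + \<beta> + 1) * jacobi_coeff \<alpha> \<beta> (Suc n) s
         + real (Suc n + \<beta>) * ((if s \<le> n then J s else 0) - (if s \<ge> 1 then J (s - 1) else 0))) * A ^ s * B ^ (Suc n - s))"
    unfolding J_def by (intro sum.cong refl) (simp only: jacobi_coeff_contiguous atMost_iff)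
  also have "\<dots> = real (2 * Suc n + \<alpha> + \<beta> + 1) * (\<Sum>s\<le>Suc n. jacobi_coeff \<alpha> \<beta> (Suc n) s * A ^ s * B ^ (Suc n - s))
     + real (Suc n + \<beta>) * (\<Sum>s\<le>Suc n. ((if s \<le> n then J s else 0) - (if s \<ge> 1 then J (s - 1) else 0)) * A ^ s * B ^ (Suc n - s))"
    by (simp only: distrib_right sum.distrib sum_distrib_left mult.assoc)
  also have "\<dots> = real (2 * Suc n + \<alpha> + \<beta> + 1) * jacobi_poly (real \<alpha>) (real \<beta>) (Suc n) x
     + real (Suc n + \<beta>) * jacobi_poly (real (Suc \<alpha>)) (real \<beta>) n x"
    unfolding jacobi_poly_nat *[symmetric] unfolding A_def B_def J_def ..
  finally show ?thesis .
qed

text \<open>The contiguous relation has positive coefficients and holds at \<open>1\<close> as well.\<close>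

lemma jacobi_poly_bound_lift:
  assumes "\<And>k. \<bar>c * jacobi_poly 0 (real \<beta>) k x\<bar> \<le> e * jacobi_poly 0 (real \<beta>) k 1"
  shows "\<bar>c * jacobi_poly (real \<alpha>) (real \<beta>) k x\<bar> \<le> e * jacobi_poly (real \<alpha>) (real \<beta>) k 1"
proof (induction \<alpha> arbitrary: k)
  case 0
  then show ?case using assms by simp
next
  case (Suc \<alpha>)
  show ?case
  proof (induction k)
    case 0
    show ?case using assms[of 0] by (simp add: jacobi_poly_def)
  next
    case (Suc n)
    let ?p = "real (Suc n + \<alpha> + \<beta> + 1)" and ?q = "real (2 * Suc n + \<alpha> + \<beta> + 1)" and ?r = "real (Suc n + \<beta>)"
    let ?J = "\<lambda>\<alpha> k x. jacobi_poly (real \<alpha>) (real \<beta>) k x"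
    have "?p * \<bar>c * ?J (Suc \<alpha>) (Suc n) x\<bar> = \<bar>c * (?p * ?J (Suc \<alpha>) (Suc n) x)\<bar>"
      by (simp add: abs_mult)
    also have "\<dots> = \<bar>?q * (c * ?J \<alpha> (Suc n) x) + ?r * (c * ?J (Suc \<alpha>) n x)\<bar>"
      unfolding jacobi_poly_contiguous by (simp add: algebra_simps)
    also have "\<dots> \<le> ?q * \<bar>c * ?J \<alpha> (Suc n) x\<bar> + ?r * \<bar>c * ?J (Suc \<alpha>) n x\<bar>"
      by (rule order_trans[OF abs_triangle_ineq]) (simp add: abs_mult)
    also have "\<dots> \<le> ?q * (e * ?J \<alpha> (Suc n) 1) + ?r * (e * ?J (Suc \<alpha>) n 1)"
      using \<open>\<And>k. \<bar>c * ?J \<alpha> k x\<bar> \<le> e * ?J \<alpha> k 1\<close> Suc.IH by (intro add_mono mult_left_mono) auto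
    also have "\<dots> = e * (?q * ?J \<alpha> (Suc n) 1 + ?r * ?J (Suc \<alpha>) n 1)" by (simp only: algebra_simps)
    also have "\<dots> = ?p * (e * ?J (Suc \<alpha>) (Suc n) 1)"
      unfolding jacobi_poly_contiguous[symmetric] by simp
    finally show ?case by simp
  qed
qed

text \<open>By \<open>x \<le> exp (x - 1)\<close> it suffices to bound
  \<open>m (T - 1) + n (T' - 1)\<close>. Twice this is \<open>(m T^2 - m) + (n T'^2 - n)\<close>,
  which is at most 0 by \<open>P + Q = m + n\<close>, minus the squares
  \<open>m (T - 1)^2 + n (T' - 1)^2\<close>. The first square is at least
  \<open>(P - m)^2 / (4 (m + n))\<close>, and halving gives the constant 8. Only an inequality is
  asked of \<open>T'\<close>, which leaves room for \<open>n = 0\<close>.\<close>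

lemma power_prod_le_exp:
  fixes P Q T T' :: real and m n :: nat
  assumes m: "m > 0" and T: "T \<ge> 0" "real m * T\<^sup>2 = P" and T': "T' \<ge> 0" "real n * T'\<^sup>2 \<le> Q"
    and PQ: "P + Q = real (m + n)"
  shows "T ^ m * T' ^ n \<le> exp (- (P - real m)\<^sup>2 / (8 * real (m + n)))"
proof -
  have pow: "x ^ k \<le> exp (real k * (x - 1))" if "x \<ge> 0" for x :: real and k :: nat
  proof -
    have "x \<le> exp (x - 1)" using exp_ge_add_one_self[of "x - 1"] by simp
    then have "x ^ k \<le> exp (x - 1) ^ k" using that by (rule power_mono)
    then show ?thesis by (simp add: exp_of_nat_mult)
  qed
  have "Q \<ge> 0" by (rule order_trans[OF _ T'(2)]) simp
  then have "P \<le> real (m + n)" using PQ by simp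
  have lower: "real m * (T - 1)\<^sup>2 \<ge> (P - real m)\<^sup>2 / (4 * real (m + n))"
  proof -
    have "(P - real m)\<^sup>2 = (real m * (T - 1)\<^sup>2) * (real m * (T + 1)\<^sup>2)"
      unfolding T(2)[symmetric] by algebra
    also have "real m * (T + 1)\<^sup>2 \<le> 2 * P + 2 * real m"
    proof -
      have "2 * P + 2 * real m - real m * (T + 1)\<^sup>2 = real m * (T - 1)\<^sup>2"
        unfolding T(2)[symmetric] by algebra
      then show ?thesis by (smt (verit) mult_nonneg_nonneg of_nat_0_le_iff zero_le_power2)
    qed
    also have "2 * P + 2 * real m \<le> 4 * real (m + n)" using \<open>P \<le> real (m + n)\<close> by simp
    finally have "(P - real m)\<^sup>2 \<le> (real m * (T - 1)\<^sup>2) * (4 * real (m + n))"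
      by (simp add: mult_left_mono)
    then show ?thesis using m by (simp add: divide_le_eq)
  qed
  have "T ^ m * T' ^ n \<le> exp (real m * (T - 1)) * exp (real n * (T' - 1))"
    using T T' by (intro mult_mono pow) auto
  also have "\<dots> = exp (real m * (T - 1) + real n * (T' - 1))" by (simp add: exp_add)
  also have "\<dots> \<le> exp (- (P - real m)\<^sup>2 / (8 * real (m + n)))"
  proof -
    define E where "E = (P - real m)\<^sup>2 / (4 * real (m + n))"
    have "2 * (real m * (T - 1)) = (P - real m) - real m * (T - 1)\<^sup>2"
      unfolding T(2)[symmetric] by algebra
    moreover have "2 * (real n * (T' - 1)) = (real n * T'\<^sup>2 - real n) - real n * (T' - 1)\<^sup>2" by algebra
    moreover have "real n * (T' - 1)\<^sup>2 \<ge> 0" by simp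
    moreover have "- (P - real m)\<^sup>2 / (8 * real (m + n)) = - E / 2"
      by (simp add: E_def)
    moreover have "P - real m + (Q - real n) = 0" using PQ by simp
    ultimately show ?thesis using lower T'(2) unfolding E_def[symmetric] exp_le_cancel_iff by linarith
  qed
  finally show ?thesis .
qed

text \<open>
  \<open>r ^ (m - n) * P\<^sub>n\<close> is the constant term of \<open>(r + \<i> s w)\<^sup>m (r + \<i> s / w)\<^sup>n\<close>. On the circle of radius
  \<open>\<rho> = sqrt (n / m)\<close>, which carries the saddle points in the oscillatory range, the quantities \<open>P\<close> and
  \<open>Q\<close> below add up to \<open>m + n\<close>, and the modulus of the integrand is at most \<open>1\<close>.
\<close>

lemma jacobi_poly_0_integral_bound:
  fixes r s :: real
  assumes m: "m > 0" and nm: "n \<le> m" and rs: "r \<ge> 0" "s \<ge> 0" "r\<^sup>2 + s\<^sup>2 = 1"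
  shows "2 * pi * \<bar>r ^ (m - n) * jacobi_poly 0 (real (m - n)) n (2 * r\<^sup>2 - 1)\<bar> \<le>
    integral {0..2*pi} (\<lambda>t. exp (- (s * (s * real (m - n) + 2 * r * sqrt (real m * real n) * sin t))\<^sup>2 / (8 * real (m + n))))"
    (is "?lhs \<le> integral _ ?G")
proof -
  define \<rho> where "\<rho> = sqrt (real n) / sqrt (real m)"
  define \<rho>' where "\<rho>' = sqrt (real m) / sqrt (real n)"
  define u where "u = complex_of_real r"
  define v where "v = \<i> * complex_of_real (s * \<rho>)"
  define v' where "v' = \<i> * complex_of_real (s * \<rho>')"
  define F where "F = (\<lambda>t. (u + v * cis t) ^ m * (u + v' * cis (- t)) ^ n)"
  \<comment> \<open>For \<open>n = 0\<close> division by zero makes \<open>\<rho>' = 0\<close>, but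
    then only \<open>i = 0\<close> occurs and both sides are 1.\<close>
  have vv: "(v * v') ^ i = of_real ((- s\<^sup>2) ^ i)" if "i \<le> n" for i
  proof (cases "n = 0")
    case False
    then have "\<rho> * \<rho>' = 1" using m by (simp add: \<rho>_def \<rho>'_def)
    then have "v * v' = of_real (- s\<^sup>2)"
      unfolding v_def v'_def by (simp add: complex_eq_iff power2_eq_square)
    then show ?thesis by simp
  qed (use that in simp)
  let ?R = "r ^ (m - n) * jacobi_poly 0 (real (m - n)) n (2 * r\<^sup>2 - 1)"
  have "?R = (\<Sum>i\<le>n. real (m choose i) * real (n choose i) * r ^ (m - i) * r ^ (n - i) * (- s\<^sup>2) ^ i)"
  proof -
    have "(2 * r\<^sup>2 - 1 - 1) / 2 = - s\<^sup>2" "(2 * r\<^sup>2 - 1 + 1) / 2 = r * r" using rs by (auto simp: power2_eq_square)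
    then have "?R = r ^ (m - n) * (\<Sum>i\<le>n. jacobi_coeff 0 (m - n) n i * (- s\<^sup>2) ^ i * (r * r) ^ (n - i))"
      using jacobi_poly_nat[of 0 "m - n" n "2 * r\<^sup>2 - 1"] by simp
    also have "\<dots> = (\<Sum>i\<le>n. real (m choose i) * real (n choose i) * r ^ (m - i) * r ^ (n - i) * (- s\<^sup>2) ^ i)"
      unfolding sum_distrib_left
    proof (intro sum.cong refl)
      fix i assume "i \<in> {..n}"
      then have i: "i \<le> n" by simp
      then have "n choose (n - i) = n choose i" by (rule binomial_symmetric[symmetric])
      moreover have "r ^ (m - i) = r ^ (m - n) * r ^ (n - i)"
        using i nm by (simp flip: power_add)
      ultimately show "r ^ (m - n) * (jacobi_coeff 0 (m - n) n i * (- s\<^sup>2) ^ i * (r * r) ^ (n - i)) =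
        real (m choose i) * real (n choose i) * r ^ (m - i) * r ^ (n - i) * (- s\<^sup>2) ^ i"
        using nm by (simp add: jacobi_coeff_def power_mult_distrib mult_ac)
    qed
    finally show ?thesis .
  qed
  then have R: "complex_of_real ?R = (\<Sum>i\<le>n. of_nat (m choose i) * of_nat (n choose i) * u ^ (m - i) * u ^ (n - i) * (v * v') ^ i)"
    by (simp only: of_real_sum u_def) (intro sum.cong refl, simp add: vv)
  have F: "(F has_integral of_real (2 * pi) * of_real ?R) {0..2*pi}"
    unfolding R F_def by (rule has_integral_trig_product[OF nm])
  have bound: "norm (F t) \<le> ?G t" for t
  proof -
    define P where "P = real m * r\<^sup>2 + real n * s\<^sup>2 - 2 * r * s * sqrt (real m * real n) * sin t"
    define Q where "Q = real n * r\<^sup>2 + real m * s\<^sup>2 + 2 * r * s * sqrt (real m * real n) * sin t"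
    have sc: "(cos t)\<^sup>2 = 1 - (sin t)\<^sup>2" by (simp add: cos_squared_eq)
    have "(cmod (u + v * cis t))\<^sup>2 = (r - s * \<rho> * sin t)\<^sup>2 + (s * \<rho> * cos t)\<^sup>2"
      unfolding cmod_power2 u_def v_def by simp
    also have "\<dots> = r\<^sup>2 + s\<^sup>2 * \<rho>\<^sup>2 - 2 * r * s * \<rho> * sin t"
      by (simp add: sc power2_diff algebra_simps)
    finally have T2: "(cmod (u + v * cis t))\<^sup>2 = r\<^sup>2 + s\<^sup>2 * \<rho>\<^sup>2 - 2 * r * s * \<rho> * sin t" .
    have "real m * (cmod (u + v * cis t))\<^sup>2 = real m * r\<^sup>2 + s\<^sup>2 * (real m * \<rho>\<^sup>2) - 2 * r * s * (real m * \<rho>) * sin t"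
      unfolding T2 by (simp add: algebra_simps)
    moreover have "real m * \<rho>\<^sup>2 = real n" using m by (simp add: \<rho>_def power_divide)
    moreover have "real m * \<rho> = sqrt (real m * real n)" using m
      by (simp add: \<rho>_def real_sqrt_mult field_simps)
    ultimately have 1: "real m * (cmod (u + v * cis t))\<^sup>2 = P" by (simp add: P_def)
    \<comment> \<open>This is an equality unless \<open>n = 0\<close>, when the left side is 0 and
      \<open>Q\<close> is \<open>m * s^2\<close>.\<close>
    have Q0: "real n * (cmod (u + v' * cis (- t)))\<^sup>2 \<le> Q"
    proof (cases "n = 0")
      case False
      have "(cmod (u + v' * cis (- t)))\<^sup>2 = (r + s * \<rho>' * sin t)\<^sup>2 + (s * \<rho>' * cos t)\<^sup>2"
        unfolding cmod_power2 u_def v'_def by simp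
      also have "\<dots> = r\<^sup>2 + s\<^sup>2 * \<rho>'\<^sup>2 + 2 * r * s * \<rho>' * sin t"
        by (simp add: sc power2_sum algebra_simps)
      finally have T2: "(cmod (u + v' * cis (- t)))\<^sup>2 = r\<^sup>2 + s\<^sup>2 * \<rho>'\<^sup>2 + 2 * r * s * \<rho>' * sin t" .
      have "real n * (cmod (u + v' * cis (- t)))\<^sup>2 = real n * r\<^sup>2 + s\<^sup>2 * (real n * \<rho>'\<^sup>2) + 2 * r * s * (real n * \<rho>') * sin t"
        unfolding T2 by (simp add: algebra_simps)
      moreover have "real n * \<rho>'\<^sup>2 = real m" using False by (simp add: \<rho>'_def power_divide)
      moreover have "real n * \<rho>' = sqrt (real m * real n)" using False
        by (simp add: \<rho>'_def real_sqrt_mult field_simps)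
      ultimately show ?thesis by (simp add: Q_def)
    qed (simp add: Q_def)
    have "P + Q = real (m + n) * (r\<^sup>2 + s\<^sup>2)" by (simp add: P_def Q_def algebra_simps)
    then have PQ: "P + Q = real (m + n)" using rs by simp
    have "P - real m = - (s * (s * real (m - n) + 2 * r * sqrt (real m * real n) * sin t))"
    proof -
      have r2: "r\<^sup>2 = 1 - s\<^sup>2" using rs by simp
      show ?thesis unfolding P_def r2 of_nat_diff[OF nm] by (simp add: algebra_simps power2_eq_square)
    qed
    then have "(P - real m)\<^sup>2 = (s * (s * real (m - n) + 2 * r * sqrt (real m * real n) * sin t))\<^sup>2"
      by (simp only: power2_minus)
    moreover have "norm (F t) \<le> exp (- (P - real m)\<^sup>2 / (8 * real (m + n)))"
      unfolding F_def norm_mult norm_power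
      by (rule power_prod_le_exp[OF m _ 1 _ Q0 PQ]) auto
    ultimately show ?thesis by simp
  qed
  have "norm (integral {0..2*pi} F) \<le> integral {0..2*pi} ?G"
  proof (rule integral_norm_bound_integral)
    show "F integrable_on {0..2*pi}" using F by blast
    show "?G integrable_on {0..2*pi}"
      using m by (intro integrable_continuous_real continuous_intros) auto
  qed (rule bound)
  moreover have "norm (integral {0..2*pi} F) = ?lhs"
    unfolding integral_unique[OF F] norm_mult norm_of_real by simp
  ultimately show ?thesis by simp
qed

lemma negligible_sin_level_set:
  fixes x y :: real
  assumes "x \<noteq> 0 \<or> y \<noteq> 0"
  shows "negligible {t::real. x + y * sin t = 0}"
proof (cases "{t::real. x + y * sin t = 0} = {}")
  case False
  then obtain t0 where t0: "x + y * sin t0 = 0" by auto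
  with assms have y: "y \<noteq> 0" by auto
  have "{t. x + y * sin t = 0} \<subseteq> (\<lambda>k. t0 + 2 * of_int k * pi) ` (UNIV :: int set) \<union> (\<lambda>k. - t0 + (2 * of_int k + 1) * pi) ` (UNIV :: int set)"
  proof
    fix t assume "t \<in> {t. x + y * sin t = 0}"
    then have "x + y * sin t = 0" by simp
    with t0 have "y * sin t = y * sin t0" by linarith
    then have "sin t = sin t0" using y by simp
    then obtain k where "k \<in> \<int>" "t = t0 + 2 * k * pi \<or> t = - t0 + (2 * k + 1) * pi" by (auto simp: sin_eq)
    then show "t \<in> (\<lambda>k. t0 + 2 * of_int k * pi) ` (UNIV :: int set) \<union> (\<lambda>k. - t0 + (2 * of_int k + 1) * pi) ` (UNIV :: int set)"
      by (auto elim!: Ints_cases)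
  qed
  then have "countable {t. x + y * sin t = 0}" by (rule countable_subset) auto
  then show ?thesis
    using countable_imp_null_set_lborel[of "{t. x + y * sin t = 0}"]
    by (simp add: negligible_iff_null_sets null_sets_completionI)
qed simp

text \<open>The bound must hold for all directions of \<open>(X, Y)\<close> at once, hence
  compactness: along a sequence of counterexamples the normalised pairs subconverge to some
  \<open>(x, y)\<close> on the unit circle. The exponent then tends to minus infinity wherever
  \<open>x + y * sin t\<close> is nonzero, that is, almost everywhere, and dominated convergence
  contradicts the lower bound \<open>e\<close>.\<close>

lemma gaussian_sine_integral_small:
  fixes c e :: real
  assumes c: "c > 0" and e: "e > 0"
  shows "\<exists>L. \<forall>X Y. X\<^sup>2 + Y\<^sup>2 \<ge> L \<longrightarrow> integral {0..2*pi} (\<lambda>t. exp (- c * (X + Y * sin t)\<^sup>2)) < e"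
proof (rule ccontr)
  assume "\<not> ?thesis"
  then have "\<forall>k::nat. \<exists>X Y. X\<^sup>2 + Y\<^sup>2 \<ge> real k + 1 \<and> integral {0..2*pi} (\<lambda>t. exp (- c * (X + Y * sin t)\<^sup>2)) \<ge> e"
    by (meson not_less)
  then obtain X Y where XY: "\<And>k. (X k)\<^sup>2 + (Y k)\<^sup>2 \<ge> real k + 1"
    "\<And>k. integral {0..2*pi} (\<lambda>t. exp (- c * (X k + Y k * sin t)\<^sup>2)) \<ge> e" by metis
  define R where "R = (\<lambda>k. sqrt ((X k)\<^sup>2 + (Y k)\<^sup>2))"
  have R2: "(R k)\<^sup>2 = (X k)\<^sup>2 + (Y k)\<^sup>2" for k by (simp add: R_def)
  have Rpos: "R k > 0" for k
    unfolding R_def real_sqrt_gt_0_iff using XY(1)[of k] by linarith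
  define p where "p = (\<lambda>k. (X k / R k, Y k / R k))"
  have "p k \<in> sphere 0 1" for k
  proof -
    have "(X k / R k)\<^sup>2 + (Y k / R k)\<^sup>2 = 1"
      unfolding power_divide add_divide_distrib[symmetric] R2[symmetric] using Rpos[of k] by simp
    then show ?thesis by (simp add: p_def norm_Pair power_divide)
  qed
  then obtain q \<sigma> where q: "q \<in> sphere 0 1" "strict_mono (\<sigma> :: nat \<Rightarrow> nat)" "(p \<circ> \<sigma>) \<longlonglongrightarrow> q"
    using compact_sphere[of "0 :: real \<times> real" 1] unfolding compact_def by blast
  obtain x y where xy: "q = (x, y)" by (cases q)
  have ne: "x \<noteq> 0 \<or> y \<noteq> 0" using q(1) by (auto simp: xy norm_Pair)
  define Z where "Z = {t::real. x + y * sin t = 0}"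
  have Z: "negligible Z" unfolding Z_def by (rule negligible_sin_level_set[OF ne])
  define f where "f = (\<lambda>k t. exp (- c * (X (\<sigma> k) + Y (\<sigma> k) * sin t)\<^sup>2))"
  \<comment> \<open>On the negligible set \<open>Z\<close> the limit of \<open>f k\<close> is
    unknown; the value 0 there makes the convergence hold at every point.\<close>
  define g where "g = (\<lambda>k t. if t \<in> Z then 0 else f k t)"
  have fint: "f k integrable_on {0..2*pi}" for k
    unfolding f_def by (intro integrable_continuous_real continuous_intros)
  have gint: "g k integrable_on {0..2*pi}" for k
    by (rule integrable_spike[OF fint Z]) (auto simp: g_def)
  have geq: "integral {0..2*pi} (g k) = integral {0..2*pi} (f k)" for k
    by (rule integral_spike[OF Z]) (auto simp: g_def)
  have lim: "(\<lambda>k. g k t) \<longlonglongrightarrow> 0" for t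
  proof (cases "t \<in> Z")
    case False
    have a: "(\<lambda>k. X (\<sigma> k) / R (\<sigma> k)) \<longlonglongrightarrow> x" "(\<lambda>k. Y (\<sigma> k) / R (\<sigma> k)) \<longlonglongrightarrow> y"
      using tendsto_fst[OF q(3)] tendsto_snd[OF q(3)] by (simp_all add: p_def xy o_def)
    have b: "(\<lambda>k. (X (\<sigma> k) / R (\<sigma> k) + Y (\<sigma> k) / R (\<sigma> k) * sin t)\<^sup>2) \<longlonglongrightarrow> (x + y * sin t)\<^sup>2"
      by (intro tendsto_intros a)
    have "(x + y * sin t)\<^sup>2 > 0" using False by (simp add: Z_def)
    moreover have "filterlim (\<lambda>k. c * (R (\<sigma> k))\<^sup>2) at_top sequentially"
    proof (rule filterlim_tendsto_pos_mult_at_top[OF tendsto_const c])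
      show "filterlim (\<lambda>k. (R (\<sigma> k))\<^sup>2) at_top sequentially"
      proof (rule filterlim_at_top_mono[OF filterlim_real_sequentially], rule eventuallyI)
        fix k
        have "real k \<le> real (\<sigma> k)" using seq_suble[OF q(2), of k] by simp
        also have "\<dots> \<le> (R (\<sigma> k))\<^sup>2" using XY(1)[of "\<sigma> k"] unfolding R2 by simp
        finally show "real k \<le> (R (\<sigma> k))\<^sup>2" .
      qed
    qed
    ultimately have "filterlim (\<lambda>k. (X (\<sigma> k) / R (\<sigma> k) + Y (\<sigma> k) / R (\<sigma> k) * sin t)\<^sup>2 * (c * (R (\<sigma> k))\<^sup>2)) at_top sequentially"
      by (rule filterlim_tendsto_pos_mult_at_top[OF b])
    also have "(\<lambda>k. (X (\<sigma> k) / R (\<sigma> k) + Y (\<sigma> k) / R (\<sigma> k) * sin t)\<^sup>2 * (c * (R (\<sigma> k))\<^sup>2)) =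
        (\<lambda>k. c * (X (\<sigma> k) + Y (\<sigma> k) * sin t)\<^sup>2)"
    proof
      fix k
      have "X (\<sigma> k) + Y (\<sigma> k) * sin t = R (\<sigma> k) * (X (\<sigma> k) / R (\<sigma> k) + Y (\<sigma> k) / R (\<sigma> k) * sin t)"
        using Rpos[of "\<sigma> k"] by (simp add: field_simps)
      then show "(X (\<sigma> k) / R (\<sigma> k) + Y (\<sigma> k) / R (\<sigma> k) * sin t)\<^sup>2 * (c * (R (\<sigma> k))\<^sup>2) =
          c * (X (\<sigma> k) + Y (\<sigma> k) * sin t)\<^sup>2"
        by (simp only: power_mult_distrib mult_ac)
    qed
    finally have "filterlim (\<lambda>k. - (c * (X (\<sigma> k) + Y (\<sigma> k) * sin t)\<^sup>2)) at_bot sequentially"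
      by (simp add: filterlim_uminus_at_bot)
    then have "(\<lambda>k. exp (- (c * (X (\<sigma> k) + Y (\<sigma> k) * sin t)\<^sup>2))) \<longlonglongrightarrow> 0"
      by (rule filterlim_compose[OF exp_at_bot])
    then show ?thesis using False by (simp add: g_def f_def)
  qed (simp add: g_def)
  have "(\<lambda>k. integral {0..2*pi} (g k)) \<longlonglongrightarrow> integral {0..2*pi} (\<lambda>_. 0)"
  proof (rule dominated_convergence(2)[of g _ "\<lambda>_. 1"])
    show "\<And>k t. norm (g k t) \<le> 1" using c by (auto simp: g_def f_def)
  qed (use gint lim in auto)
  then have "(\<lambda>k. integral {0..2*pi} (f k)) \<longlonglongrightarrow> 0" by (simp add: geq)
  then have "eventually (\<lambda>k. integral {0..2*pi} (f k) < e) sequentially"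
    using e by (rule order_tendstoD)
  then obtain N where "integral {0..2*pi} (f N) < e" by (auto simp: eventually_sequentially)
  then show False using XY(2)[of "\<sigma> N"] by (simp add: f_def)
qed

text \<open>The radial factor of a disk polynomial before normalisation at 1. Kept unnormalised, it
  is bounded by multiples of the value at 1, which is the shape that the contiguous relation
  propagates.\<close>

definition jacobi_radial :: "nat \<Rightarrow> nat \<Rightarrow> nat \<Rightarrow> real \<Rightarrow> real" where
  "jacobi_radial \<alpha> d k r = r ^ d * jacobi_poly (real \<alpha>) (real d) k (2 * r\<^sup>2 - 1)"

lemma jacobi_radial_0_le_1:
  assumes "0 \<le> r" "r \<le> 1"
  shows "\<bar>jacobi_radial 0 d k r\<bar> \<le> 1"
proof (cases "k + d = 0")
  case False
  define s where "s = sqrt (1 - r\<^sup>2)"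
  have rs: "s \<ge> 0" "r\<^sup>2 + s\<^sup>2 = 1" using assms by (auto simp: s_def power_le_one)
  let ?G = "\<lambda>t. exp (- (s * (s * real (k + d - k) + 2 * r * sqrt (real (k + d) * real k) * sin t))\<^sup>2 / (8 * real (k + d + k)))"
  have "2 * pi * \<bar>jacobi_radial 0 d k r\<bar> \<le> integral {0..2*pi} ?G"
    using jacobi_poly_0_integral_bound[of "k + d" k r s] rs assms False by (simp add: jacobi_radial_def)
  also have "\<dots> \<le> integral {0..2*pi} (\<lambda>_. 1)"
    using False by (intro integral_le integrable_continuous_real continuous_intros) auto
  also have "\<dots> = 2 * pi" by simp
  finally show ?thesis by simp
qed (simp add: jacobi_radial_def jacobi_poly_def)

text \<open>Uniformity in \<open>k\<close> is the point. For small \<open>k\<close> the linear term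
  \<open>s * d\<close> drives the exponent of the integral bound, for large \<open>k\<close> the
  sine term does, and their squares together grow at least like a constant times \<open>d\<close>.
  At \<open>r = 0\<close> the sine term is missing, but there the factor \<open>r ^ d\<close>
  vanishes.\<close>

lemma jacobi_radial_0_decay:
  assumes r: "0 \<le> r" "r < 1" and e: "e > 0"
  shows "\<exists>D. \<forall>d\<ge>D. \<forall>k. \<bar>jacobi_radial 0 d k r\<bar> \<le> e"
proof (cases "r = 0")
  case True
  then show ?thesis using e by (intro exI[of _ 1]) (auto simp: jacobi_radial_def power_0_left)
next
  case False
  then have "r > 0" using r by simp
  define s where "s = sqrt (1 - r\<^sup>2)"
  have "r\<^sup>2 < 1" using r by (simp add: power_less_one_iff)
  then have s: "s > 0" "r\<^sup>2 + s\<^sup>2 = 1" by (auto simp: s_def)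
  define c where "c = s\<^sup>2 / 8"
  have c: "c > 0" using s by (simp add: c_def)
  obtain L where L: "\<And>X Y. X\<^sup>2 + Y\<^sup>2 \<ge> L \<Longrightarrow> integral {0..2*pi} (\<lambda>t. exp (- c * (X + Y * sin t)\<^sup>2)) < 2 * pi * e"
    using gaussian_sine_integral_small[OF c, of "2 * pi * e"] e by auto
  define \<mu> where "\<mu> = min (r\<^sup>2) (s\<^sup>2)"
  have \<mu>: "\<mu> > 0" using s \<open>r > 0\<close> by (simp add: \<mu>_def)
  obtain D :: nat where D: "real D \<ge> L / \<mu>" using real_arch_simple by blast
  have "\<bar>jacobi_radial 0 d k r\<bar> \<le> e" if d: "d \<ge> Suc D" for d k
  proof -
    define m where "m = k + d"
    define M where "M = real (m + k)"
    have M: "M > 0" "M \<ge> real D" using d by (auto simp: M_def m_def)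
    \<comment> \<open>The factor \<open>1 / M\<close> of the exponent is absorbed into
      \<open>X\<close> and \<open>Y\<close>; what remains in front of the square is
      \<open>c = s^2 / 8\<close>.\<close>
    define X where "X = s * real d / sqrt M"
    define Y where "Y = 2 * r * sqrt (real m * real k) / sqrt M"
    have XY: "X\<^sup>2 + Y\<^sup>2 \<ge> L"
    proof -
      have "L \<le> \<mu> * real D" using D \<mu> by (simp add: divide_le_eq mult.commute)
      also have "\<dots> \<le> \<mu> * M" using M \<mu> by (intro mult_left_mono) auto
      \<comment> \<open>With \<open>d = m - k\<close> this is
        \<open>d^2 + 4 m k = (m + k)^2\<close>, so that \<open>X^2 + Y^2\<close> is at least
        \<open>\<mu> * M\<close> whatever \<open>k\<close> is.\<close>
      also have "\<dots> = (\<mu> * (real d)\<^sup>2 + \<mu> * (4 * (real m * real k))) / M"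
        using M unfolding M_def m_def by (simp add: field_simps power2_eq_square)
      also have "\<dots> \<le> (s\<^sup>2 * (real d)\<^sup>2 + r\<^sup>2 * (4 * (real m * real k))) / M"
        using M by (intro divide_right_mono add_mono mult_right_mono) (auto simp: \<mu>_def)
      also have "\<dots> = X\<^sup>2 + Y\<^sup>2"
        using M by (simp add: X_def Y_def power_divide power_mult_distrib add_divide_distrib)
      finally show ?thesis .
    qed
    have "2 * pi * \<bar>jacobi_radial 0 d k r\<bar> \<le>
       integral {0..2*pi} (\<lambda>t. exp (- (s * (s * real (m - k) + 2 * r * sqrt (real m * real k) * sin t))\<^sup>2 / (8 * real (m + k))))"
      using jacobi_poly_0_integral_bound[of m k r s] s r d by (simp add: jacobi_radial_def m_def)
    also have "(\<lambda>t. exp (- (s * (s * real (m - k) + 2 * r * sqrt (real m * real k) * sin t))\<^sup>2 / (8 * real (m + k)))) =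
       (\<lambda>t. exp (- c * (X + Y * sin t)\<^sup>2))"
    proof
      fix t
      have "X + Y * sin t = (s * real (m - k) + 2 * r * sqrt (real m * real k) * sin t) / sqrt M"
        by (simp add: X_def Y_def m_def add_divide_distrib)
      then show "exp (- (s * (s * real (m - k) + 2 * r * sqrt (real m * real k) * sin t))\<^sup>2 / (8 * real (m + k))) =
        exp (- c * (X + Y * sin t)\<^sup>2)"
        using M by (simp add: c_def power_divide power_mult_distrib M_def del: of_nat_add)
    qed
    also have "integral {0..2*pi} (\<lambda>t. exp (- c * (X + Y * sin t)\<^sup>2)) < 2 * pi * e" by (rule L[OF XY])
    finally show ?thesis by simp
  qed
  then show ?thesis by blast
qed

lemma jacobi_poly_0_1: "jacobi_poly 0 (real \<beta>) k 1 = 1"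
  using jacobi_poly_1[of 0] by simp

lemma jacobi_radial_le_1:
  assumes "0 \<le> r" "r \<le> 1"
  shows "\<bar>jacobi_radial \<alpha> d k r\<bar> \<le> jacobi_poly (real \<alpha>) (real d) k 1"
  using jacobi_poly_bound_lift[of "r ^ d" d "2 * r\<^sup>2 - 1" 1 \<alpha> k] jacobi_radial_0_le_1[OF assms, of d]
  by (simp add: jacobi_radial_def jacobi_poly_0_1)

lemma jacobi_radial_decay:
  assumes "0 \<le> r" "r < 1" "e > 0"
  shows "\<exists>D. \<forall>d\<ge>D. \<forall>k. \<bar>jacobi_radial \<alpha> d k r\<bar> \<le> e * jacobi_poly (real \<alpha>) (real d) k 1"
proof -
  obtain D where D: "\<And>d k. d \<ge> D \<Longrightarrow> \<bar>jacobi_radial 0 d k r\<bar> \<le> e"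
    using jacobi_radial_0_decay[OF assms] by blast
  have "\<bar>jacobi_radial \<alpha> d k r\<bar> \<le> e * jacobi_poly (real \<alpha>) (real d) k 1" if "d \<ge> D" for d k
    using jacobi_poly_bound_lift[of "r ^ d" d "2 * r\<^sup>2 - 1" e \<alpha> k] D[OF that]
    by (simp add: jacobi_radial_def jacobi_poly_0_1)
  then show ?thesis by blast
qed

section \<open>Disk polynomials: rotation, boundedness and decay\<close>

lemma disk_poly_eq:
  "disk_poly \<alpha> m n z = (if n \<le> m then z ^ (m - n) else cnj z ^ (n - m)) *
     of_real (jacobi_poly (real \<alpha>) (real_of_int \<bar>int m - int n\<bar>) (min m n) (2 * (cmod z)\<^sup>2 - 1) /
              jacobi_poly (real \<alpha>) (real_of_int \<bar>int m - int n\<bar>) (min m n) 1)"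
proof -
  have "rcis (cmod z ^ k) (real k * Arg z) = z ^ k" for k
    using DeMoivre2[of "cmod z" "Arg z" k] by (simp add: rcis_cmod_Arg)
  moreover from this have "rcis (cmod z ^ k) (- (real k * Arg z)) = cnj z ^ k" for k
    by (metis rcis_def cis_cnj complex_cnj_complex_of_real complex_cnj_mult complex_cnj_power)
  moreover have "int m - int n = (if n \<le> m then int (m - n) else - int (n - m))" by auto
  ultimately have "rcis (cmod z ^ nat \<bar>int m - int n\<bar>) (real_of_int (int m - int n) * Arg z) =
      (if n \<le> m then z ^ (m - n) else cnj z ^ (n - m))"
    by (simp only: abs_minus_cancel abs_of_nat nat_int of_int_minus of_int_of_nat_eq mult_minus_left split: if_split) simp
  then show ?thesis by (simp add: disk_poly_def Let_def)
qed

lemma disk_poly_1: "disk_poly \<alpha> m n 1 = 1"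
proof -
  have "jacobi_poly (real \<alpha>) (real (nat \<bar>int m - int n\<bar>)) (min m n) 1 \<noteq> 0"
    using jacobi_poly_1_pos by (metis less_irrefl)
  then show ?thesis by (simp add: disk_poly_eq)
qed

lemma disk_poly_mult_unimodular:
  assumes "cmod \<zeta> = 1"
  shows "disk_poly \<alpha> m n (\<zeta> * z) = \<zeta> powi (int m - int n) * disk_poly \<alpha> m n z"
proof -
  have "cnj \<zeta> = inverse \<zeta>"
    using inverse_unique[of \<zeta> "cnj \<zeta>"] complex_norm_square[of \<zeta>] assms by simp
  moreover have "nat (int m - int n) = m - n" "nat (int n - int m) = n - m" by simp_all
  then have "\<zeta> powi (int m - int n) = (if n \<le> m then \<zeta> ^ (m - n) else inverse \<zeta> ^ (n - m))"
    by (auto simp: power_int_def)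
  ultimately have "(if n \<le> m then (\<zeta> * z) ^ (m - n) else cnj (\<zeta> * z) ^ (n - m)) =
      \<zeta> powi (int m - int n) * (if n \<le> m then z ^ (m - n) else cnj z ^ (n - m))"
    by (simp add: power_mult_distrib)
  then show ?thesis using assms by (simp add: disk_poly_eq norm_mult)
qed

lemma norm_disk_poly:
  "cmod (disk_poly \<alpha> m n z) = \<bar>jacobi_radial \<alpha> (nat \<bar>int m - int n\<bar>) (min m n) (cmod z)\<bar> /
      jacobi_poly (real \<alpha>) (real (nat \<bar>int m - int n\<bar>)) (min m n) 1"
proof -
  have "cmod (if n \<le> m then z ^ (m - n) else cnj z ^ (n - m)) = cmod z ^ nat \<bar>int m - int n\<bar>"
    by (auto simp: norm_power intro!: arg_cong[of _ _ "\<lambda>k. cmod z ^ k"])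
  moreover have "real_of_int \<bar>int m - int n\<bar> = real (nat \<bar>int m - int n\<bar>)" by simp
  ultimately show ?thesis
    using jacobi_poly_1_pos[of \<alpha> "nat \<bar>int m - int n\<bar>" "min m n"]
    unfolding disk_poly_eq norm_mult norm_of_real jacobi_radial_def abs_divide abs_mult
    by simp
qed

lemma norm_disk_poly_le_1:
  assumes "cmod z \<le> 1"
  shows "cmod (disk_poly \<alpha> m n z) \<le> 1"
  unfolding norm_disk_poly pos_divide_le_eq[OF jacobi_poly_1_pos] mult_1
  using assms by (intro jacobi_radial_le_1) auto

lemma disk_poly_decay:
  assumes "cmod z < 1" "e > 0"
  shows "\<exists>D::nat. \<forall>m n. \<bar>int m - int n\<bar> \<ge> int D \<longrightarrow> cmod (disk_poly \<alpha> m n z) \<le> e"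
proof -
  obtain D where D: "\<And>d k. d \<ge> D \<Longrightarrow> \<bar>jacobi_radial \<alpha> d k (cmod z)\<bar> \<le> e * jacobi_poly (real \<alpha>) (real d) k 1"
    using jacobi_radial_decay[of "cmod z" e \<alpha>] assms by auto
  have "cmod (disk_poly \<alpha> m n z) \<le> e" if "\<bar>int m - int n\<bar> \<ge> int D" for m n
    unfolding norm_disk_poly pos_divide_le_eq[OF jacobi_poly_1_pos]
    using that by (intro D) simp
  then show ?thesis by blast
qed

section \<open>Positive semidefinite forms\<close>

definition quad_form :: "'i set \<Rightarrow> ('i \<Rightarrow> 'i \<Rightarrow> complex) \<Rightarrow> ('i \<Rightarrow> complex) \<Rightarrow> complex" where
  "quad_form I A c = (\<Sum>i\<in>I. \<Sum>j\<in>I. c i * cnj (c j) * A i j)"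

definition psd :: "'i set \<Rightarrow> ('i \<Rightarrow> 'i \<Rightarrow> complex) \<Rightarrow> bool" where
  "psd I A \<longleftrightarrow> (\<forall>c. 0 \<le> quad_form I A c)"

lemma quad_form_cong: "(\<And>i j. i \<in> I \<Longrightarrow> j \<in> I \<Longrightarrow> A i j = B i j) \<Longrightarrow> quad_form I A c = quad_form I B c"
  by (simp add: quad_form_def)

lemma psd_cong: "(\<And>i j. i \<in> I \<Longrightarrow> j \<in> I \<Longrightarrow> A i j = B i j) \<Longrightarrow> psd I A = psd I B"
  unfolding psd_def by (simp cong: quad_form_cong)

lemma quad_form_add: "quad_form I (\<lambda>i j. A i j + B i j) c = quad_form I A c + quad_form I B c"
  by (simp add: quad_form_def algebra_simps sum.distrib)

lemma psd_add: "psd I A \<Longrightarrow> psd I B \<Longrightarrow> psd I (\<lambda>i j. A i j + B i j)"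
  by (simp add: psd_def quad_form_add)

lemma psd_sum:
  assumes "\<And>k. k \<in> K \<Longrightarrow> psd I (A k)"
  shows "psd I (\<lambda>i j. \<Sum>k\<in>K. A k i j)"
  using assms
proof (induction K rule: infinite_finite_induct)
  case (insert k K)
  then show ?case using psd_add[of I "A k" "\<lambda>i j. \<Sum>k\<in>K. A k i j"] by simp
qed (simp_all add: psd_def quad_form_def)

lemma quad_form_supp:
  assumes "finite I" "J \<subseteq> I" "\<And>i. i \<in> I - J \<Longrightarrow> c i = 0"
  shows "quad_form I A c = quad_form J A c"
  unfolding quad_form_def using assms
  by (intro sum.mono_neutral_cong_right sum.mono_neutral_right) (auto intro!: sum.neutral)

lemma psd_subset:
  assumes "psd I A" "finite I" "J \<subseteq> I"
  shows "psd J A"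
  unfolding psd_def
proof
  fix c
  have "quad_form I A (\<lambda>i. if i \<in> J then c i else 0) = quad_form J A (\<lambda>i. if i \<in> J then c i else 0)"
    using assms by (intro quad_form_supp) auto
  also have "\<dots> = quad_form J A c" by (simp add: quad_form_def)
  finally show "0 \<le> quad_form J A c" using assms(1) unfolding psd_def by metis
qed

lemma quad_form_insert:
  assumes "finite I" "x \<notin> I"
  shows "quad_form (insert x I) A c = c x * cnj (c x) * A x x + c x * (\<Sum>j\<in>I. cnj (c j) * A x j)
           + cnj (c x) * (\<Sum>i\<in>I. c i * A i x) + quad_form I A c"
  using assms by (simp add: quad_form_def sum.distrib sum_distrib_left algebra_simps)

lemma psd_diag_nonneg:
  assumes "psd I A" "finite I" "i \<in> I"
  shows "0 \<le> A i i"
proof -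
  have "psd {i} A" by (rule psd_subset[OF assms(1,2)]) (use assms in auto)
  then have "0 \<le> quad_form {i} A (\<lambda>_. 1)" unfolding psd_def by blast
  then show ?thesis by (simp add: quad_form_def)
qed

text \<open>The order on the complex numbers makes every value of the form real. Testing two indices
  with coefficients 1, 1 and 1, \<open>\<i>\<close> fixes the imaginary and the real part of the
  symmetry.\<close>

lemma psd_hermitian:
  assumes "psd I A" "finite I" "i \<in> I" "j \<in> I"
  shows "A j i = cnj (A i j)"
proof (cases "i = j")
  case True
  then show ?thesis using psd_diag_nonneg[OF assms(1-3)] by (simp add: less_eq_complex_def complex_eq_iff)
next
  case False
  have "psd {i, j} A" by (rule psd_subset[OF assms(1,2)]) (use assms in auto)
  then have "0 \<le> quad_form {i, j} A (\<lambda>k. if k = i then 1 else b)" for b unfolding psd_def by blast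
  from this[of 1] this[of \<i>] psd_diag_nonneg[OF assms(1-3)] psd_diag_nonneg[OF assms(1,2,4)] False
  show ?thesis by (auto simp: quad_form_def less_eq_complex_def complex_eq_iff)
qed

lemma psd_zero_diag:
  assumes "psd I A" "finite I" "i \<in> I" "j \<in> I" "A i i = 0"
  shows "A i j = 0"
proof (rule ccontr)
  assume ne: "A i j \<noteq> 0"
  then have "i \<noteq> j" using assms by auto
  \<comment> \<open>Chosen so that the two-point form below becomes \<open>- A j j - 2\<close>,
    which is negative.\<close>
  define s where "s = (Re (A j j) + 1) / (cmod (A i j))\<^sup>2"
  have "psd {i, j} A" by (rule psd_subset[OF assms(1,2)]) (use assms in auto)
  then have "0 \<le> quad_form {i, j} A (\<lambda>k. if k = i then - of_real s * cnj (A i j) else 1)"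
    unfolding psd_def by blast
  also have "\<dots> = - of_real s * (cnj (A i j) * A i j) - of_real s * (A i j * cnj (A i j)) + A j j"
    using \<open>i \<noteq> j\<close> psd_hermitian[OF assms(1-4)] assms(5) by (simp add: quad_form_def)
  also have "\<dots> = of_real (- 2 * (s * (cmod (A i j))\<^sup>2)) + A j j"
    unfolding mult.commute[of "cnj (A i j)"] complex_norm_square[symmetric] by simp
  also have "s * (cmod (A i j))\<^sup>2 = Re (A j j) + 1" using ne by (simp add: s_def)
  finally show False using psd_diag_nonneg[OF assms(1,2,4)] by (simp add: less_eq_complex_def)
qed

lemma quad_form_scale:
  "quad_form I (\<lambda>i j. v i * cnj (v j) * B i j) c = quad_form I B (\<lambda>i. c i * v i)"
  by (simp add: quad_form_def mult_ac)

text \<open>Induction by one step of Gaussian elimination: \<open>A\<close> is a rank-one form plus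
  its Schur complement \<open>A'\<close>, whose row and column at \<open>x\<close> vanish. The
  rank-one part times \<open>B\<close> is \<open>B\<close> with rescaled coefficients, and
  \<open>A'\<close> times \<open>B\<close> is covered by the induction hypothesis.\<close>

lemma psd_schur_product:
  assumes "finite I" "psd I A" "psd I B"
  shows "psd I (\<lambda>i j. A i j * B i j)"
  using assms
proof (induction I arbitrary: A rule: finite_induct)
  case empty
  then show ?case by (simp add: psd_def quad_form_def)
next
  case (insert x I)
  note fin = finite.insertI[OF insert.hyps(1), of x]
  define a where "a = A x x"
  \<comment> \<open>If \<open>a = 0\<close>, the row of \<open>x\<close> vanishes, and \<open>A'\<close> is \<open>A\<close> because of \<open>t / 0 = 0\<close>.\<close>
  define A' where "A' = (\<lambda>i j. A i j - A i x * A x j / a)"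
  have a: "0 \<le> a" unfolding a_def using psd_diag_nonneg[OF insert.prems(1) fin] by blast
  have herm: "A x j = cnj (A j x)" if "j \<in> insert x I" for j
    using psd_hermitian[OF insert.prems(1) fin that, of x] by simp
  have row: "A' x j = 0" "A' j x = 0" if "j \<in> insert x I" for j
    using psd_zero_diag[OF insert.prems(1) fin _ that, of x] herm[OF that]
    by (auto simp: A'_def a_def)
  have "psd I A'"
  proof (cases "a = 0")
    case True
    then have "A' = A" by (simp add: A'_def)
    then show ?thesis using psd_subset[OF insert.prems(1) fin, of I] by auto
  next
    case False
    show ?thesis unfolding psd_def
    proof
      fix c
      define \<beta> where "\<beta> = (\<Sum>j\<in>I. c j * A j x)"
      have \<beta>: "cnj \<beta> = (\<Sum>j\<in>I. cnj (c j) * A x j)" unfolding \<beta>_def by (simp add: herm)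
      have ca: "cnj a = a" using a by (simp add: less_eq_complex_def complex_eq_iff)
      \<comment> \<open>The coefficient at \<open>x\<close> that completes the square: the form of
        \<open>A\<close> then equals that of the Schur complement.\<close>
      define c' where "c' = c(x := - \<beta> / a)"
      have c': "c' i = c i" if "i \<in> I" for i using that insert.hyps by (auto simp: c'_def)
      have "quad_form (insert x I) A c' =
          c' x * cnj (c' x) * a + c' x * cnj \<beta> + cnj (c' x) * \<beta> + quad_form I A c"
      proof -
        have "(\<Sum>j\<in>I. cnj (c' j) * A x j) = cnj \<beta>" "(\<Sum>i\<in>I. c' i * A i x) = \<beta>"
          unfolding \<beta> unfolding \<beta>_def by (intro sum.cong refl; simp add: c')+
        moreover have "quad_form I A c' = quad_form I A c" by (simp add: quad_form_def c')
        ultimately show ?thesis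
          unfolding quad_form_insert[OF insert.hyps(1,2)] by (simp only: a_def)
      qed
      also have "\<dots> = quad_form I A c - \<beta> * cnj \<beta> / a"
        using False by (simp add: c'_def ca field_simps)
      also have "\<dots> = quad_form I A' c"
      proof -
        have "\<beta> * cnj \<beta> / a = (\<Sum>i\<in>I. \<Sum>j\<in>I. c i * cnj (c j) * (A i x * A x j / a))"
          unfolding \<beta> unfolding \<beta>_def by (simp add: sum_product sum_divide_distrib mult_ac)
        then show ?thesis unfolding quad_form_def A'_def
          by (simp add: right_diff_distrib sum_subtractf)
      qed
      finally show "0 \<le> quad_form I A' c" using insert.prems(1) unfolding psd_def by metis
    qed
  qed
  then have IH: "psd I (\<lambda>i j. A' i j * B i j)"
    using insert.IH psd_subset[OF insert.prems(2) fin, of I] by blast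
  show ?case unfolding psd_def
  proof
    fix c
    have "quad_form (insert x I) (\<lambda>i j. A i j * B i j) c =
        quad_form (insert x I) (\<lambda>i j. A' i j * B i j + inverse a * (A i x * cnj (A j x) * B i j)) c"
      by (intro quad_form_cong) (simp add: A'_def herm field_simps)
    also have "\<dots> = quad_form (insert x I) (\<lambda>i j. A' i j * B i j) c
        + inverse a * quad_form (insert x I) (\<lambda>i j. A i x * cnj (A j x) * B i j) c"
      unfolding quad_form_add by (simp add: quad_form_def sum_distrib_left mult_ac)
    also have "quad_form (insert x I) (\<lambda>i j. A' i j * B i j) c = quad_form I (\<lambda>i j. A' i j * B i j) c"
      unfolding quad_form_insert[OF insert.hyps(1,2)] by (simp add: row)
    finally have eq: "quad_form (insert x I) (\<lambda>i j. A i j * B i j) c = quad_form I (\<lambda>i j. A' i j * B i j) c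
        + inverse a * quad_form (insert x I) B (\<lambda>i. c i * A i x)"
      by (simp only: quad_form_scale)
    have "0 \<le> inverse a" using a by (auto simp: less_eq_complex_def)
    then show "0 \<le> quad_form (insert x I) (\<lambda>i j. A i j * B i j) c"
      unfolding eq using IH insert.prems(2) by (auto simp: psd_def intro!: add_nonneg_nonneg mult_nonneg_nonneg)
  qed
qed

text \<open>Indices with the same image are merged by adding their coefficients. This serves twice:
  to admit repeated points, and to collapse each circle to one representative.\<close>

lemma quad_form_pullback:
  assumes "finite J" "finite I" "h ` J \<subseteq> I"
  shows "quad_form J (\<lambda>i j. A (h i) (h j)) c = quad_form I A (\<lambda>y. \<Sum>i\<in>{i\<in>J. h i = y}. c i)"
proof -
  have group: "(\<Sum>i\<in>J. f i) = (\<Sum>y\<in>I. \<Sum>i\<in>{i\<in>J. h i = y}. f i)" for f :: "_ \<Rightarrow> complex"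
    by (rule sum.group[OF assms, symmetric])
  have "quad_form J (\<lambda>i j. A (h i) (h j)) c =
     (\<Sum>y\<in>I. \<Sum>i\<in>{i\<in>J. h i = y}. \<Sum>y'\<in>I. \<Sum>j\<in>{j\<in>J. h j = y'}. c i * cnj (c j) * A (h i) (h j))"
    unfolding quad_form_def group ..
  also have "\<dots> = (\<Sum>y\<in>I. \<Sum>i\<in>{i\<in>J. h i = y}. \<Sum>y'\<in>I. \<Sum>j\<in>{j\<in>J. h j = y'}. c i * cnj (c j) * A y y')"
    by (intro sum.cong refl) simp
  also have "\<dots> = (\<Sum>y\<in>I. \<Sum>y'\<in>I. \<Sum>i\<in>{i\<in>J. h i = y}. \<Sum>j\<in>{j\<in>J. h j = y'}. c i * cnj (c j) * A y y')"
    by (intro sum.cong refl sum.swap)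
  also have "\<dots> = quad_form I A (\<lambda>y. \<Sum>i\<in>{i\<in>J. h i = y}. c i)"
    unfolding quad_form_def cnj_sum unfolding sum_product unfolding sum_distrib_right ..
  finally show ?thesis .
qed

lemma psd_pullback:
  assumes "finite J" "finite I" "h ` J \<subseteq> I" "psd I A"
  shows "psd J (\<lambda>i j. A (h i) (h j))"
  using assms(4) unfolding psd_def quad_form_pullback[OF assms(1-3)] by blast

lemma quad_form_reindex:
  assumes "bij_betw h J I"
  shows "quad_form I A c = quad_form J (\<lambda>i j. A (h i) (h j)) (c \<circ> h)"
  unfolding quad_form_def by (simp add: sum.reindex_bij_betw[OF assms, symmetric])

text \<open>Positive definiteness is stated for distinct points numbered from 0. Enumerating the
  image of \<open>h\<close> and pulling back lifts both restrictions; rotated copies of different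
  points may well coincide.\<close>

lemma positive_definite_psd:
  fixes K :: "complex ^ 'q \<Rightarrow> complex ^ 'q \<Rightarrow> complex"
  assumes K: "positive_definite K" and J: "finite J" "h ` J \<subseteq> sphere 0 1"
  shows "psd J (\<lambda>i j. K (h i) (h j))"
proof -
  have "psd X K" if X: "finite X" "X \<subseteq> sphere 0 1" for X
  proof (cases "X = {}")
    case False
    obtain e where e: "bij_betw e {..<card X} X" using ex_bij_betw_nat_finite[OF X(1)] by (auto simp: atLeast0LessThan)
    have "card X \<ge> 1" using False X by (simp add: Suc_le_eq card_gt_0_iff)
    moreover have "e ` {..<card X} \<subseteq> sphere 0 1" "inj_on e {..<card X}"
      using e X(2) by (auto simp: bij_betw_def)
    ultimately have "0 \<le> quad_form {..<card X} (\<lambda>i j. K (e i) (e j)) c" for c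
      using K[unfolded positive_definite_def, rule_format, of "card X" e c] by (simp only: quad_form_def)
    then show ?thesis unfolding psd_def quad_form_reindex[OF e] by blast
  qed (simp add: psd_def quad_form_def)
  then show ?thesis using psd_pullback[of J "h ` J" h K] J by blast
qed

section \<open>Parts of a disk polynomial series\<close>

definition degree_index :: "int set \<Rightarrow> (nat \<times> nat) set" where
  "degree_index D = {p. int (fst p) - int (snd p) \<in> D}"

definition residues :: "nat \<Rightarrow> int \<Rightarrow> int set" where
  "residues N d = {e. int N dvd e - d}"

lemma residues_mod: "residues N (d mod int N) = residues N d"
proof -
  have "int N dvd e - d mod int N \<longleftrightarrow> int N dvd e - d" for e
    unfolding mod_eq_dvd_iff[symmetric] by simp
  then show ?thesis by (simp add: residues_def)
qed

locale disk_series =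
  fixes \<alpha> :: nat and a :: "nat \<Rightarrow> nat \<Rightarrow> real" and f :: "complex \<Rightarrow> complex"
  assumes nonneg: "a m n \<ge> 0"
    and series: "z \<in> cball 0 1 \<Longrightarrow> ((\<lambda>(m, n). of_real (a m n) * disk_poly \<alpha> m n z) has_sum f z) UNIV"
begin

definition summand :: "complex \<Rightarrow> nat \<times> nat \<Rightarrow> complex" where
  "summand z p = of_real (a (fst p) (snd p)) * disk_poly \<alpha> (fst p) (snd p) z"

text \<open>A set \<open>D\<close> of degrees, not one degree, because finite averages see a residue
  class; single degrees enter as the limit in \<open>part_residues_tendsto\<close>.\<close>

definition part :: "int set \<Rightarrow> complex \<Rightarrow> complex" where
  "part D z = infsum (summand z) (degree_index D)"

definition mass :: "int set \<Rightarrow> real" where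
  "mass D = infsum (\<lambda>p. a (fst p) (snd p)) (degree_index D)"

lemma summand_has_sum: "cmod z \<le> 1 \<Longrightarrow> (summand z has_sum f z) UNIV"
  using series[of z] by (simp add: summand_def[abs_def] case_prod_unfold)

lemma part_has_sum: "cmod z \<le> 1 \<Longrightarrow> (summand z has_sum part D z) (degree_index D)"
  unfolding part_def
  by (meson has_sum_infsum has_sum_imp_summable subset_UNIV summable_on_subset_banach summand_has_sum)

lemma coeff_summable: "(\<lambda>p. a (fst p) (snd p)) summable_on A"
proof -
  have "summand 1 summable_on UNIV" using summand_has_sum[of 1] by (auto intro: has_sum_imp_summable)
  from summable_on_Re[OF this] have "(\<lambda>p. a (fst p) (snd p)) summable_on UNIV"
    by (simp add: summand_def disk_poly_1)
  then show ?thesis by (rule summable_on_subset_banach) simp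
qed

lemma mass_has_sum: "((\<lambda>p. a (fst p) (snd p)) has_sum mass D) (degree_index D)"
  unfolding mass_def by (rule has_sum_infsum[OF coeff_summable])

lemma mass_nonneg: "mass D \<ge> 0"
  unfolding mass_def by (rule infsum_nonneg) (simp add: nonneg)

lemma coeff_le_mass: "int m - int n \<in> D \<Longrightarrow> a m n \<le> mass D"
  using finite_sum_le_infsum[OF coeff_summable, of "{(m, n)}" "degree_index D"]
  by (simp add: mass_def degree_index_def nonneg)

lemma mass_pos_iff: "mass D > 0 \<longleftrightarrow> (\<exists>m n. int m - int n \<in> D \<and> a m n > 0)"
proof
  assume "mass D > 0"
  show "\<exists>m n. int m - int n \<in> D \<and> a m n > 0"
  proof (rule ccontr)
    assume "\<not> ?thesis"
    then have "a (fst p) (snd p) = 0" if "p \<in> degree_index D" for p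
      using nonneg[of "fst p" "snd p"] that by (force simp: degree_index_def)
    then have "mass D = 0" unfolding mass_def by (rule infsum_0)
    with \<open>mass D > 0\<close> show False by simp
  qed
next
  assume "\<exists>m n. int m - int n \<in> D \<and> a m n > 0"
  then show "mass D > 0" using coeff_le_mass by (meson less_le_trans)
qed

lemma norm_part_le_mult:
  assumes "cmod z \<le> 1" "\<And>m n. int m - int n \<in> D \<Longrightarrow> cmod (disk_poly \<alpha> m n z) \<le> e"
  shows "cmod (part D z) \<le> e * mass D"
proof (rule norm_infsum_le[OF part_has_sum[OF assms(1)]])
  show "((\<lambda>p. e * a (fst p) (snd p)) has_sum e * mass D) (degree_index D)"
    by (intro has_sum_cmult_right mass_has_sum)
  show "cmod (summand z p) \<le> e * a (fst p) (snd p)" if "p \<in> degree_index D" for p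
  proof -
    have "a (fst p) (snd p) * cmod (disk_poly \<alpha> (fst p) (snd p) z) \<le> a (fst p) (snd p) * e"
      using that by (intro mult_left_mono assms(2) nonneg) (simp add: degree_index_def)
    then show ?thesis using nonneg[of "fst p" "snd p"] by (simp add: summand_def norm_mult mult.commute)
  qed
qed

lemma norm_part_le: "cmod z \<le> 1 \<Longrightarrow> cmod (part D z) \<le> mass D"
  using norm_part_le_mult[of z D 1] norm_disk_poly_le_1 by simp

lemma part_1: "part D 1 = of_real (mass D)"
proof -
  have "(summand 1 has_sum of_real (mass D)) (degree_index D)"
    using has_sum_of_real[OF mass_has_sum[of D]] by (simp add: summand_def[abs_def] disk_poly_1)
  then show ?thesis using part_has_sum[of 1 D] has_sum_unique by fastforce
qed

lemma part_decay:
  assumes "cmod z < 1" "e > 0"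
  shows "\<exists>D::nat. \<forall>d. \<bar>d\<bar> \<ge> int D \<longrightarrow> cmod (part {d} z) \<le> e * mass {d}"
proof -
  obtain D :: nat where D: "\<And>m n. \<bar>int m - int n\<bar> \<ge> int D \<Longrightarrow> cmod (disk_poly \<alpha> m n z) \<le> e"
    using disk_poly_decay[OF assms] by blast
  have "cmod (part {d} z) \<le> e * mass {d}" if "\<bar>d\<bar> \<ge> int D" for d
    using assms that by (intro norm_part_le_mult D) auto
  then show ?thesis by blast
qed

lemma part_mult_unimodular:
  assumes "cmod \<zeta> = 1" "cmod z \<le> 1"
  shows "part {d} (\<zeta> * z) = \<zeta> powi d * part {d} z"
proof -
  have "(summand (\<zeta> * z) has_sum \<zeta> powi d * part {d} z) (degree_index {d})"
  proof (rule has_sum_cong[THEN iffD1, OF _ has_sum_cmult_right[OF part_has_sum[OF assms(2)], of "\<zeta> powi d"]])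
    show "\<zeta> powi d * summand z p = summand (\<zeta> * z) p" if "p \<in> degree_index {d}" for p
      using that assms(1) by (auto simp: summand_def disk_poly_mult_unimodular degree_index_def)
  qed
  moreover have "cmod (\<zeta> * z) \<le> 1" using assms by (simp add: norm_mult)
  ultimately show ?thesis using part_has_sum has_sum_unique by blast
qed

text \<open>Rotation by \<open>\<zeta>\<close> multiplies a term of degree \<open>d\<close> by
  \<open>\<zeta> powi d\<close>, which depends on \<open>d\<close> modulo \<open>N\<close> only. The
  series therefore regroups into \<open>N\<close> parts, one for each residue.\<close>

lemma residue_expansion:
  assumes N: "N > 0" and \<zeta>: "\<zeta> ^ N = 1" "cmod \<zeta> = 1" and z: "cmod z \<le> 1"
  shows "f (\<zeta> * z) = (\<Sum>\<rho><N. \<zeta> ^ \<rho> * part (residues N (int \<rho>)) z)"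
proof -
  have powi: "\<zeta> powi d = \<zeta> ^ nat (d mod int N)" for d
  proof -
    have "\<zeta> \<noteq> 0" using \<zeta>(2) by auto
    have "d = int N * (d div int N) + int (nat (d mod int N))" using N by simp
    then have "\<zeta> powi d = \<zeta> powi (int N * (d div int N)) * \<zeta> ^ nat (d mod int N)"
      using \<open>\<zeta> \<noteq> 0\<close> by (metis power_int_add power_int_of_nat)
    also have "\<zeta> powi (int N * (d div int N)) = 1"
      using \<zeta>(1) by (simp add: power_int_mult)
    finally show ?thesis by simp
  qed
  define idx where "idx = (\<lambda>K. degree_index {e. nat (e mod int N) \<in> K})"
  have one: "(summand (\<zeta> * z) has_sum \<zeta> ^ \<rho> * part (residues N (int \<rho>)) z) (idx {\<rho>})" if "\<rho> < N" for \<rho>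
  proof -
    have idx: "idx {\<rho>} = degree_index (residues N (int \<rho>))"
      using N that by (auto simp: idx_def degree_index_def residues_def mod_eq_dvd_iff[symmetric] nat_eq_iff)
    show ?thesis unfolding idx
    proof (rule has_sum_cong[THEN iffD1, OF _ has_sum_cmult_right[OF part_has_sum[OF z], of "\<zeta> ^ \<rho>"]])
      show "\<zeta> ^ \<rho> * summand z p = summand (\<zeta> * z) p" if "p \<in> degree_index (residues N (int \<rho>))" for p
        using that \<zeta>(2) unfolding idx[symmetric]
        by (simp add: summand_def disk_poly_mult_unimodular idx_def degree_index_def powi)
    qed
  qed
  have "(summand (\<zeta> * z) has_sum (\<Sum>\<rho>\<in>K. \<zeta> ^ \<rho> * part (residues N (int \<rho>)) z)) (idx K)"
    if "finite K" "K \<subseteq> {..<N}" for K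
    using that
  proof (induction K)
    case empty
    then show ?case by (simp add: idx_def degree_index_def)
  next
    case (insert \<rho> K)
    have "idx (insert \<rho> K) = idx {\<rho>} \<union> idx K" "idx {\<rho>} \<inter> idx K = {}"
      using insert.hyps by (auto simp: idx_def degree_index_def)
    then show ?case
      using has_sum_Un_disjoint[OF one[of \<rho>] insert.IH] insert.hyps insert.prems by simp
  qed
  from this[of "{..<N}"] have "(summand (\<zeta> * z) has_sum (\<Sum>\<rho><N. \<zeta> ^ \<rho> * part (residues N (int \<rho>)) z)) (idx {..<N})"
    by simp
  moreover have "idx {..<N} = UNIV"
    using N by (auto simp: idx_def degree_index_def nat_less_iff)
  moreover have "cmod (\<zeta> * z) \<le> 1" using \<zeta> z by (simp add: norm_mult)
  ultimately show ?thesis using summand_has_sum has_sum_unique by fastforce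
qed

text \<open>A finite set \<open>F\<close> of indices carries all but \<open>e / 2\<close> of the
  mass. Once \<open>N\<close> exceeds the distance from \<open>d\<close> of every degree in
  \<open>F\<close>, the residue class of \<open>d\<close> without \<open>d\<close> itself misses
  \<open>F\<close>.\<close>

lemma part_residues_tendsto:
  assumes z: "cmod z \<le> 1"
  shows "(\<lambda>N. part (residues N d) z) \<longlonglongrightarrow> part {d} z"
proof (rule LIMSEQ_I)
  fix e :: real assume "e > 0"
  have "((\<lambda>p. a (fst p) (snd p)) has_sum mass UNIV) UNIV"
    using mass_has_sum[of UNIV] by (simp add: degree_index_def)
  from has_sum_finite_approximation[OF this, of "e / 2"] \<open>e > 0\<close> obtain F where
    F: "finite F" "dist (\<Sum>p\<in>F. a (fst p) (snd p)) (mass UNIV) \<le> e / 2" by auto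
  define B where "B = Max (insert 0 ((\<lambda>p. nat \<bar>int (fst p) - int (snd p) - d\<bar>) ` F))"
  have B: "\<bar>int (fst p) - int (snd p) - d\<bar> \<le> int B" if "p \<in> F" for p
  proof -
    have "nat \<bar>int (fst p) - int (snd p) - d\<bar> \<le> B" unfolding B_def using F(1) that by (intro Max_ge) auto
    then show ?thesis by simp
  qed
  have "norm (part (residues N d) z - part {d} z) < e" if N: "N \<ge> Suc B" for N
  proof -
    define D where "D = residues N d - {d}"
    have D: "degree_index (residues N d) = degree_index {d} \<union> degree_index D"
      "degree_index {d} \<inter> degree_index D = {}"
      by (auto simp: degree_index_def D_def residues_def)
    have "(summand z has_sum (part {d} z + part D z)) (degree_index (residues N d))"
      unfolding D(1) by (rule has_sum_Un_disjoint[OF part_has_sum[OF z] part_has_sum[OF z] D(2)])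
    then have "part (residues N d) z = part {d} z + part D z"
      using part_has_sum[OF z] has_sum_unique by blast
    then have "norm (part (residues N d) z - part {d} z) \<le> mass D" using norm_part_le[OF z] by simp
    also have "mass D \<le> e / 2"
    proof -
      have disj: "F \<inter> degree_index D = {}"
      proof safe
        fix m n assume mn: "(m, n) \<in> F" "(m, n) \<in> degree_index D"
        let ?k = "int m - int n - d"
        have "int N dvd ?k" "?k \<noteq> 0"
          using mn(2) by (auto simp: degree_index_def D_def residues_def)
        then have "int N \<le> \<bar>?k\<bar>" using dvd_imp_le_int[of ?k "int N"] by simp
        with B[OF mn(1)] N show "(m, n) \<in> {}" by simp
      qed
      have "((\<lambda>p. a (fst p) (snd p)) has_sum ((\<Sum>p\<in>F. a (fst p) (snd p)) + mass D)) (F \<union> degree_index D)"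
        using F(1) by (intro has_sum_Un_disjoint mass_has_sum disj) simp
      then have "(\<Sum>p\<in>F. a (fst p) (snd p)) + mass D \<le> mass UNIV"
        using mass_has_sum[of UNIV] by (rule has_sum_mono2) (auto simp: degree_index_def nonneg)
      then show ?thesis using F(2) unfolding dist_real_def by linarith
    qed
    finally show ?thesis using \<open>e > 0\<close> by simp
  qed
  then show "\<exists>no. \<forall>n\<ge>no. norm (part (residues n d) z - part {d} z) < e" by blast
qed

end

section \<open>Hermitian inner product and roots of unity\<close>

lemma hermitian_inner_scale:
  "hermitian_inner (a *s x) (b *s y) = a * cnj b * hermitian_inner x y"
  by (simp add: hermitian_inner_def sum_distrib_left mult_ac)

lemma hermitian_inner_self: "hermitian_inner x x = of_real ((norm x)\<^sup>2)"
proof -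
  have "(norm x)\<^sup>2 = (\<Sum>i\<in>UNIV. (cmod (x $ i))\<^sup>2)"
    by (simp add: norm_vec_def L2_set_def sum_nonneg)
  then show ?thesis by (simp add: hermitian_inner_def flip: complex_norm_square)
qed

text \<open>Pythagoras for the component of \<open>x\<close> orthogonal to \<open>y\<close>. Both
  the Cauchy-Schwarz bound and its equality case, which recognises points of one circle, are read
  off from it.\<close>

lemma hermitian_inner_projection:
  assumes "norm x = 1" "norm y = 1"
  shows "(norm (x - hermitian_inner x y *s y))\<^sup>2 = 1 - (cmod (hermitian_inner x y))\<^sup>2"
proof -
  define h where "h = hermitian_inner x y"
  have cnj_h: "hermitian_inner y x = cnj h" by (simp add: h_def hermitian_inner_def mult.commute)
  have "complex_of_real ((norm (x - h *s y))\<^sup>2) = hermitian_inner (x - h *s y) (x - h *s y)"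
    by (simp only: hermitian_inner_self)
  also have "\<dots> = hermitian_inner x x - cnj h * hermitian_inner x y - h * hermitian_inner y x + h * cnj h * hermitian_inner y y"
    by (simp add: hermitian_inner_def algebra_simps sum.distrib sum_subtractf sum_distrib_left)
  also have "\<dots> = of_real (1 - (cmod h)\<^sup>2)"
  proof -
    have "h * cnj h = of_real ((cmod h)\<^sup>2)" by (rule complex_norm_square[symmetric])
    then show ?thesis using assms by (simp add: hermitian_inner_self cnj_h mult.commute[of "cnj h"] flip: h_def)
  qed
  finally show ?thesis unfolding of_real_eq_iff h_def .
qed

lemma norm_hermitian_inner_le_1:
  assumes "norm x = 1" "norm y = 1"
  shows "cmod (hermitian_inner x y) \<le> 1"
proof -
  have "0 \<le> (norm (x - hermitian_inner x y *s y))\<^sup>2" by simp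
  then have "(cmod (hermitian_inner x y))\<^sup>2 \<le> 1\<^sup>2" unfolding hermitian_inner_projection[OF assms] by simp
  then show ?thesis by (rule power2_le_imp_le) simp
qed

lemma norm_hermitian_inner_eq_1:
  assumes "norm x = 1" "norm y = 1" "cmod (hermitian_inner x y) = 1"
  shows "x = hermitian_inner x y *s y"
  using hermitian_inner_projection[OF assms(1,2)] assms(3) by simp

lemma norm_unimodular_scale:
  assumes "cmod \<zeta> = 1" shows "norm (\<zeta> *s x) = norm x"
  using assms by (simp add: norm_vec_def norm_mult)

lemma sum_roots_of_unity:
  fixes N :: nat
  defines "\<omega> \<equiv> cis (2 * pi / real N)"
  assumes N: "N > 0"
  shows "(\<Sum>k<N. (\<omega> ^ k) ^ s * cnj (\<omega> ^ k) ^ t) = (if int N dvd int s - int t then of_nat N else 0)"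
proof -
  have \<omega>: "\<omega> = exp (2 * of_real pi * \<i> / of_nat N)"
    by (simp add: \<omega>_def cis_conv_exp mult_ac)
  have pow: "\<omega> ^ s = exp (2 * of_real pi * \<i> * of_nat s / of_nat N)" for s
    unfolding \<omega> by (simp add: exp_of_nat_mult[symmetric] mult_ac)
  have \<omega>N: "\<omega> ^ N = 1" using N by (simp add: pow)
  have cnj: "\<omega> * cnj \<omega> = 1" by (simp add: \<omega>_def cis_cnj cis_mult)
  define \<eta> where "\<eta> = \<omega> ^ s * cnj \<omega> ^ t"
  have inv: "cnj \<omega> ^ t * \<omega> ^ t = 1" using cnj by (simp add: mult.commute flip: power_mult_distrib)
  have "\<eta> = 1 \<longleftrightarrow> \<omega> ^ s = \<omega> ^ t"
  proof
    assume "\<eta> = 1"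
    then have "\<omega> ^ s * (cnj \<omega> ^ t * \<omega> ^ t) = \<omega> ^ t" by (simp add: \<eta>_def flip: mult.assoc)
    then show "\<omega> ^ s = \<omega> ^ t" by (simp only: inv mult_1_right)
  next
    assume "\<omega> ^ s = \<omega> ^ t"
    then show "\<eta> = 1" using inv by (simp add: \<eta>_def mult.commute)
  qed
  also have "\<dots> \<longleftrightarrow> s mod N = t mod N"
    unfolding pow using N by (intro complex_root_unity_eq) simp
  also have "\<dots> \<longleftrightarrow> int N dvd int s - int t"
    by (metis mod_eq_dvd_iff of_nat_eq_iff of_nat_mod)
  finally have eq1: "\<eta> = 1 \<longleftrightarrow> int N dvd int s - int t" .
  have "\<eta> ^ N = (\<omega> ^ N) ^ s * cnj (\<omega> ^ N) ^ t"
    by (simp add: \<eta>_def power_mult_distrib power_mult[symmetric] mult.commute)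
  then have \<eta>N: "\<eta> ^ N = 1" by (simp add: \<omega>N)
  have "(\<Sum>k<N. (\<omega> ^ k) ^ s * cnj (\<omega> ^ k) ^ t) = (\<Sum>k<N. \<eta> ^ k)"
    by (intro sum.cong refl) (simp add: \<eta>_def power_mult_distrib power_mult[symmetric] mult.commute)
  also have "\<dots> = (if \<eta> = 1 then of_nat N else 0)" by (simp add: sum_gp_strict \<eta>N)
  finally show ?thesis by (simp add: eq1)
qed

lemma root_of_unity:
  assumes "N > 0"
  shows "cis (2 * pi / real N) ^ N = 1" "cmod (cis (2 * pi / real N)) = 1"
  using assms by (simp_all add: Complex.DeMoivre)

text \<open>For each \<open>i\<close> the double sum factors as a root-of-unity sum times its
  conjugate, which is \<open>N^2\<close> or 0. It serves both to project onto one residue class and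
  to compute the form that is to be annihilated.\<close>

lemma weighted_residue_sum:
  fixes N :: nat and A :: "'i \<Rightarrow> complex"
  defines "\<omega> \<equiv> cis (2 * pi / real N)"
  assumes N: "N > 0"
  shows "(\<Sum>k<N. \<Sum>l<N. cnj (\<omega> ^ k) ^ t * (\<omega> ^ l) ^ t * (\<Sum>i\<in>I. (\<omega> ^ k * cnj (\<omega> ^ l)) ^ s i * A i)) =
     (of_nat N)\<^sup>2 * (\<Sum>i\<in>I. if int N dvd int (s i) - int t then A i else 0)"
proof -
  let ?E = "\<lambda>i. (\<Sum>k<N. (\<omega> ^ k) ^ s i * cnj (\<omega> ^ k) ^ t)"
  have "(\<Sum>k<N. \<Sum>l<N. cnj (\<omega> ^ k) ^ t * (\<omega> ^ l) ^ t * (\<Sum>i\<in>I. (\<omega> ^ k * cnj (\<omega> ^ l)) ^ s i * A i)) =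
    (\<Sum>k<N. \<Sum>l<N. \<Sum>i\<in>I. ((\<omega> ^ k) ^ s i * cnj (\<omega> ^ k) ^ t) * cnj ((\<omega> ^ l) ^ s i * cnj (\<omega> ^ l) ^ t) * A i)"
    by (simp add: sum_distrib_left power_mult_distrib mult_ac)
  also have "\<dots> = (\<Sum>k<N. \<Sum>i\<in>I. \<Sum>l<N. ((\<omega> ^ k) ^ s i * cnj (\<omega> ^ k) ^ t) * cnj ((\<omega> ^ l) ^ s i * cnj (\<omega> ^ l) ^ t) * A i)"
    by (intro sum.cong refl sum.swap)
  also have "\<dots> = (\<Sum>i\<in>I. \<Sum>k<N. \<Sum>l<N. ((\<omega> ^ k) ^ s i * cnj (\<omega> ^ k) ^ t) * cnj ((\<omega> ^ l) ^ s i * cnj (\<omega> ^ l) ^ t) * A i)"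
    by (rule sum.swap)
  also have "\<dots> = (\<Sum>i\<in>I. ?E i * cnj (?E i) * A i)"
    unfolding cnj_sum unfolding sum_product unfolding sum_distrib_right ..
  also have "\<dots> = (\<Sum>i\<in>I. (of_nat N)\<^sup>2 * (if int N dvd int (s i) - int t then A i else 0))"
    unfolding \<omega>_def sum_roots_of_unity[OF N] by (intro sum.cong refl) (auto simp: power2_eq_square)
  finally show ?thesis by (simp add: sum_distrib_left)
qed

section \<open>Positive semidefiniteness of the residue parts\<close>

context disk_series
begin

text \<open>Apply \<open>f\<close> to all rotated points \<open>\<omega>^k x_i\<close> with
  coefficients \<open>c_i\<close> times the conjugate of \<open>\<omega>^(k \<rho>)\<close>: the
  resulting nonnegative form is \<open>N^2\<close> times the form of the part.\<close>

lemma psd_part_residues: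
  fixes x :: "'i \<Rightarrow> complex ^ 'q"
  assumes pd: "positive_definite (isotropic_kernel f :: complex ^ 'q \<Rightarrow> complex ^ 'q \<Rightarrow> complex)"
    and J: "finite J" "x ` J \<subseteq> sphere 0 1" and N: "N > 0" "\<rho> < N"
  shows "psd J (\<lambda>i j. part (residues N (int \<rho>)) (hermitian_inner (x i) (x j)))"
  unfolding psd_def
proof
  fix c
  define \<omega> where "\<omega> = cis (2 * pi / real N)"
  note \<omega> = root_of_unity[OF N(1), folded \<omega>_def]
  define h where "h = (\<lambda>(i, k). \<omega> ^ k *s x i)"
  let ?P = "\<lambda>i j. part (residues N (int \<rho>)) (hermitian_inner (x i) (x j))"
  have nx: "norm (x i) = 1" if "i \<in> J" for i using J(2) that by auto
  have hsph: "h ` (J \<times> {..<N}) \<subseteq> sphere 0 1"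
    using nx by (auto simp: h_def norm_unimodular_scale norm_power \<omega>(2))
  have inner: "(\<Sum>k<N. \<Sum>l<N. cnj (\<omega> ^ k) ^ \<rho> * (\<omega> ^ l) ^ \<rho> * f (\<omega> ^ k * cnj (\<omega> ^ l) * hermitian_inner (x i) (x j))) =
     (of_nat N)\<^sup>2 * ?P i j" if ij: "i \<in> J" "j \<in> J" for i j
  proof -
    let ?z = "hermitian_inner (x i) (x j)"
    have "f (\<omega> ^ k * cnj (\<omega> ^ l) * ?z) =
        (\<Sum>r<N. (\<omega> ^ k * cnj (\<omega> ^ l)) ^ r * part (residues N (int r)) ?z)" for k l
    proof (rule residue_expansion[OF N(1)])
      have "(\<omega> ^ k * cnj (\<omega> ^ l)) ^ N = (\<omega> ^ N) ^ k * cnj (\<omega> ^ N) ^ l"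
        by (simp add: power_mult_distrib power_mult[symmetric] mult.commute)
      then show "(\<omega> ^ k * cnj (\<omega> ^ l)) ^ N = 1" by (simp add: \<omega>(1))
      show "cmod (\<omega> ^ k * cnj (\<omega> ^ l)) = 1" by (simp add: norm_mult norm_power \<omega>(2))
      show "cmod ?z \<le> 1" using ij nx by (intro norm_hermitian_inner_le_1)
    qed
    then have "(\<Sum>k<N. \<Sum>l<N. cnj (\<omega> ^ k) ^ \<rho> * (\<omega> ^ l) ^ \<rho> * f (\<omega> ^ k * cnj (\<omega> ^ l) * ?z)) =
       (of_nat N)\<^sup>2 * (\<Sum>r<N. if int N dvd int r - int \<rho> then part (residues N (int r)) ?z else 0)"
      unfolding \<omega>_def using weighted_residue_sum[OF N(1), where s = "\<lambda>r. r"] by simp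
    also have "(\<Sum>r<N. if int N dvd int r - int \<rho> then part (residues N (int r)) ?z else 0) =
       (\<Sum>r<N. if r = \<rho> then part (residues N (int r)) ?z else 0)"
      using N by (intro sum.cong refl) (auto simp flip: mod_eq_dvd_iff)
    also have "\<dots> = ?P i j" using N(2) by simp
    finally show ?thesis .
  qed
  have "psd (J \<times> {..<N}) (\<lambda>p q. isotropic_kernel f (h p) (h q))"
    using J(1) by (intro positive_definite_psd[OF pd _ hsph]) simp
  then have "0 \<le> quad_form (J \<times> {..<N}) (\<lambda>p q. isotropic_kernel f (h p) (h q)) (\<lambda>(i, k). c i * cnj (\<omega> ^ k) ^ \<rho>)"
    unfolding psd_def by blast
  also have "\<dots> = (\<Sum>i\<in>J. \<Sum>k<N. \<Sum>j\<in>J. \<Sum>l<N. c i * cnj (c j) *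
      (cnj (\<omega> ^ k) ^ \<rho> * (\<omega> ^ l) ^ \<rho> * f (\<omega> ^ k * cnj (\<omega> ^ l) * hermitian_inner (x i) (x j))))"
    unfolding quad_form_def sum.cartesian_product' by (simp add: h_def isotropic_kernel_def hermitian_inner_scale mult_ac)
  also have "\<dots> = (\<Sum>i\<in>J. \<Sum>j\<in>J. \<Sum>k<N. \<Sum>l<N. c i * cnj (c j) *
      (cnj (\<omega> ^ k) ^ \<rho> * (\<omega> ^ l) ^ \<rho> * f (\<omega> ^ k * cnj (\<omega> ^ l) * hermitian_inner (x i) (x j))))"
    by (intro sum.cong refl sum.swap)
  also have "\<dots> = (\<Sum>i\<in>J. \<Sum>j\<in>J. c i * cnj (c j) * ((of_nat N)\<^sup>2 * ?P i j))"
    by (intro sum.cong refl) (simp only: sum_distrib_left[symmetric] inner)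
  also have "\<dots> = of_real ((real N)\<^sup>2) * quad_form J ?P c"
    by (simp add: quad_form_def sum_distrib_left mult_ac)
  finally show "0 \<le> quad_form J ?P c" using N(1) by (simp add: less_eq_complex_def zero_le_mult_iff)
qed

text \<open>The difference is the sum of the finitely many other residue parts.\<close>

lemma psd_minus_part_residues:
  fixes x :: "'i \<Rightarrow> complex ^ 'q"
  assumes pd: "positive_definite (isotropic_kernel f :: complex ^ 'q \<Rightarrow> complex ^ 'q \<Rightarrow> complex)"
    and J: "finite J" "x ` J \<subseteq> sphere 0 1" and N: "N > 0" "\<rho> < N"
  shows "psd J (\<lambda>i j. f (hermitian_inner (x i) (x j)) - part (residues N (int \<rho>)) (hermitian_inner (x i) (x j)))"
proof -
  have nx: "norm (x i) = 1" if "i \<in> J" for i using J(2) that by auto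
  have "psd J (\<lambda>i j. \<Sum>r\<in>{..<N} - {\<rho>}. part (residues N (int r)) (hermitian_inner (x i) (x j)))"
    using psd_part_residues[OF pd J N(1)] by (intro psd_sum) auto
  also have "?this \<longleftrightarrow> ?thesis"
  proof (rule psd_cong)
    fix i j assume "i \<in> J" "j \<in> J"
    then have z: "cmod (hermitian_inner (x i) (x j)) \<le> 1" using nx by (intro norm_hermitian_inner_le_1)
    have "f (hermitian_inner (x i) (x j)) = (\<Sum>r<N. part (residues N (int r)) (hermitian_inner (x i) (x j)))"
      using residue_expansion[OF N(1), of 1] z by simp
    also have "\<dots> = part (residues N (int \<rho>)) (hermitian_inner (x i) (x j))
        + (\<Sum>r\<in>{..<N} - {\<rho>}. part (residues N (int r)) (hermitian_inner (x i) (x j)))"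
      using N(2) by (intro sum.remove) auto
    finally show "(\<Sum>r\<in>{..<N} - {\<rho>}. part (residues N (int r)) (hermitian_inner (x i) (x j))) =
      f (hermitian_inner (x i) (x j)) - part (residues N (int \<rho>)) (hermitian_inner (x i) (x j))"
      by simp
  qed
  finally show ?thesis .
qed

end

text \<open>The diagonal contributes \<open>\<mu> * s\<close>, with \<open>s\<close> the sum of the
  squared moduli of \<open>u\<close>. By Cauchy-Schwarz the rest has modulus at most
  \<open>e * \<mu> * card Y * s\<close>, which is smaller unless \<open>s = 0\<close>.\<close>

lemma almost_diagonal_form_pos:
  fixes A :: "'i \<Rightarrow> 'i \<Rightarrow> complex"
  assumes Y: "finite Y" and \<mu>: "\<mu> > 0" and diag: "\<And>p. p \<in> Y \<Longrightarrow> A p p = of_real \<mu>"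
    and off: "\<And>p q. p \<in> Y \<Longrightarrow> q \<in> Y \<Longrightarrow> p \<noteq> q \<Longrightarrow> cmod (A p q) \<le> e * \<mu>"
    and e: "0 \<le> e" "e * real (card Y) < 1" and zero: "quad_form Y A u = 0" and p: "p \<in> Y"
  shows "u p = 0"
proof -
  define s where "s = (\<Sum>p\<in>Y. (cmod (u p))\<^sup>2)"
  have "quad_form Y A u = (\<Sum>p\<in>Y. u p * cnj (u p) * A p p + (\<Sum>q\<in>Y - {p}. u p * cnj (u q) * A p q))"
    unfolding quad_form_def using Y by (intro sum.cong refl sum.remove)
  also have "\<dots> = (\<Sum>p\<in>Y. u p * cnj (u p) * A p p) + (\<Sum>p\<in>Y. \<Sum>q\<in>Y - {p}. u p * cnj (u q) * A p q)"
    by (rule sum.distrib)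
  also have "(\<Sum>p\<in>Y. u p * cnj (u p) * A p p) = of_real (\<mu> * s)"
    by (simp add: s_def diag sum_distrib_left complex_norm_square[symmetric] mult.commute)
  finally have "of_real (\<mu> * s) + (\<Sum>p\<in>Y. \<Sum>q\<in>Y - {p}. u p * cnj (u q) * A p q) = 0"
    unfolding zero by (rule sym)
  then have "complex_of_real (\<mu> * s) = - (\<Sum>p\<in>Y. \<Sum>q\<in>Y - {p}. u p * cnj (u q) * A p q)"
    by (rule eq_neg_iff_add_eq_0[THEN iffD2])
  from arg_cong[OF this, of cmod] have "\<bar>\<mu> * s\<bar> = cmod (\<Sum>p\<in>Y. \<Sum>q\<in>Y - {p}. u p * cnj (u q) * A p q)"
    unfolding norm_minus_cancel norm_of_real .
  moreover have "s \<ge> 0" by (simp add: s_def sum_nonneg)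
  ultimately have "\<mu> * s = cmod (\<Sum>p\<in>Y. \<Sum>q\<in>Y - {p}. u p * cnj (u q) * A p q)" using \<mu> by simp
  also have "\<dots> \<le> (\<Sum>p\<in>Y. \<Sum>q\<in>Y - {p}. cmod (u p) * cmod (u q) * (e * \<mu>))"
    using off by (intro sum_norm_le) (auto simp: norm_mult intro!: mult_left_mono)
  also have "\<dots> \<le> (\<Sum>p\<in>Y. \<Sum>q\<in>Y. cmod (u p) * cmod (u q) * (e * \<mu>))"
    using Y e \<mu> by (intro sum_mono sum_mono2) auto
  also have "\<dots> = (\<Sum>p\<in>Y. cmod (u p))\<^sup>2 * (e * \<mu>)"
    unfolding power2_eq_square sum_product unfolding sum_distrib_right ..
  also have "\<dots> \<le> (s * real (card Y)) * (e * \<mu>)"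
    unfolding s_def using e \<mu> by (intro mult_right_mono sum_squared_le_sum_of_squares) auto
  finally have "\<mu> * (s * (1 - e * real (card Y))) \<le> 0" by (simp add: algebra_simps)
  then have "s * (1 - e * real (card Y)) \<le> 0" using \<mu> by (simp add: mult_le_0_iff)
  with e(2) have "s \<le> 0" by (simp add: mult_le_0_iff)
  moreover have "(cmod (u p))\<^sup>2 \<le> s"
    unfolding s_def using Y p by (intro member_le_sum) auto
  ultimately have "(cmod (u p))\<^sup>2 \<le> 0" by linarith
  then show ?thesis by simp
qed

section \<open>Products of two series\<close>

text \<open>For residue parts \<open>A\<close> and \<open>B\<close>, the identity
  \<open>f g - A B = (f - A) g + A (g - B)\<close> writes the difference as a sum of Schur products
  of positive semidefinite forms. Thus the form of \<open>A B\<close> lies between 0 and that of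
  \<open>f g\<close>, which is 0; letting \<open>N\<close> grow passes to single degrees.\<close>

lemma quad_form_product_parts_zero:
  fixes x :: "'i \<Rightarrow> complex ^ 'q"
  assumes F: "disk_series \<alpha> a f" and G: "disk_series \<alpha> b g"
    and pdf: "positive_definite (isotropic_kernel f :: complex ^ 'q \<Rightarrow> complex ^ 'q \<Rightarrow> complex)"
    and pdg: "positive_definite (isotropic_kernel g :: complex ^ 'q \<Rightarrow> complex ^ 'q \<Rightarrow> complex)"
    and J: "finite J" "x ` J \<subseteq> sphere 0 1"
    and zero: "quad_form J (\<lambda>i j. f (hermitian_inner (x i) (x j)) * g (hermitian_inner (x i) (x j))) c = 0"
  shows "quad_form J (\<lambda>i j. disk_series.part \<alpha> a {d} (hermitian_inner (x i) (x j)) *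
                           disk_series.part \<alpha> b {d'} (hermitian_inner (x i) (x j))) c = 0"
proof -
  interpret F: disk_series \<alpha> a f by (rule F)
  interpret G: disk_series \<alpha> b g by (rule G)
  let ?z = "\<lambda>i j. hermitian_inner (x i) (x j)"
  have z: "cmod (?z i j) \<le> 1" if "i \<in> J" "j \<in> J" for i j
    using J(2) that by (intro norm_hermitian_inner_le_1) auto
  have "quad_form J (\<lambda>i j. F.part (residues N d) (?z i j) * G.part (residues N d') (?z i j)) c = 0"
    if N: "N > 0" for N
  proof -
    define \<rho> \<rho>' where "\<rho> = nat (d mod int N)" "\<rho>' = nat (d' mod int N)"
    have \<rho>: "\<rho> < N" "\<rho>' < N" "residues N d = residues N (int \<rho>)" "residues N d' = residues N (int \<rho>')"
      using N by (simp_all add: \<rho>_\<rho>'_def nat_less_iff residues_mod)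
    let ?A = "\<lambda>i j. F.part (residues N (int \<rho>)) (?z i j)" and ?B = "\<lambda>i j. G.part (residues N (int \<rho>')) (?z i j)"
    let ?f = "\<lambda>i j. f (?z i j)" and ?g = "\<lambda>i j. g (?z i j)"
    have g: "psd J ?g"
      using positive_definite_psd[OF pdg J] by (simp add: isotropic_kernel_def)
    note A = F.psd_part_residues[OF pdf J N \<rho>(1)] F.psd_minus_part_residues[OF pdf J N \<rho>(1)]
    note B = G.psd_part_residues[OF pdg J N \<rho>(2)] G.psd_minus_part_residues[OF pdg J N \<rho>(2)]
    have "psd J (\<lambda>i j. (?f i j - ?A i j) * ?g i j + ?A i j * (?g i j - ?B i j))"
      by (rule psd_add[OF psd_schur_product[OF J(1) A(2) g] psd_schur_product[OF J(1) A(1) B(2)]])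
    then have nonneg: "0 \<le> quad_form J (\<lambda>i j. (?f i j - ?A i j) * ?g i j + ?A i j * (?g i j - ?B i j)) c"
      unfolding psd_def by (rule spec)
    have "0 = quad_form J (\<lambda>i j. ?f i j * ?g i j) c" by (rule zero[symmetric])
    also have "\<dots> = quad_form J (\<lambda>i j. ((?f i j - ?A i j) * ?g i j + ?A i j * (?g i j - ?B i j)) + ?A i j * ?B i j) c"
      by (rule quad_form_cong) (simp add: algebra_simps)
    also have "\<dots> = quad_form J (\<lambda>i j. (?f i j - ?A i j) * ?g i j + ?A i j * (?g i j - ?B i j)) c
        + quad_form J (\<lambda>i j. ?A i j * ?B i j) c"
      by (rule quad_form_add)
    also have "\<dots> \<ge> 0 + quad_form J (\<lambda>i j. ?A i j * ?B i j) c"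
      by (intro add_right_mono nonneg)
    finally have "quad_form J (\<lambda>i j. ?A i j * ?B i j) c \<le> 0" by simp
    moreover have "0 \<le> quad_form J (\<lambda>i j. ?A i j * ?B i j) c"
      using psd_schur_product[OF J(1) A(1) B(1)] unfolding psd_def by (rule spec)
    ultimately show ?thesis unfolding \<rho> by (rule antisym)
  qed
  then have "(\<lambda>N. quad_form J (\<lambda>i j. F.part (residues N d) (?z i j) * G.part (residues N d') (?z i j)) c) \<longlonglongrightarrow> 0"
    by (intro tendsto_eventually) (auto simp: eventually_sequentially intro!: exI[of _ 1])
  moreover have "(\<lambda>N. quad_form J (\<lambda>i j. F.part (residues N d) (?z i j) * G.part (residues N d') (?z i j)) c)
      \<longlonglongrightarrow> quad_form J (\<lambda>i j. F.part {d} (?z i j) * G.part {d'} (?z i j)) c"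
    unfolding quad_form_def
    by (intro tendsto_sum tendsto_mult tendsto_const F.part_residues_tendsto G.part_residues_tendsto z)
  ultimately show ?thesis using LIMSEQ_unique by blast
qed

text \<open>If \<open>d + d'\<close> is large, then \<open>d\<close> or \<open>d'\<close> is. One
  factor is then small relative to its mass, and the other is at most its mass.\<close>

lemma product_parts_decay:
  assumes F: "disk_series \<alpha> a f" and G: "disk_series \<alpha> b g"
    and Z: "finite Z" "\<And>z. z \<in> Z \<Longrightarrow> cmod z < 1" and e: "e > 0"
  shows "\<exists>D::nat. \<forall>z\<in>Z. \<forall>d d'. \<bar>d + d'\<bar> \<ge> int D \<longrightarrow>
    cmod (disk_series.part \<alpha> a {d} z * disk_series.part \<alpha> b {d'} z)
      \<le> e * (disk_series.mass a {d} * disk_series.mass b {d'})"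
  using Z
proof (induction Z rule: finite_induct)
  case (insert z Z)
  interpret F: disk_series \<alpha> a f by (rule F)
  interpret G: disk_series \<alpha> b g by (rule G)
  obtain D where D: "\<forall>z\<in>Z. \<forall>d d'. \<bar>d + d'\<bar> \<ge> int D \<longrightarrow>
      cmod (F.part {d} z * G.part {d'} z) \<le> e * (F.mass {d} * G.mass {d'})"
    using insert.IH insert.prems by blast
  have z: "cmod z < 1" "cmod z \<le> 1" using insert.prems[of z] by auto
  obtain D1 where D1: "\<And>d. \<bar>d\<bar> \<ge> int D1 \<Longrightarrow> cmod (F.part {d} z) \<le> e * F.mass {d}"
    using F.part_decay[OF z(1) e] by blast
  obtain D2 where D2: "\<And>d. \<bar>d\<bar> \<ge> int D2 \<Longrightarrow> cmod (G.part {d} z) \<le> e * G.mass {d}"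
    using G.part_decay[OF z(1) e] by blast
  have "cmod (F.part {d} z * G.part {d'} z) \<le> e * (F.mass {d} * G.mass {d'})"
    if "\<bar>d + d'\<bar> \<ge> int (D1 + D2)" for d d'
  proof -
    have "\<bar>d\<bar> \<ge> int D1 \<or> \<bar>d'\<bar> \<ge> int D2" using that by linarith
    then show ?thesis
    proof (elim disjE)
      assume 1: "\<bar>d\<bar> \<ge> int D1"
      have "cmod (F.part {d} z) * cmod (G.part {d'} z) \<le> (e * F.mass {d}) * G.mass {d'}"
        using D1[OF 1] G.norm_part_le[OF z(2)] e F.mass_nonneg by (intro mult_mono) auto
      then show ?thesis by (simp add: norm_mult mult_ac)
    next
      assume 2: "\<bar>d'\<bar> \<ge> int D2"
      have "cmod (F.part {d} z) * cmod (G.part {d'} z) \<le> F.mass {d} * (e * G.mass {d'})"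
        using D2[OF 2] F.norm_part_le[OF z(2)] F.mass_nonneg by (intro mult_mono) auto
      then show ?thesis by (simp add: norm_mult mult_ac)
    qed
  qed
  with D show ?case by (intro exI[of _ "D + D1 + D2"]) auto
qed auto

text \<open>
  Points that differ by a unimodular factor are merged into one class. The parts of degree \<open>d\<close> and
  \<open>d'\<close> of \<open>f\<close> and \<open>g\<close> see a class only through the exponential sum below, and for large
  \<open>d + d'\<close> their product is nearly diagonal on representatives of the classes.
\<close>

lemma class_sums_vanish:
  fixes x :: "'i \<Rightarrow> complex ^ 'q"
  assumes F: "disk_series \<alpha> a f" and G: "disk_series \<alpha> b g"
    and pdf: "positive_definite (isotropic_kernel f :: complex ^ 'q \<Rightarrow> complex ^ 'q \<Rightarrow> complex)"
    and pdg: "positive_definite (isotropic_kernel g :: complex ^ 'q \<Rightarrow> complex ^ 'q \<Rightarrow> complex)"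
    and J: "finite J" "x ` J \<subseteq> sphere 0 1"
    and zero: "quad_form J (\<lambda>i j. f (hermitian_inner (x i) (x j)) * g (hermitian_inner (x i) (x j))) c = 0"
  shows "\<exists>(r :: 'i \<Rightarrow> 'i) \<zeta> (D :: nat). (\<forall>i\<in>J. cmod (\<zeta> i) = 1 \<and> x i = \<zeta> i *s x (r i)) \<and>
    (\<forall>m n m' n'. a m n > 0 \<longrightarrow> b m' n' > 0 \<longrightarrow> \<bar>(int m - int n) + (int m' - int n')\<bar> \<ge> int D \<longrightarrow>
       (\<forall>p\<in>r ` J. (\<Sum>i\<in>{i\<in>J. r i = p}. c i * \<zeta> i powi ((int m - int n) + (int m' - int n'))) = 0))"
proof -
  interpret F: disk_series \<alpha> a f by (rule F)
  interpret G: disk_series \<alpha> b g by (rule G)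
  let ?z = "\<lambda>i j. hermitian_inner (x i) (x j)"
  have nx: "norm (x i) = 1" if "i \<in> J" for i using J(2) that by auto
  define rel where "rel = (\<lambda>i j. \<exists>\<zeta>. cmod \<zeta> = 1 \<and> x i = \<zeta> *s x j)"
  have rel_refl: "rel i i" for i unfolding rel_def by (rule exI[of _ 1]) simp
  have rel_sym: "rel j i" if "rel i j" for i j
  proof -
    from that obtain \<zeta> where \<zeta>: "cmod \<zeta> = 1" "x i = \<zeta> *s x j" by (auto simp: rel_def)
    then have "\<zeta> \<noteq> 0" by auto
    then have "x j = inverse \<zeta> *s x i" using \<zeta> by simp
    then show ?thesis using \<zeta> unfolding rel_def by (intro exI[of _ "inverse \<zeta>"]) (simp add: norm_inverse)
  qed
  have rel_trans: "rel i k" if ij: "rel i j" and jk: "rel j k" for i j k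
  proof -
    obtain \<zeta> \<zeta>' where "cmod \<zeta> = 1" "x i = \<zeta> *s x j" "cmod \<zeta>' = 1" "x j = \<zeta>' *s x k"
      using ij jk unfolding rel_def by blast
    then show ?thesis unfolding rel_def
      by (intro exI[of _ "\<zeta> * \<zeta>'"]) (simp add: norm_mult)
  qed
  define r where "r = (\<lambda>i. SOME j. j \<in> J \<and> rel i j)"
  have r: "r i \<in> J" "rel i (r i)" if "i \<in> J" for i
    using someI[of "\<lambda>j. j \<in> J \<and> rel i j" i] that rel_refl by (auto simp: r_def)
  \<comment> \<open>Related indices satisfy the very same predicate, so the choice operator returns
    one representative for the whole class.\<close>
  have r_eq: "r i = r j" if "rel i j" for i j
  proof -
    have "rel i = rel j" using that rel_sym rel_trans by blast
    then show ?thesis by (simp add: r_def)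
  qed
  define \<zeta> where "\<zeta> = (\<lambda>i. SOME \<zeta>. cmod \<zeta> = 1 \<and> x i = \<zeta> *s x (r i))"
  have \<zeta>: "cmod (\<zeta> i) = 1 \<and> x i = \<zeta> i *s x (r i)" if "i \<in> J" for i
    unfolding \<zeta>_def by (rule someI_ex) (use r(2)[OF that] in \<open>simp add: rel_def\<close>)
  define Y where "Y = r ` J"
  have Y: "finite Y" "Y \<subseteq> J" using J(1) r by (auto simp: Y_def)
  have z1: "cmod (?z p q) \<le> 1" if "p \<in> J" "q \<in> J" for p q
    using that nx by (intro norm_hermitian_inner_le_1)
  have sep: "cmod (?z p q) < 1" if pq: "p \<in> Y" "q \<in> Y" "p \<noteq> q" for p q
  proof (rule ccontr)
    assume "\<not> cmod (?z p q) < 1"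
    then have "cmod (?z p q) = 1" using pq Y z1[of p q] by auto
    moreover from this have "x p = ?z p q *s x q" using pq Y nx by (intro norm_hermitian_inner_eq_1) auto
    ultimately have "rel p q" unfolding rel_def by blast
    moreover obtain i j where "i \<in> J" "j \<in> J" "p = r i" "q = r j" using pq(1,2) unfolding Y_def by blast
    ultimately have "rel i j" using r rel_sym rel_trans by metis
    then show False using r_eq \<open>p = r i\<close> \<open>q = r j\<close> pq(3) by simp
  qed
  \<comment> \<open>Small enough for \<open>almost_diagonal_form_pos\<close> on
    \<open>card Y\<close> representatives, and positive even if \<open>Y\<close> is empty.\<close>
  define e where "e = 1 / (real (card Y) + 1)"
  have e: "e > 0" "e * real (card Y) < 1" by (simp_all add: e_def divide_less_eq)
  define Z where "Z = (\<lambda>(p, q). ?z p q) ` {(p, q). p \<in> Y \<and> q \<in> Y \<and> p \<noteq> q}"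
  have "finite {(p, q). p \<in> Y \<and> q \<in> Y \<and> p \<noteq> q}"
    by (rule finite_subset[of _ "Y \<times> Y"]) (use Y in auto)
  then have Z: "finite Z" "\<And>z. z \<in> Z \<Longrightarrow> cmod z < 1" using sep by (auto simp: Z_def)
  obtain D where D: "\<And>z d d'. z \<in> Z \<Longrightarrow> \<bar>d + d'\<bar> \<ge> int D \<Longrightarrow>
      cmod (F.part {d} z * G.part {d'} z) \<le> e * (F.mass {d} * G.mass {d'})"
    using product_parts_decay[OF F G Z e(1)] by blast
  show ?thesis
  proof (intro exI[of _ r] exI[of _ \<zeta>] exI[of _ D] conjI ballI allI impI)
    fix m n m' n' p
    assume ab: "a m n > 0" "b m' n' > 0" and large: "\<bar>(int m - int n) + (int m' - int n')\<bar> \<ge> int D"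
      and p: "p \<in> r ` J"
    define d d' where "d = int m - int n" "d' = int m' - int n'"
    define P where "P = (\<lambda>z. F.part {d} z * G.part {d'} z)"
    define v where "v = (\<lambda>i. \<zeta> i powi (d + d'))"
    have mass: "F.mass {d} > 0" "G.mass {d'} > 0"
      using ab unfolding F.mass_pos_iff G.mass_pos_iff d_d'_def by blast+
    have P: "P (?z i j) = v i * cnj (v j) * P (?z (r i) (r j))" if ij: "i \<in> J" "j \<in> J" for i j
    proof -
      have zij: "?z i j = \<zeta> i * (cnj (\<zeta> j) * ?z (r i) (r j))"
        using \<zeta>[OF ij(1)] \<zeta>[OF ij(2)] hermitian_inner_scale by (metis mult.assoc)
      have un: "cmod (\<zeta> i) = 1" "cmod (cnj (\<zeta> j)) = 1" "\<zeta> i \<noteq> 0" "\<zeta> j \<noteq> 0"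
        using \<zeta>[OF ij(1)] \<zeta>[OF ij(2)] by auto
      have le: "cmod (?z (r i) (r j)) \<le> 1" using ij r by (intro z1) auto
      then have le': "cmod (cnj (\<zeta> j) * ?z (r i) (r j)) \<le> 1" using un by (simp add: norm_mult)
      show ?thesis
        unfolding zij P_def F.part_mult_unimodular[OF un(1) le'] G.part_mult_unimodular[OF un(1) le']
          F.part_mult_unimodular[OF un(2) le] G.part_mult_unimodular[OF un(2) le]
        using un by (simp add: v_def power_int_add)
    qed
    have "quad_form J (\<lambda>i j. v i * cnj (v j) * P (?z (r i) (r j))) c = quad_form J (\<lambda>i j. P (?z i j)) c"
      by (intro quad_form_cong) (simp add: P)
    also have "\<dots> = 0" unfolding P_def by (rule quad_form_product_parts_zero[OF F G pdf pdg J zero])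
    finally have form: "quad_form Y (\<lambda>p q. P (?z p q)) (\<lambda>p. \<Sum>i\<in>{i\<in>J. r i = p}. c i * v i) = 0"
      unfolding quad_form_scale
      using quad_form_pullback[OF J(1) Y(1), of r "\<lambda>p q. P (?z p q)"] by (simp add: Y_def)
    have "(\<Sum>i\<in>{i\<in>J. r i = p}. c i * v i) = 0"
    proof (rule almost_diagonal_form_pos[OF Y(1) _ _ _ _ _ form])
      show "0 < F.mass {d} * G.mass {d'}" using mass by simp
      show "P (?z q q) = of_real (F.mass {d} * G.mass {d'})" if "q \<in> Y" for q
      proof -
        have "?z q q = 1" using nx that Y by (auto simp: hermitian_inner_self)
        then show ?thesis by (simp add: P_def F.part_1 G.part_1)
      qed
      show "cmod (P (?z p q)) \<le> e * (F.mass {d} * G.mass {d'})" if "p \<in> Y" "q \<in> Y" "p \<noteq> q" for p q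
        unfolding P_def using large that by (intro D) (auto simp: Z_def d_d'_def)
    qed (use e p in \<open>auto simp: Y_def\<close>)
    then show "(\<Sum>i\<in>{i\<in>J. r i = p}. c i * \<zeta> i powi ((int m - int n) + (int m' - int n'))) = 0"
      by (simp add: v_def d_d'_def)
  qed (use \<zeta> in auto)
qed

text \<open>The offset \<open>s\<close> is congruent to \<open>j\<close> modulo \<open>n\<close> and
  at least \<open>D\<close>, and the step \<open>N\<close> is a multiple of \<open>n\<close> that is
  at least \<open>s + D\<close>. Members with \<open>l \<ge> 0\<close> are then at least
  \<open>D\<close>, all others at most \<open>- D\<close>.\<close>

lemma far_sub_progression:
  fixes n j D :: nat
  assumes "n \<ge> 2"
  shows "\<exists>P\<in>full_arith_progressions. \<forall>e\<in>P. \<bar>e\<bar> \<ge> int D \<and> (\<exists>l. e = int n * l + int j)"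
proof -
  define s where "s = j + n * D"
  define N where "N = n * (s + D + 1)"
  have s: "s \<ge> D" using assms by (simp add: s_def add_increasing)
  have "1 * (s + D + 1) \<le> N" "n * 1 \<le> N"
    unfolding N_def using assms by (intro mult_le_mono1 mult_le_mono2; simp)+
  then have N: "N \<ge> s + D" "N \<ge> 2" using assms by simp_all
  show ?thesis
  proof (intro bexI ballI)
    show "range (\<lambda>l. int N * l + int s) \<in> full_arith_progressions"
      unfolding full_arith_progressions_def using N by blast
    fix e assume "e \<in> range (\<lambda>l. int N * l + int s)"
    then obtain l where l: "e = int N * l + int s" by auto
    have "\<bar>e\<bar> \<ge> int D"
    proof (cases "l \<ge> 0")
      case True
      then have "int N * l \<ge> 0" by simp
      then show ?thesis using s l by simp
    next
      case False
      then have "int N * l \<le> int N * (- 1)" by (intro mult_left_mono) auto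
      then show ?thesis using N l by simp
    qed
    moreover have "e = int n * (int (s + D + 1) * l + int D) + int j"
      unfolding l by (simp add: N_def s_def algebra_simps)
    ultimately show "\<bar>e\<bar> \<ge> int D \<and> (\<exists>l. e = int n * l + int j)" by blast
  qed
qed

text \<open>Sufficiency of the condition. Were \<open>c i0\<close> nonzero, the exponential sum over
  the circle of \<open>i0\<close> would have a zero-free progression; a thinned copy of it still
  contains an occurring degree sum, at which \<open>class_sums_vanish\<close> forces a zero.\<close>

lemma coefficients_zero_if_quad_form_zero:
  fixes x :: "'i \<Rightarrow> complex ^ 'q"
  assumes F: "disk_series \<alpha> a f" and G: "disk_series \<alpha> b g"
    and pdf: "positive_definite (isotropic_kernel f :: complex ^ 'q \<Rightarrow> complex ^ 'q \<Rightarrow> complex)"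
    and pdg: "positive_definite (isotropic_kernel g :: complex ^ 'q \<Rightarrow> complex ^ 'q \<Rightarrow> complex)"
    and prog: "\<And>P. P \<in> full_arith_progressions \<Longrightarrow>
      {(int m - int n) + (int m' - int n') | m n m' n'. a m n * b m' n' > 0} \<inter> P \<noteq> {}"
    and J: "finite J" "x ` J \<subseteq> sphere 0 1" "inj_on x J"
    and zero: "quad_form J (\<lambda>i j. f (hermitian_inner (x i) (x j)) * g (hermitian_inner (x i) (x j))) c = 0"
    and i0: "i0 \<in> J"
  shows "c i0 = 0"
proof (rule ccontr)
  assume c: "c i0 \<noteq> 0"
  interpret F: disk_series \<alpha> a f by (rule F)
  interpret G: disk_series \<alpha> b g by (rule G)
  obtain r :: "'i \<Rightarrow> 'i" and \<zeta> and D :: nat where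
    \<zeta>: "\<forall>i\<in>J. cmod (\<zeta> i) = 1 \<and> x i = \<zeta> i *s x (r i)" and
    vanish: "\<forall>m n m' n'. a m n > 0 \<longrightarrow> b m' n' > 0 \<longrightarrow> \<bar>(int m - int n) + (int m' - int n')\<bar> \<ge> int D \<longrightarrow>
       (\<forall>p\<in>r ` J. (\<Sum>i\<in>{i\<in>J. r i = p}. c i * \<zeta> i powi ((int m - int n) + (int m' - int n'))) = 0)"
    using class_sums_vanish[OF F G pdf pdg J(1,2) zero] by (elim exE conjE)
  define I where "I = {i\<in>J. r i = r i0}"
  have "finite I" using J(1) by (simp add: I_def)
  \<comment> \<open>All points of \<open>I\<close> are multiples of the same vector, so distinct
    points have distinct factors \<open>\<zeta> i\<close>. This keeps the bases of the exponential
    sum distinct.\<close>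
  moreover have "inj_on \<zeta> I"
  proof (rule inj_onI)
    fix i j assume "i \<in> I" "j \<in> I" "\<zeta> i = \<zeta> j"
    then show "i = j" using \<zeta> J(3) by (auto simp: I_def inj_on_def)
  qed
  moreover have "\<zeta> i \<noteq> 0" if "i \<in> I" for i using \<zeta> that by (force simp: I_def)
  moreover have "i0 \<in> I" using i0 by (simp add: I_def)
  ultimately obtain n j where n: "n \<ge> 2" and ne: "\<And>l. (\<Sum>i\<in>I. c i * \<zeta> i powi (int n * l + int j)) \<noteq> 0"
    using exponential_sum_nonzero_on_progression[of I \<zeta> i0 c] c by blast
  obtain P where P: "P \<in> full_arith_progressions" "\<And>e. e \<in> P \<Longrightarrow> \<bar>e\<bar> \<ge> int D"
    "\<And>e. e \<in> P \<Longrightarrow> \<exists>l. e = int n * l + int j"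
    using far_sub_progression[OF n, of D j] by blast
  from prog[OF P(1)] obtain k l k' l' where
    e: "a k l * b k' l' > 0" "(int k - int l) + (int k' - int l') \<in> P" by auto
  have "a k l > 0" "b k' l' > 0" using e(1) F.nonneg[of k l] G.nonneg[of k' l'] by (auto simp: zero_less_mult_iff)
  then have "(\<Sum>i\<in>I. c i * \<zeta> i powi ((int k - int l) + (int k' - int l'))) = 0"
    unfolding I_def using e(2) P(2) i0 by (intro vanish[rule_format]) auto
  moreover obtain l'' where "(int k - int l) + (int k' - int l') = int n * l'' + int j" using P(3)[OF e(2)] by blast
  ultimately show False using ne by metis
qed

text \<open>
  On the points \<open>\<omega>\<^sup>k x\<close> of one circle, with \<open>\<omega>\<close> a primitive \<open>N\<close>-th root of unity, only the residues
  modulo \<open>N\<close> of the degrees matter.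
\<close>

lemma quad_form_roots_of_unity_zero:
  fixes N j :: nat
  defines "\<omega> \<equiv> cis (2 * pi / real N)"
  assumes F: "disk_series \<alpha> a f" and G: "disk_series \<alpha> b g" and N: "N > 0"
    and disj: "{(int m - int n) + (int m' - int n') | m n m' n'. a m n * b m' n' > 0}
                \<inter> range (\<lambda>l. int N * l + int j) = {}"
  shows "quad_form {..<N} (\<lambda>k l. f (\<omega> ^ k * cnj (\<omega> ^ l)) * g (\<omega> ^ k * cnj (\<omega> ^ l))) (\<lambda>k. cnj (\<omega> ^ k) ^ j) = 0"
proof -
  interpret F: disk_series \<alpha> a f by (rule F)
  interpret G: disk_series \<alpha> b g by (rule G)
  note \<omega> = root_of_unity[OF N, folded \<omega>_def]
  let ?A = "\<lambda>r. F.part (residues N (int r)) 1" and ?B = "\<lambda>r. G.part (residues N (int r)) 1"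
  have *: "f (\<omega> ^ k * cnj (\<omega> ^ l)) * g (\<omega> ^ k * cnj (\<omega> ^ l)) =
     (\<Sum>i\<in>{..<N} \<times> {..<N}. (\<omega> ^ k * cnj (\<omega> ^ l)) ^ (fst i + snd i) * (?A (fst i) * ?B (snd i)))" for k l
  proof -
    have "(\<omega> ^ k * cnj (\<omega> ^ l)) ^ N = (\<omega> ^ N) ^ k * cnj (\<omega> ^ N) ^ l"
      by (simp add: power_mult_distrib power_mult[symmetric] mult.commute)
    then have 1: "(\<omega> ^ k * cnj (\<omega> ^ l)) ^ N = 1" by (simp add: \<omega>(1))
    have 2: "cmod (\<omega> ^ k * cnj (\<omega> ^ l)) = 1" by (simp add: norm_mult norm_power \<omega>(2))
    show ?thesis
      using F.residue_expansion[OF N 1 2, of 1] G.residue_expansion[OF N 1 2, of 1]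
      by (simp add: sum_product sum.cartesian_product case_prod_unfold power_add mult_ac)
  qed
  have "quad_form {..<N} (\<lambda>k l. f (\<omega> ^ k * cnj (\<omega> ^ l)) * g (\<omega> ^ k * cnj (\<omega> ^ l))) (\<lambda>k. cnj (\<omega> ^ k) ^ j) =
    (of_nat N)\<^sup>2 * (\<Sum>i\<in>{..<N} \<times> {..<N}. if int N dvd int (fst i + snd i) - int j then ?A (fst i) * ?B (snd i) else 0)"
    unfolding quad_form_def *
    using weighted_residue_sum[OF N, of j "\<lambda>i. fst i + snd i" "\<lambda>i. ?A (fst i) * ?B (snd i)" "{..<N} \<times> {..<N}"]
    by (simp add: \<omega>_def)
  also have "(\<Sum>i\<in>{..<N} \<times> {..<N}. if int N dvd int (fst i + snd i) - int j then ?A (fst i) * ?B (snd i) else 0) = 0"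
  proof (intro sum.neutral ballI)
    fix i
    show "(if int N dvd int (fst i + snd i) - int j then ?A (fst i) * ?B (snd i) else 0) = 0"
    proof (rule ccontr)
      assume ne: "\<not> ?thesis"
      then have dvd: "int N dvd int (fst i + snd i) - int j" by (auto split: if_splits)
      \<comment> \<open>A nonzero term means positive mass in both residue classes, hence occurring
        degrees congruent to \<open>fst i\<close> and \<open>snd i\<close>. Their sum would lie in
        the progression that was assumed to be missed.\<close>
      have "F.mass (residues N (int (fst i))) > 0" "G.mass (residues N (int (snd i))) > 0"
        using ne F.mass_nonneg[of "residues N (int (fst i))"] G.mass_nonneg[of "residues N (int (snd i))"]
        by (auto simp: F.part_1 G.part_1 order.strict_iff_order split: if_splits)
      then obtain m n m' n' where mn: "int N dvd int m - int n - int (fst i)" "a m n > 0"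
        "int N dvd int m' - int n' - int (snd i)" "b m' n' > 0"
        unfolding F.mass_pos_iff G.mass_pos_iff by (auto simp: residues_def)
      have "int N dvd (int m - int n - int (fst i)) + (int m' - int n' - int (snd i)) + (int (fst i + snd i) - int j)"
        by (intro dvd_add mn dvd)
      also have "\<dots> = (int m - int n) + (int m' - int n') - int j" by simp
      finally obtain l where "(int m - int n) + (int m' - int n') - int j = int N * l" by (elim dvdE)
      then have "(int m - int n) + (int m' - int n') = int N * l + int j" by simp
      then have "(int m - int n) + (int m' - int n') \<in> range (\<lambda>l. int N * l + int j)" by (rule image_eqI) simp
      moreover have "a m n * b m' n' > 0" using mn by simp
      ultimately show False using disj by blast
    qed
  qed
  finally show ?thesis by simp
qed

theorem theorem5p2:
  fixes f g :: "complex \<Rightarrow> complex" and a b :: "nat \<Rightarrow> nat \<Rightarrow> real"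
  assumes "CARD('q::finite) \<ge> 2"
    and "continuous_on (cball 0 1) f"
    and "continuous_on (cball 0 1) g"
    and "positive_definite (isotropic_kernel f :: complex ^ 'q \<Rightarrow> complex ^ 'q \<Rightarrow> complex)"
    and "positive_definite (isotropic_kernel g :: complex ^ 'q \<Rightarrow> complex ^ 'q \<Rightarrow> complex)"
    and "\<And>m n. a m n \<ge> 0"
    and "\<And>m n. b m n \<ge> 0"
    and "(\<lambda>(m, n). of_real (a m n) * disk_poly (CARD('q) - 2) m n 1) summable_on UNIV"
    and "(\<lambda>(m, n). of_real (b m n) * disk_poly (CARD('q) - 2) m n 1) summable_on UNIV"
    and "\<And>z. z \<in> cball 0 1 \<Longrightarrow>
           ((\<lambda>(m, n). of_real (a m n) * disk_poly (CARD('q) - 2) m n z) has_sum f z) UNIV"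
    and "\<And>z. z \<in> cball 0 1 \<Longrightarrow>
           ((\<lambda>(m, n). of_real (b m n) * disk_poly (CARD('q) - 2) m n z) has_sum g z) UNIV"
  shows "strictly_positive_definite
           (isotropic_kernel (\<lambda>z. f z * g z) :: complex ^ 'q \<Rightarrow> complex ^ 'q \<Rightarrow> complex) \<longleftrightarrow>
         (\<forall>P\<in>full_arith_progressions.
            {(int m - int n) + (int m' - int n') | m n m' n'. a m n * b m' n' > 0} \<inter> P \<noteq> {})"
    (is "strictly_positive_definite ?K \<longleftrightarrow> (\<forall>P\<in>_. ?S \<inter> P \<noteq> {})")
proof
  have F: "disk_series (CARD('q) - 2) a f" using assms(6,10) by unfold_locales
  have G: "disk_series (CARD('q) - 2) b g" using assms(7,11) by unfold_locales
  {
    assume spd: "strictly_positive_definite ?K"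
    show "\<forall>P\<in>full_arith_progressions. ?S \<inter> P \<noteq> {}"
    proof (intro ballI notI)
      fix P assume "P \<in> full_arith_progressions" and disj: "?S \<inter> P = {}"
      then obtain N j where N: "P = range (\<lambda>l. int N * l + int j)" "N \<ge> 2"
        unfolding full_arith_progressions_def by blast
      then have "N > 0" by simp
      define \<omega> where "\<omega> = cis (2 * pi / real N)"
      note \<omega> = root_of_unity[OF \<open>N > 0\<close>, folded \<omega>_def]
      \<comment> \<open>Any unit vector would do; \<open>undefined\<close> is just some coordinate,
        and that coordinate of \<open>x k\<close> reads off \<open>\<omega> ^ k\<close>.\<close>
      define x0 :: "complex ^ 'q" where "x0 = axis undefined 1"
      have x0: "hermitian_inner x0 x0 = 1"
        by (simp add: hermitian_inner_def x0_def axis_def if_distrib[of "\<lambda>t. t * _"] cong: if_cong)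
      then have "norm x0 = 1 \<or> norm x0 = - 1"
        unfolding hermitian_inner_self of_real_eq_1_iff power2_eq_1_iff .
      then have nx0: "norm x0 = 1" using norm_ge_zero[of x0] by linarith
      define x where "x = (\<lambda>k::nat. \<omega> ^ k *s x0)"
      have x: "x ` {..<N} \<subseteq> sphere 0 1" "inj_on x {..<N}"
      proof -
        show "x ` {..<N} \<subseteq> sphere 0 1"
          by (auto simp: x_def norm_unimodular_scale norm_power \<omega>(2) nx0)
        show "inj_on x {..<N}"
        proof (rule inj_onI)
          fix k l assume kl: "k \<in> {..<N}" "l \<in> {..<N}" "x k = x l"
          have "x i $ undefined = \<omega> ^ i" for i by (simp add: x_def x0_def axis_def)
          then have "\<omega> ^ k = \<omega> ^ l" using kl(3) by metis
          moreover have "\<omega> ^ i = exp (2 * of_real pi * \<i> * of_nat i / of_nat N)" for i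
            by (simp add: \<omega>_def cis_conv_exp exp_of_nat_mult[symmetric] mult_ac)
          ultimately have "k mod N = l mod N"
            using complex_root_unity_eq[of N k l] \<open>N > 0\<close> by simp
          then show "k = l" using kl by simp
        qed
      qed
      have nz: "\<exists>k<N. cnj (\<omega> ^ k) ^ j \<noteq> 0" using \<open>N > 0\<close> by (intro exI[of _ 0]) auto
      have "0 < quad_form {..<N} (\<lambda>k l. ?K (x k) (x l)) (\<lambda>k. cnj (\<omega> ^ k) ^ j)"
        unfolding quad_form_def
        using spd[unfolded strictly_positive_definite_def, THEN conjunct2, rule_format, OF _ x nz] \<open>N > 0\<close> by simp
      also have "(\<lambda>k l. ?K (x k) (x l)) = (\<lambda>k l. f (\<omega> ^ k * cnj (\<omega> ^ l)) * g (\<omega> ^ k * cnj (\<omega> ^ l)))"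
        by (simp add: isotropic_kernel_def x_def hermitian_inner_scale x0)
      also have "quad_form {..<N} (\<lambda>k l. f (\<omega> ^ k * cnj (\<omega> ^ l)) * g (\<omega> ^ k * cnj (\<omega> ^ l))) (\<lambda>k. cnj (\<omega> ^ k) ^ j) = 0"
        unfolding \<omega>_def using disj by (intro quad_form_roots_of_unity_zero[OF F G \<open>N > 0\<close>]) (simp add: N(1))
      finally show False by simp
    qed
  next
    assume prog: "\<forall>P\<in>full_arith_progressions. ?S \<inter> P \<noteq> {}"
    let ?A = "\<lambda>x i j. f (hermitian_inner (x i) (x j)) * g (hermitian_inner (x i) (x j))"
    have pd: "0 \<le> quad_form {..<n} (?A x) c" if "x ` {..<n} \<subseteq> sphere 0 1"
      for n and x :: "nat \<Rightarrow> complex ^ 'q" and c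
      using psd_schur_product[OF _ positive_definite_psd[OF assms(4) _ that] positive_definite_psd[OF assms(5) _ that]]
      by (simp add: isotropic_kernel_def psd_def)
    have nonneg: "0 \<le> (\<Sum>i<n. \<Sum>j<n. c i * cnj (c j) * ?K (x i) (x j))"
      if "x ` {..<n} \<subseteq> sphere 0 1" for n and x :: "nat \<Rightarrow> complex ^ 'q" and c
      using pd[OF that, of c] by (simp only: quad_form_def isotropic_kernel_def)
    have pos: "0 < (\<Sum>i<n. \<Sum>j<n. c i * cnj (c j) * ?K (x i) (x j))"
      if x: "x ` {..<n} \<subseteq> sphere 0 1" "inj_on x {..<n}" and c: "\<exists>i<n. c i \<noteq> 0"
      for n and x :: "nat \<Rightarrow> complex ^ 'q" and c
    proof -
      have ne: "quad_form {..<n} (?A x) c \<noteq> 0"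
        using coefficients_zero_if_quad_form_zero[OF F G assms(4,5) _ _ x, of c] prog c by blast
      have "0 < quad_form {..<n} (?A x) c"
        by (rule order.not_eq_order_implies_strict[OF ne[symmetric] pd[OF x(1)]])
      then show ?thesis by (simp only: quad_form_def isotropic_kernel_def)
    qed
    show "strictly_positive_definite ?K"
      unfolding strictly_positive_definite_def positive_definite_def
      by (intro conjI allI impI; (rule nonneg pos; assumption))
  }
qed

end
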